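(* For every standard rational $\epsilon>0$ there exists a model of $$T^1_2(R) + \exists n\,\Big(\forall m \leq n^{1-\epsilon}\ PHP^{m+1}_m(\Delta^b_1(R)) \ \wedge\ \neg PHP^{n+1}_n(R)\Big).$$
   Context: Language $L$: constants $0,1$; unary $\lfloor x/2\rfloor$, $|x|$ (bit-length); binary $+,\cdot$, $x\#y=2^{|x|\cdot|y|}$; relation $<$; $L(R)$ adds a binary relation symbol $R$. A quantifier is sharply bounded if of form $\forall x<|t|$ or $\exists x<|t|$. $\Sigma^b_1(R)$-formulas are built from atomic $L(R)$-formulas by connectives and sharply bounded quantifiers, with bounded existential quantifiers $\exists x<t$ in front; $\Pi^b_1(R)$ dually. $S^1_2(R)$ is the base theory BASIC plus polynomial induction for $\Sigma^b_1(R)$-formulas; $T^1_2(R)$ is BASIC plus ordinary induction for $\Sigma^b_1(R)$-formulas (with parameters). A $\Delta^b_1(R)$-formula is a $\Sigma^b_1(R)$-formula provably equivalent in $S^1_2(R)$ to a $\Pi^b_1(R)$-formula. For a formula $\phi(x,y)$, $PHP^p_h(\phi)$ is the disjunction of: $\exists a<p\,\forall b<h\,\neg\phi(a,b)$; $\exists a\neq a'<p\,\exists b<h\,(\phi(a,b)\wedge\phi(a',b))$; $\exists a<p\,\exists b\neq b'<h\,(\phi(a,b)\wedge\phi(a,b'))$. "$\forall m\leq n^{1-\epsilon}\,PHP^{m+1}_m(\Delta^b_1(R))$" denotes the scheme of statements $\forall m\leq n^{1-\epsilon}\,PHP^{m+1}_m(\phi)$ for all $\Delta^b_1(R)$-formulas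 $\phi(x,y)$ (possibly with further parameters), where $m\leq n^{1-\epsilon}$ is expressed in the obvious arithmetical way (e.g. $m^q\leq n^p$ for $1-\epsilon=p/q$). *)

theory Defs
  imports Complex_Main
begin

section \<open>The language \<open>L(R)\<close>, with de Bruijn indices\<close>

datatype trm =
    Var nat
  | Zero
  | One
  | Half trm
  | Len trm
  | Add trm trm
  | Mul trm trm
  | Smash trm trm

datatype form =
    Falsum
  | Eq trm trm
  | Less trm trm
  | Rel trm trm
  | And form form
  | Or form form
  | Imp form form
  | All form
  | Ex form

abbreviation Neg :: "form \<Rightarrow> form" where
  "Neg \<phi> \<equiv> Imp \<phi> Falsum"

abbreviation Iff :: "form \<Rightarrow> form \<Rightarrow> form" where
  "Iff \<phi> \<psi> \<equiv> And (Imp \<phi> \<psi>) (Imp \<psi> \<phi>)"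

abbreviation Leq :: "trm \<Rightarrow> trm \<Rightarrow> form" where
  "Leq s t \<equiv> Or (Less s t) (Eq s t)"

abbreviation Two :: trm where
  "Two \<equiv> Add One One"

primrec pow :: "trm \<Rightarrow> nat \<Rightarrow> trm" where
  "pow t 0 = One"
| "pow t (Suc k) = Mul t (pow t k)"

primrec tsubst :: "(nat \<Rightarrow> trm) \<Rightarrow> trm \<Rightarrow> trm" where
  "tsubst \<sigma> (Var i) = \<sigma> i"
| "tsubst \<sigma> Zero = Zero"
| "tsubst \<sigma> One = One"
| "tsubst \<sigma> (Half t) = Half (tsubst \<sigma> t)"
| "tsubst \<sigma> (Len t) = Len (tsubst \<sigma> t)"
| "tsubst \<sigma> (Add s t) = Add (tsubst \<sigma> s) (tsubst \<sigma> t)"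
| "tsubst \<sigma> (Mul s t) = Mul (tsubst \<sigma> s) (tsubst \<sigma> t)"
| "tsubst \<sigma> (Smash s t) = Smash (tsubst \<sigma> s) (tsubst \<sigma> t)"

abbreviation tlift :: "trm \<Rightarrow> trm" where
  "tlift \<equiv> tsubst (\<lambda>i. Var (Suc i))"

definition under_binder :: "(nat \<Rightarrow> trm) \<Rightarrow> nat \<Rightarrow> trm" where
  "under_binder \<sigma> = case_nat (Var 0) (\<lambda>i. tlift (\<sigma> i))"

primrec subst :: "(nat \<Rightarrow> trm) \<Rightarrow> form \<Rightarrow> form" where
  "subst \<sigma> Falsum = Falsum"
| "subst \<sigma> (Eq s t) = Eq (tsubst \<sigma> s) (tsubst \<sigma> t)"
| "subst \<sigma> (Less s t) = Less (tsubst \<sigma> s) (tsubst \<sigma> t)"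
| "subst \<sigma> (Rel s t) = Rel (tsubst \<sigma> s) (tsubst \<sigma> t)"
| "subst \<sigma> (And \<phi> \<psi>) = And (subst \<sigma> \<phi>) (subst \<sigma> \<psi>)"
| "subst \<sigma> (Or \<phi> \<psi>) = Or (subst \<sigma> \<phi>) (subst \<sigma> \<psi>)"
| "subst \<sigma> (Imp \<phi> \<psi>) = Imp (subst \<sigma> \<phi>) (subst \<sigma> \<psi>)"
| "subst \<sigma> (All \<phi>) = All (subst (under_binder \<sigma>) \<phi>)"
| "subst \<sigma> (Ex \<phi>) = Ex (subst (under_binder \<sigma>) \<phi>)"

abbreviation lift :: "form \<Rightarrow> form" where
  "lift \<equiv> subst (\<lambda>i. Var (Suc i))"

text \<open>Removes the outermost binder, substituting \<open>t\<close> for the variable it bound.\<close>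

definition inst :: "trm \<Rightarrow> form \<Rightarrow> form" where
  "inst t = subst (case_nat t Var)"


section \<open>Semantics\<close>

text \<open>The universe of a structure is the whole type \<open>'a\<close>, and \<open>Eq\<close> is interpreted as identity.
  As \<open>L(R)\<close> is countable and the theories considered have only infinite models, by the downward
  Loewenheim-Skolem theorem they have a model exactly if they have one with universe \<open>nat\<close>.\<close>

record 'a struct =
  zero_of :: 'a
  one_of :: 'a
  half_of :: "'a \<Rightarrow> 'a"
  len_of :: "'a \<Rightarrow> 'a"
  add_of :: "'a \<Rightarrow> 'a \<Rightarrow> 'a"
  mul_of :: "'a \<Rightarrow> 'a \<Rightarrow> 'a"
  smash_of :: "'a \<Rightarrow> 'a \<Rightarrow> 'a"
  less_of :: "'a \<Rightarrow> 'a \<Rightarrow> bool"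
  rel_of :: "'a \<Rightarrow> 'a \<Rightarrow> bool"

primrec tval :: "'a struct \<Rightarrow> (nat \<Rightarrow> 'a) \<Rightarrow> trm \<Rightarrow> 'a" where
  "tval M e (Var i) = e i"
| "tval M e Zero = zero_of M"
| "tval M e One = one_of M"
| "tval M e (Half t) = half_of M (tval M e t)"
| "tval M e (Len t) = len_of M (tval M e t)"
| "tval M e (Add s t) = add_of M (tval M e s) (tval M e t)"
| "tval M e (Mul s t) = mul_of M (tval M e s) (tval M e t)"
| "tval M e (Smash s t) = smash_of M (tval M e s) (tval M e t)"

primrec sat :: "'a struct \<Rightarrow> (nat \<Rightarrow> 'a) \<Rightarrow> form \<Rightarrow> bool" where
  "sat M e Falsum \<longleftrightarrow> False"
| "sat M e (Eq s t) \<longleftrightarrow> tval M e s = tval M e t"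
| "sat M e (Less s t) \<longleftrightarrow> less_of M (tval M e s) (tval M e t)"
| "sat M e (Rel s t) \<longleftrightarrow> rel_of M (tval M e s) (tval M e t)"
| "sat M e (And \<phi> \<psi>) \<longleftrightarrow> sat M e \<phi> \<and> sat M e \<psi>"
| "sat M e (Or \<phi> \<psi>) \<longleftrightarrow> sat M e \<phi> \<or> sat M e \<psi>"
| "sat M e (Imp \<phi> \<psi>) \<longleftrightarrow> (sat M e \<phi> \<longrightarrow> sat M e \<psi>)"
| "sat M e (All \<phi>) \<longleftrightarrow> (\<forall>x. sat M (case_nat x e) \<phi>)"
| "sat M e (Ex \<phi>) \<longleftrightarrow> (\<exists>x. sat M (case_nat x e) \<phi>)"

text \<open>Axioms may be open; their free variables are read universally, here and in \<open>proves\<close>.\<close>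

definition models :: "'a struct \<Rightarrow> form set \<Rightarrow> bool" where
  "models M T \<longleftrightarrow> (\<forall>\<phi>\<in>T. \<forall>e. sat M e \<phi>)"


section \<open>Provability: classical natural deduction with equality\<close>

inductive derives :: "form set \<Rightarrow> form list \<Rightarrow> form \<Rightarrow> bool" for T where
  axm: "\<phi> \<in> T \<Longrightarrow> derives T \<Gamma> \<phi>"
| hyp: "\<phi> \<in> set \<Gamma> \<Longrightarrow> derives T \<Gamma> \<phi>"
| contr: "derives T (Neg \<phi> # \<Gamma>) Falsum \<Longrightarrow> derives T \<Gamma> \<phi>"
| andI: "derives T \<Gamma> \<phi> \<Longrightarrow> derives T \<Gamma> \<psi> \<Longrightarrow> derives T \<Gamma> (And \<phi> \<psi>)"
| andE1: "derives T \<Gamma> (And \<phi> \<psi>) \<Longrightarrow> derives T \<Gamma> \<phi>"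
| andE2: "derives T \<Gamma> (And \<phi> \<psi>) \<Longrightarrow> derives T \<Gamma> \<psi>"
| orI1: "derives T \<Gamma> \<phi> \<Longrightarrow> derives T \<Gamma> (Or \<phi> \<psi>)"
| orI2: "derives T \<Gamma> \<psi> \<Longrightarrow> derives T \<Gamma> (Or \<phi> \<psi>)"
| orE: "derives T \<Gamma> (Or \<phi> \<psi>) \<Longrightarrow> derives T (\<phi> # \<Gamma>) \<chi> \<Longrightarrow> derives T (\<psi> # \<Gamma>) \<chi> \<Longrightarrow> derives T \<Gamma> \<chi>"
| impI: "derives T (\<phi> # \<Gamma>) \<psi> \<Longrightarrow> derives T \<Gamma> (Imp \<phi> \<psi>)"
| impE: "derives T \<Gamma> (Imp \<phi> \<psi>) \<Longrightarrow> derives T \<Gamma> \<phi> \<Longrightarrow> derives T \<Gamma> \<psi>"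
| allI: "derives T (map lift \<Gamma>) \<phi> \<Longrightarrow> derives T \<Gamma> (All \<phi>)"
| allE: "derives T \<Gamma> (All \<phi>) \<Longrightarrow> derives T \<Gamma> (inst t \<phi>)"
| exI: "derives T \<Gamma> (inst t \<phi>) \<Longrightarrow> derives T \<Gamma> (Ex \<phi>)"
| exE: "derives T \<Gamma> (Ex \<phi>) \<Longrightarrow> derives T (\<phi> # map lift \<Gamma>) (lift \<chi>) \<Longrightarrow> derives T \<Gamma> \<chi>"
| eqI: "derives T \<Gamma> (Eq t t)"
| eqE: "derives T \<Gamma> (Eq s t) \<Longrightarrow> derives T \<Gamma> (inst s \<phi>) \<Longrightarrow> derives T \<Gamma> (inst t \<phi>)"

definition proves :: "form set \<Rightarrow> form \<Rightarrow> bool" where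
  "proves T \<phi> \<longleftrightarrow> derives T [] \<phi>"


section \<open>Bounded formulas\<close>

text \<open>The bound \<open>t\<close> lives outside the quantifier, so it cannot mention the bound variable.\<close>

definition AllB :: "trm \<Rightarrow> form \<Rightarrow> form" where
  "AllB t \<phi> = All (Imp (Less (Var 0) (tlift t)) \<phi>)"

definition ExB :: "trm \<Rightarrow> form \<Rightarrow> form" where
  "ExB t \<phi> = Ex (And (Less (Var 0) (tlift t)) \<phi>)"

inductive sharply_bounded :: "form \<Rightarrow> bool" where
  "sharply_bounded Falsum"
| "sharply_bounded (Eq s t)"
| "sharply_bounded (Less s t)"
| "sharply_bounded (Rel s t)"
| "sharply_bounded \<phi> \<Longrightarrow> sharply_bounded \<psi> \<Longrightarrow> sharply_bounded (And \<phi> \<psi>)"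
| "sharply_bounded \<phi> \<Longrightarrow> sharply_bounded \<psi> \<Longrightarrow> sharply_bounded (Or \<phi> \<psi>)"
| "sharply_bounded \<phi> \<Longrightarrow> sharply_bounded \<psi> \<Longrightarrow> sharply_bounded (Imp \<phi> \<psi>)"
| "sharply_bounded \<phi> \<Longrightarrow> sharply_bounded (AllB (Len t) \<phi>)"
| "sharply_bounded \<phi> \<Longrightarrow> sharply_bounded (ExB (Len t) \<phi>)"

inductive Sigma_b1 :: "form \<Rightarrow> bool" where
  "sharply_bounded \<phi> \<Longrightarrow> Sigma_b1 \<phi>"
| "Sigma_b1 \<phi> \<Longrightarrow> Sigma_b1 (ExB t \<phi>)"

inductive Pi_b1 :: "form \<Rightarrow> bool" where
  "sharply_bounded \<phi> \<Longrightarrow> Pi_b1 \<phi>"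
| "Pi_b1 \<phi> \<Longrightarrow> Pi_b1 (AllB t \<phi>)"


section \<open>The theories \<open>S\<^sup>1\<^sub>2(R)\<close> and \<open>T\<^sup>1\<^sub>2(R)\<close>\<close>

text \<open>
  Buss's 32 axioms in his order, reading \<open>S a\<close> as \<open>a + 1\<close> and \<open>a \<le> b\<close> as \<open>a < b \<or> a = b\<close>.
  Since here \<open><\<close> rather than \<open>\<le>\<close> is primitive, irreflexivity of \<open><\<close> has to be added.
\<close>

definition BASIC :: "form set" where
  "BASIC = (let a = Var 0; b = Var 1; c = Var 2; d = Var 3 in
    { Neg (Less a a),
      Imp (Leq a b) (Leq a (Add b One)),
      Neg (Eq a (Add a One)),
      Leq Zero a,
      Iff (And (Leq a b) (Neg (Eq a b))) (Leq (Add a One) b),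
      Imp (Neg (Eq a Zero)) (Neg (Eq (Mul Two a) Zero)),
      Or (Leq a b) (Leq b a),
      Imp (And (Leq a b) (Leq b a)) (Eq a b),
      Imp (And (Leq a b) (Leq b c)) (Leq a c),
      Eq (Len Zero) Zero,
      Imp (Neg (Eq a Zero))
        (And (Eq (Len (Mul Two a)) (Add (Len a) One))
             (Eq (Len (Add (Mul Two a) One)) (Add (Len a) One))),
      Eq (Len One) One,
      Imp (Leq a b) (Leq (Len a) (Len b)),
      Eq (Len (Smash a b)) (Add (Mul (Len a) (Len b)) One),
      Eq (Smash Zero a) One,
      Imp (Neg (Eq a Zero))
        (And (Eq (Smash One (Mul Two a)) (Mul Two (Smash One a)))
             (Eq (Smash One (Add (Mul Two a) One)) (Mul Two (Smash One a)))),
      Eq (Smash a b) (Smash b a),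
      Imp (Eq (Len a) (Len b)) (Eq (Smash a c) (Smash b c)),
      Imp (Eq (Len a) (Add (Len b) (Len c))) (Eq (Smash a d) (Mul (Smash b d) (Smash c d))),
      Leq a (Add a b),
      Imp (And (Leq a b) (Neg (Eq a b)))
        (And (Leq (Add (Mul Two a) One) (Mul Two b))
             (Neg (Eq (Add (Mul Two a) One) (Mul Two b)))),
      Eq (Add a b) (Add b a),
      Eq (Add a Zero) a,
      Eq (Add a (Add b One)) (Add (Add a b) One),
      Eq (Add (Add a b) c) (Add a (Add b c)),
      Iff (Leq (Add a b) (Add a c)) (Leq b c),
      Eq (Mul a Zero) Zero,
      Eq (Mul a (Add b One)) (Add (Mul a b) a),
      Eq (Mul a b) (Mul b a),
      Eq (Mul a (Add b c)) (Add (Mul a b) (Mul a c)),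
      Imp (Leq One a) (Iff (Leq (Mul a b) (Mul a c)) (Leq b c)),
      Imp (Neg (Eq a Zero)) (Eq (Len a) (Add (Len (Half a)) One)),
      Iff (Eq a (Half b)) (Or (Eq (Mul Two a) b) (Eq (Add (Mul Two a) One) b)) })"

text \<open>
  In both schemes the induction variable of \<open>\<phi>\<close> is \<open>Var 0\<close>; the other free variables of \<open>\<phi>\<close>
  are parameters.
\<close>

definition IND :: "form \<Rightarrow> form" where
  "IND \<phi> = Imp (And (inst Zero \<phi>)
                     (All (Imp \<phi> (subst (case_nat (Add (Var 0) One) (\<lambda>i. Var (Suc i))) \<phi>))))
                (All \<phi>)"

definition PIND :: "form \<Rightarrow> form" where
  "PIND \<phi> = Imp (And (inst Zero \<phi>)
                      (All (Imp (subst (case_nat (Half (Var 0)) (\<lambda>i. Var (Suc i))) \<phi>) \<phi>)))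
                 (All \<phi>)"

definition S12 :: "form set" where
  "S12 = BASIC \<union> {PIND \<phi> | \<phi>. Sigma_b1 \<phi>}"

definition T12 :: "form set" where
  "T12 = BASIC \<union> {IND \<phi> | \<phi>. Sigma_b1 \<phi>}"

definition Delta_b1 :: "form \<Rightarrow> bool" where
  "Delta_b1 \<phi> \<longleftrightarrow> Sigma_b1 \<phi> \<and> (\<exists>\<psi>. Pi_b1 \<psi> \<and> proves S12 (Iff \<phi> \<psi>))"


section \<open>The pigeonhole principle\<close>

text \<open>
  A formula \<open>\<phi>(x,y)\<close> has \<open>x = Var 0\<close>, \<open>y = Var 1\<close>, and parameters \<open>Var (j + 2)\<close>, which become
  \<open>Var j\<close> of the surrounding context.  \<open>app2 k \<phi> s t\<close> is \<open>\<phi>(s,t)\<close> placed under \<open>k\<close> further binders.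
\<close>

definition app2 :: "nat \<Rightarrow> form \<Rightarrow> trm \<Rightarrow> trm \<Rightarrow> form" where
  "app2 k \<phi> s t = subst (case_nat s (case_nat t (\<lambda>j. Var (j + k)))) \<phi>"

definition PHP :: "trm \<Rightarrow> trm \<Rightarrow> form \<Rightarrow> form" where
  "PHP p h \<phi> =
     Or (ExB p (AllB (tlift h) (Neg (app2 2 \<phi> (Var 1) (Var 0)))))
    (Or (ExB p (ExB (tlift p) (And (Neg (Eq (Var 1) (Var 0)))
          (ExB (tlift (tlift h)) (And (app2 3 \<phi> (Var 2) (Var 0)) (app2 3 \<phi> (Var 1) (Var 0)))))))
        (ExB p (ExB (tlift h) (ExB (tlift (tlift h)) (And (Neg (Eq (Var 1) (Var 0)))
          (And (app2 3 \<phi> (Var 2) (Var 1)) (app2 3 \<phi> (Var 2) (Var 0))))))))"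

text \<open>
  \<open>m \<le> n\<^sup>r\<close>, cleared of the exponent's denominator, and for \<open>r < 0\<close> also of the negative exponent.
\<close>

definition leq_pow :: "rat \<Rightarrow> trm \<Rightarrow> trm \<Rightarrow> form" where
  "leq_pow r m n = (case quotient_of r of (p, q) \<Rightarrow>
     if p \<ge> 0 then Leq (pow m (nat q)) (pow n (nat p))
     else Leq (Mul (pow m (nat q)) (pow n (nat (- p)))) One)"

text \<open>
  \<open>\<forall>m \<le> n\<^sup>r. PHP\<^sup>m\<^sup>+\<^sup>1\<^sub>m(\<phi>)\<close> with \<open>n = Var 0\<close>.  The parameters of \<open>\<phi>\<close> are first moved past
  \<open>m\<close> and \<open>n\<close>, so that they are the variables \<open>Var (j + 1)\<close> of the resulting formula.
\<close>

definition PHP_below :: "rat \<Rightarrow> form \<Rightarrow> form" where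
  "PHP_below r \<phi> = All (Imp (leq_pow r (Var 0) (Var 1))
     (PHP (Add (Var 0) One) (Var 0) (app2 4 \<phi> (Var 0) (Var 1))))"

end

theory Submission
  imports Defs "HOL-Library.Countable" "HOL-Library.Infinite_Set"
begin

text \<open>
  The model is a forcing extension of a countable piece of an ultrapower of the standard model, in
  which the element \<open>n\<close> is represented by the identity function.  Its elements are functions whose
  value at \<open>k\<close> has bit-length polylogarithmic in \<open>k\<close>.  A condition consists of an infinite set \<open>A\<close>
  of indices and, for every \<open>k \<in> A\<close>, a partial injection of polylogarithmic size from \<open>k + 1\<close>
  pigeons to \<open>k\<close> holes, which approximates \<open>R\<close>.  A true \<open>\<Sigma>\<^sup>b\<^sub>1(R)\<close>-formula depends
  on polylogarithmically many values of \<open>R\<close>, so it can be forced by a small extension.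

  Induction for \<open>\<phi>\<close> costs a single extension: force \<open>\<phi>(x)\<close> for the largest \<open>x\<close> for which this is
  possible; then \<open>\<not>\<phi>(x + 1)\<close> is forced as well.

  Suppose that \<open>\<phi>\<close> is forced to be an injection from \<open>m + 1\<close> to \<open>m\<close>.  Certificates for different
  values \<open>\<phi>(a) = b\<close> and \<open>\<phi>(a) = b'\<close> conflict, so by repeatedly querying two such certificates the
  value of \<open>\<phi>(a)\<close> is determined by a decision tree of polylogarithmic depth.  If
  \<open>m \<le> k\<^sup>1\<^sup>-\<^sup>\<epsilon>\<close>, all \<open>m + 1\<close> trees together make fewer than \<open>k\<close> queries, so a single
  partial injection can answer all of them.  By the pigeonhole principle two trees then return the
  same value, contradicting injectivity.
\<close>

text \<open>The growth rate is dictated by \<open>#\<close>, which multiplies bit-lengths: the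
  lengths must be closed under products, and polylogarithmic ones are. A sharply bounded quantifier
  then has so few instances that all of them are settled by one small set of pairs. No ultrafilter
  is chosen in advance. Each requirement offers finitely many alternatives at every index, and the
  index set is thinned to an infinite set on which the same alternative is taken. The resulting
  filter decides the formulas of the class \<open>Sig\<close>, and a version of Los's theorem is
  proved for that class; induction and the pigeonhole principle are unfolded in the model down to
  such formulas. The obstacle is that totality of \<phi>, for all a some b, is not something a small
  extension can force. Hence the pigeonhole argument is run in single worlds and contrapositively:
  if every small extension left each pigeon a possible hole, there would be enough certificates for
  all decision trees to return a value. So some small extension leaves a pigeon without any hole,
  and this pigeon joins the model as a new element, refuting totality there.\<close>

instance trm :: countable
  by countable_datatype

instance form :: countable
  by countable_datatype

section \<open>Substitution\<close>

lemma tval_tsubst: "tval M e (tsubst \<sigma> t) = tval M (\<lambda>i. tval M e (\<sigma> i)) t"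
  by (induction t) auto

lemma tval_tlift [simp]: "tval M (case_nat x e) (tlift t) = tval M e t"
  by (simp add: tval_tsubst)

lemma sat_subst: "sat M e (subst \<sigma> \<phi>) \<longleftrightarrow> sat M (\<lambda>i. tval M e (\<sigma> i)) \<phi>"
proof (induction \<phi> arbitrary: e \<sigma>)
  have eq: "(\<lambda>i. tval M (case_nat x e) (under_binder \<sigma> i)) = case_nat x (\<lambda>i. tval M e (\<sigma> i))"
    for x e \<sigma>
    by (auto simp: under_binder_def fun_eq_iff split: nat.split)
  case (All \<phi>)
  then show ?case by (simp add: eq)
next
  have eq: "(\<lambda>i. tval M (case_nat x e) (under_binder \<sigma> i)) = case_nat x (\<lambda>i. tval M e (\<sigma> i))"
    for x e \<sigma>
    by (auto simp: under_binder_def fun_eq_iff split: nat.split)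
  case (Ex \<phi>)
  then show ?case by (simp add: eq)
qed (auto simp: tval_tsubst)

lemma sat_inst: "sat M e (inst t \<phi>) \<longleftrightarrow> sat M (case_nat (tval M e t) e) \<phi>"
proof -
  have "(\<lambda>i. tval M e (case_nat t Var i)) = case_nat (tval M e t) e"
    by (auto simp: fun_eq_iff split: nat.split)
  then show ?thesis by (simp add: inst_def sat_subst)
qed

lemma sat_AllB: "sat M e (AllB t \<phi>) \<longleftrightarrow>
    (\<forall>x. less_of M x (tval M e t) \<longrightarrow> sat M (case_nat x e) \<phi>)"
  by (simp add: AllB_def)

lemma sat_ExB: "sat M e (ExB t \<phi>) \<longleftrightarrow>
    (\<exists>x. less_of M x (tval M e t) \<and> sat M (case_nat x e) \<phi>)"
  by (simp add: ExB_def)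

lemma tsubst_under_binder: "tsubst (under_binder \<sigma>) (tlift t) = tlift (tsubst \<sigma> t)"
  by (induction t) (auto simp: under_binder_def)

lemma subst_ExB: "subst \<sigma> (ExB t \<phi>) = ExB (tsubst \<sigma> t) (subst (under_binder \<sigma>) \<phi>)"
  by (simp add: ExB_def tsubst_under_binder) (simp add: under_binder_def)

lemma subst_AllB: "subst \<sigma> (AllB t \<phi>) = AllB (tsubst \<sigma> t) (subst (under_binder \<sigma>) \<phi>)"
  by (simp add: AllB_def tsubst_under_binder) (simp add: under_binder_def)

lemma sharply_bounded_subst: "sharply_bounded \<phi> \<Longrightarrow> sharply_bounded (subst \<sigma> \<phi>)"
  by (induction arbitrary: \<sigma> rule: sharply_bounded.induct)
    (auto simp: subst_AllB subst_ExB intro: sharply_bounded.intros)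

section \<open>Dependence of terms and formulas on finitely many variables\<close>

primrec tbound :: "trm \<Rightarrow> nat" where
  "tbound (Var i) = Suc i"
| "tbound Zero = 0"
| "tbound One = 0"
| "tbound (Half t) = tbound t"
| "tbound (Len t) = tbound t"
| "tbound (Add s t) = max (tbound s) (tbound t)"
| "tbound (Mul s t) = max (tbound s) (tbound t)"
| "tbound (Smash s t) = max (tbound s) (tbound t)"

text \<open>Binders do not lower the bound: an overestimate of the free variables is enough, and it
  keeps the recursion simple.\<close>

primrec fbound :: "form \<Rightarrow> nat" where
  "fbound Falsum = 0"
| "fbound (Eq s t) = max (tbound s) (tbound t)"
| "fbound (Less s t) = max (tbound s) (tbound t)"
| "fbound (Rel s t) = max (tbound s) (tbound t)"
| "fbound (And \<phi> \<psi>) = max (fbound \<phi>) (fbound \<psi>)"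
| "fbound (Or \<phi> \<psi>) = max (fbound \<phi>) (fbound \<psi>)"
| "fbound (Imp \<phi> \<psi>) = max (fbound \<phi>) (fbound \<psi>)"
| "fbound (All \<phi>) = fbound \<phi>"
| "fbound (Ex \<phi>) = fbound \<phi>"

lemma tval_cong: "(\<And>i. i < tbound t \<Longrightarrow> e i = e' i) \<Longrightarrow> tval M e t = tval M e' t"
proof (induction t)
  case (Add s t)
  then have "tval M e s = tval M e' s" "tval M e t = tval M e' t" by auto
  then show ?case by simp
next
  case (Mul s t)
  then have "tval M e s = tval M e' s" "tval M e t = tval M e' t" by auto
  then show ?case by simp
next
  case (Smash s t)
  then have "tval M e s = tval M e' s" "tval M e t = tval M e' t" by auto
  then show ?case by simp
qed auto

lemma sat_cong: "(\<And>i. i < fbound \<phi> \<Longrightarrow> e i = e' i) \<Longrightarrow> sat M e \<phi> \<longleftrightarrow> sat M e' \<phi>"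
proof (induction \<phi> arbitrary: e e')
  case (Eq s t)
  have "tval M e s = tval M e' s" "tval M e t = tval M e' t"
    by (rule tval_cong, rule Eq, simp)+
  then show ?case by simp
next
  case (Less s t)
  have "tval M e s = tval M e' s" "tval M e t = tval M e' t"
    by (rule tval_cong, rule Less, simp)+
  then show ?case by simp
next
  case (Rel s t)
  have "tval M e s = tval M e' s" "tval M e t = tval M e' t"
    by (rule tval_cong, rule Rel, simp)+
  then show ?case by simp
next
  case (And \<phi> \<psi>)
  have "sat M e \<phi> = sat M e' \<phi>" "sat M e \<psi> = sat M e' \<psi>"
    by (rule And.IH, rule And.prems, simp)+
  then show ?case by simp
next
  case (Or \<phi> \<psi>)
  have "sat M e \<phi> = sat M e' \<phi>" "sat M e \<psi> = sat M e' \<psi>"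
    by (rule Or.IH, rule Or.prems, simp)+
  then show ?case by simp
next
  case (Imp \<phi> \<psi>)
  have "sat M e \<phi> = sat M e' \<phi>" "sat M e \<psi> = sat M e' \<psi>"
    by (rule Imp.IH, rule Imp.prems, simp)+
  then show ?case by simp
next
  case (All \<phi>)
  have "sat M (case_nat x e) \<phi> = sat M (case_nat x e') \<phi>" for x
  proof (rule All.IH)
    show "case_nat x e i = case_nat x e' i" if "i < fbound \<phi>" for i
      using that All.prems[of "i - 1"] by (cases i) auto
  qed
  then show ?case by simp
next
  case (Ex \<phi>)
  have "sat M (case_nat x e) \<phi> = sat M (case_nat x e') \<phi>" for x
  proof (rule Ex.IH)
    show "case_nat x e i = case_nat x e' i" if "i < fbound \<phi>" for i
      using that Ex.prems[of "i - 1"] by (cases i) auto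
  qed
  then show ?case by simp
qed auto

section \<open>Standard worlds and polylogarithmic bounds\<close>

fun blen :: "nat \<Rightarrow> nat" where
  "blen n = (if n = 0 then 0 else Suc (blen (n div 2)))"

declare blen.simps [simp del]

lemma blen_0 [simp]: "blen 0 = 0"
  by (subst blen.simps) simp

lemma blen_rec: "n \<noteq> 0 \<Longrightarrow> blen n = Suc (blen (n div 2))"
  by (subst blen.simps) simp

text \<open>This equivalence determines \<open>blen\<close>; the estimates for powers, sums and
  products below are read off from it.\<close>

lemma blen_le_iff: "blen n \<le> l \<longleftrightarrow> n < 2 ^ l"
proof (induction n arbitrary: l rule: blen.induct)
  case (1 n)
  show ?case
  proof (cases "n = 0")
    case False
    have half: "n div 2 < a \<longleftrightarrow> n < 2 * a" for a :: nat
      by arith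
    show ?thesis
    proof (cases l)
      case 0
      with False show ?thesis by (simp add: blen_rec[OF False])
    next
      case (Suc l')
      then show ?thesis
        using 1[OF False, of l'] by (simp only: blen_rec[OF False] Suc_le_mono half power_Suc)
    qed
  qed simp
qed

lemma blen_double: "n \<noteq> 0 \<Longrightarrow> blen (2 * n) = Suc (blen n)" "blen (2 * n + 1) = Suc (blen n)"
  by (subst blen_rec; simp)+

lemma blen_power2 [simp]: "blen (2 ^ l) = Suc l"
proof -
  have "blen (2 ^ l) \<le> Suc l" "\<not> blen (2 ^ l) \<le> l" by (auto simp: blen_le_iff)
  then show ?thesis by simp
qed

lemma blen_mono: "m \<le> n \<Longrightarrow> blen m \<le> blen n"
  by (meson blen_le_iff le_less_trans order_refl)

lemma less_power_blen: "n < 2 ^ blen n"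
  using blen_le_iff[of n "blen n"] by simp

lemma blen_le: "blen n \<le> n"
  by (simp add: blen_le_iff)

lemma blen_add: "blen (m + n) \<le> blen m + blen n + 1"
proof -
  have "(2::nat) ^ blen m \<le> 2 ^ (blen m + blen n)" "(2::nat) ^ blen n \<le> 2 ^ (blen m + blen n)"
    by (simp_all add: power_increasing)
  then have "m < 2 ^ (blen m + blen n)" "n < 2 ^ (blen m + blen n)"
    using less_power_blen[of m] less_power_blen[of n] by linarith+
  then show ?thesis by (simp add: blen_le_iff)
qed

lemma blen_mult: "blen (m * n) \<le> blen m + blen n"
  unfolding blen_le_iff power_add
  by (intro mult_strict_mono) (simp_all add: less_power_blen)

definition std :: "(nat \<times> nat) set \<Rightarrow> nat struct" where
  "std R = \<lparr>zero_of = 0, one_of = 1, half_of = (\<lambda>x. x div 2), len_of = blen, add_of = (+),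
     mul_of = (*), smash_of = (\<lambda>x y. 2 ^ (blen x * blen y)), less_of = (<),
     rel_of = (\<lambda>x y. (x, y) \<in> R)\<rparr>"

lemma std_sel [simp]:
  "zero_of (std R) = 0" "one_of (std R) = 1" "half_of (std R) = (\<lambda>x. x div 2)"
  "len_of (std R) = blen" "add_of (std R) = (+)" "mul_of (std R) = (*)"
  "smash_of (std R) = (\<lambda>x y. 2 ^ (blen x * blen y))" "less_of (std R) = (<)"
  "rel_of (std R) = (\<lambda>x y. (x, y) \<in> R)"
  by (simp_all add: std_def)

primrec tv :: "(nat \<Rightarrow> nat) \<Rightarrow> trm \<Rightarrow> nat" where
  "tv e (Var i) = e i"
| "tv e Zero = 0"
| "tv e One = 1"
| "tv e (Half t) = tv e t div 2"
| "tv e (Len t) = blen (tv e t)"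
| "tv e (Add s t) = tv e s + tv e t"
| "tv e (Mul s t) = tv e s * tv e t"
| "tv e (Smash s t) = 2 ^ (blen (tv e s) * blen (tv e t))"

lemma tval_std [simp]: "tval (std R) e t = tv e t"
  by (induction t) auto

lemma tv_tlift [simp]: "tv (case_nat x e) (tlift t) = tv e t"
  by (simp only: tval_tlift flip: tval_std[of "{}"])

lemma tv_mono: "(\<And>i. e i \<le> e' i) \<Longrightarrow> tv e t \<le> tv e' t"
  by (induction t) (auto simp: div_le_mono blen_mono intro!: add_mono mult_mono power_increasing)

lemma std_BASIC: "\<phi> \<in> BASIC \<Longrightarrow> sat (std R) e \<phi>"
proof -
  have one: "blen (Suc 0) = Suc 0"
    using blen_power2[of 0] by simp
  have double: "n > 0 \<Longrightarrow> blen (n + n) = Suc (blen n)" "blen (Suc (n + n)) = Suc (blen n)" for n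
    using blen_double[of n] by (simp_all add: mult_2)
  have mono: "m < n \<Longrightarrow> blen m < blen n \<or> blen m = blen n" for m n
    using blen_mono[of m n] by auto
  have half: "n > 0 \<Longrightarrow> blen n = Suc (blen (n div 2))" for n
    by (rule blen_rec) simp
  assume "\<phi> \<in> BASIC"
  then show ?thesis
    unfolding BASIC_def Let_def
    apply (elim insertE emptyE; hypsubst; simp only: sat.simps tval.simps std_sel)
    apply (simp_all add: one double mono half[symmetric] add_mult_distrib power_add algebra_simps)
    apply arith+
    done
qed

text \<open>The axioms are quantifier-free, so truth for sharply bounded formulas will carry them
  from the worlds to the model.\<close>

lemma BASIC_sharply: "\<phi> \<in> BASIC \<Longrightarrow> sharply_bounded \<phi>"
  unfolding BASIC_def Let_def
  by (elim insertE emptyE; simp only:; intro sharply_bounded.intros)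

section \<open>Polylogarithmic growth\<close>

definition polylog :: "(nat \<Rightarrow> nat) \<Rightarrow> bool" where
  "polylog f \<longleftrightarrow> (\<exists>c. \<forall>k. f k \<le> (blen k + 2) ^ c)"

lemma polylog_mono: "polylog f \<Longrightarrow> (\<And>k. g k \<le> f k) \<Longrightarrow> polylog g"
  unfolding polylog_def by (meson le_trans)

text \<open>The base \<open>blen k + 2\<close> is at least 2 even at \<open>k = 0\<close>; for this
  reason constants, and below also sums, are absorbed by a larger exponent.\<close>

lemma polylog_const [simp]: "polylog (\<lambda>k. a)"
proof -
  have "a \<le> (blen k + 2) ^ a" for k
  proof -
    have "a \<le> 2 ^ a" by simp
    also have "\<dots> \<le> (blen k + 2) ^ a" by (intro power_mono) auto
    finally show ?thesis .
  qed
  then show ?thesis unfolding polylog_def by blast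
qed

lemma polylog_blen: "polylog blen"
  unfolding polylog_def by (intro HOL.exI[of _ 1]) simp

lemma polylog_mult:
  assumes "polylog f" "polylog g"
  shows "polylog (\<lambda>k. f k * g k)"
proof -
  obtain c d where "\<forall>k. f k \<le> (blen k + 2) ^ c" "\<forall>k. g k \<le> (blen k + 2) ^ d"
    using assms unfolding polylog_def by blast
  then have "f k * g k \<le> (blen k + 2) ^ (c + d)" for k
    unfolding power_add by (simp add: mult_mono)
  then show ?thesis unfolding polylog_def by blast
qed

text \<open>Sums reduce to products by \<open>f + g \<le> (f + 1) * (g + 1)\<close>, and adding 1
  costs one exponent.\<close>

lemma polylog_add:
  assumes "polylog f" "polylog g"
  shows "polylog (\<lambda>k. f k + g k)"
proof -
  have "polylog (\<lambda>k. (f k + 1) * (g k + 1))" if "polylog (\<lambda>k. f k + 1)" "polylog (\<lambda>k. g k + 1)"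
    using that by (rule polylog_mult)
  moreover have "polylog (\<lambda>k. f k + 1)" if f: "polylog f" for f
  proof -
    obtain c where c: "\<forall>k. f k \<le> (blen k + 2) ^ c"
      using f unfolding polylog_def by blast
    have "f k + 1 \<le> (blen k + 2) ^ (c + 1)" for k
    proof -
      have "f k + 1 \<le> (blen k + 2) ^ c + (blen k + 2) ^ c"
        using c by (intro add_mono) auto
      also have "\<dots> \<le> (blen k + 2) ^ (c + 1)"
        by (simp add: algebra_simps)
      finally show ?thesis .
    qed
    then show ?thesis unfolding polylog_def by blast
  qed
  ultimately have "polylog (\<lambda>k. (f k + 1) * (g k + 1))"
    using assms by blast
  then show ?thesis
    by (rule polylog_mono) simp
qed

lemma polylog_power: "polylog f \<Longrightarrow> polylog (\<lambda>k. f k ^ c)"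
  by (induction c) (auto intro: polylog_mult)

lemma power_le_two_power: "\<exists>N. \<forall>l\<ge>N. (l + 2) ^ c < (2::nat) ^ (l - 1)"
proof -
  \<comment> \<open>By this choice the \<open>Suc c\<close>-th power of the null sequence
    \<open>x * y ^ x\<close> is \<open>x ^ Suc c / 2 ^ x\<close>.\<close>
  define y :: real where "y = root (Suc c) (1 / 2)"
  have y: "0 < y" "y < 1" "y ^ Suc c = 1 / 2"
    by (simp_all add: y_def real_root_pow_pos2 del: power_Suc)
  have "(\<lambda>x. (real x * y ^ x) ^ Suc c) \<longlonglongrightarrow> 0 ^ Suc c"
    by (intro tendsto_power powser_times_n_limit_0) (use y in auto)
  moreover have "(real x * y ^ x) ^ Suc c = real x ^ Suc c * (1 / 2) ^ x" for x
    unfolding power_mult_distrib y(3)[symmetric] power_mult[symmetric] by (simp only: mult.commute)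
  ultimately have "(\<lambda>x. real x ^ Suc c * (1 / 2) ^ x) \<longlonglongrightarrow> 0"
    by (simp del: power_Suc)
  then have "((\<lambda>x. real (x + 2) ^ Suc c * (1 / 2) ^ (x + 2)) \<longlonglongrightarrow> 0)"
    by (rule LIMSEQ_ignore_initial_segment)
  \<comment> \<open>The shift by 2 matches the base \<open>l + 2\<close> of the claim, and
    \<open>1 / 8\<close> is \<open>2 ^ (l - 1) / 2 ^ (l + 2)\<close>.\<close>
  then have "\<forall>\<^sub>F x in sequentially. real (x + 2) ^ Suc c * (1 / 2) ^ (x + 2) < 1 / 8"
    by (rule order_tendstoD) simp
  then obtain N where N: "real (x + 2) ^ Suc c * (1 / 2) ^ (x + 2) < 1 / 8" if "x \<ge> N" for x
    unfolding eventually_sequentially by blast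
  have "(l + 2) ^ c < (2::nat) ^ (l - 1)" if "l \<ge> N + 1" for l
  proof -
    have "(1 / 2 :: real) ^ (l + 2) = 1 / (8 * 2 ^ (l - 1))"
      using that by (cases l) (auto simp: field_simps)
    then have "real (l + 2) ^ Suc c < 2 ^ (l - 1)"
      using N[of l] that by (simp add: field_simps del: power_Suc of_nat_add)
    then have "real ((l + 2) ^ Suc c) < real (2 ^ (l - 1))"
      by (simp del: power_Suc of_nat_add)
    moreover have "(l + 2) ^ c \<le> (l + 2) ^ Suc c"
      by (intro power_increasing) auto
    ultimately show ?thesis
      by linarith
  qed
  then show ?thesis by blast
qed

text \<open>For \<open>k > 0\<close> one has \<open>2 ^ (blen k - 1) \<le> k\<close>, and this
  exponential in \<open>blen k\<close> eventually beats any fixed power of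
  \<open>blen k + 2\<close>.\<close>

lemma polylog_less:
  assumes "polylog f"
  shows "\<exists>K. \<forall>k\<ge>K. f k < k"
proof -
  obtain c where c: "\<forall>k. f k \<le> (blen k + 2) ^ c"
    using assms unfolding polylog_def by blast
  obtain N where N: "\<forall>l\<ge>N. (l + 2) ^ c < (2::nat) ^ (l - 1)"
    using power_le_two_power by blast
  have "f k < k" if k: "k \<ge> 2 ^ N" for k
  proof -
    have N': "\<not> blen k \<le> N"
      using k by (simp add: blen_le_iff)
    then have "\<not> blen k \<le> blen k - 1" by linarith
    then have "2 ^ (blen k - 1) \<le> k"
      by (simp only: blen_le_iff not_less)
    moreover have "f k < 2 ^ (blen k - 1)"
      using c N N' by (meson le_less_trans nat_le_linear)
    ultimately show ?thesis by simp
  qed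
  then show ?thesis by blast
qed

abbreviation pb :: "(nat \<Rightarrow> nat) \<Rightarrow> bool" where
  "pb f \<equiv> polylog (\<lambda>k. blen (f k))"

text \<open>The case \<open>Smash\<close> is what demands polylogarithmic lengths: it multiplies
  bit-lengths, which a bound linear in \<open>blen k\<close> would not survive.\<close>

lemma pb_tv:
  assumes "\<And>i. pb (B i)"
  shows "pb (\<lambda>k. tv (\<lambda>i. B i k) t)"
proof (induction t)
  case (Add s t)
  show ?case
    using polylog_add[OF polylog_add[OF Add] polylog_const[of 1]]
    by (rule polylog_mono) (simp add: blen_add[simplified])
next
  case (Mul s t)
  show ?case
    using polylog_add[OF Mul] by (rule polylog_mono) (simp add: blen_mult)
next
  case (Smash s t)
  show ?case
    using polylog_add[OF polylog_mult[OF Smash] polylog_const[of 1]]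
    by (rule polylog_mono) simp
next
  case (Half t)
  show ?case
    using Half by (rule polylog_mono) (simp add: blen_mono)
next
  case (Len t)
  show ?case
    using Len by (rule polylog_mono) (simp add: blen_le)
qed (use assms in simp_all)

lemma case_nat_app: "(\<lambda>i. case_nat f E i k) = case_nat (f k) (\<lambda>i. E i k)"
  by (auto simp: fun_eq_iff split: nat.split)

lemma pb_case_nat: "pb f \<Longrightarrow> (\<And>i. pb (E i)) \<Longrightarrow> pb (case_nat f E i)"
  by (cases i) auto

section \<open>Partial injections and forcing in a single world\<close>

text \<open>\<open>{..k}\<close> has \<open>k + 1\<close> elements and \<open>{..<k}\<close> has
  \<open>k\<close>: the pigeons and holes for \<open>n = k\<close>.\<close>

definition pinj :: "nat \<Rightarrow> (nat \<times> nat) set \<Rightarrow> bool" where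
  "pinj k R \<longleftrightarrow> R \<subseteq> {..k} \<times> {..<k} \<and>
     (\<forall>i j j'. (i, j) \<in> R \<longrightarrow> (i, j') \<in> R \<longrightarrow> j = j') \<and>
     (\<forall>i i' j. (i, j) \<in> R \<longrightarrow> (i', j) \<in> R \<longrightarrow> i = i')"

text \<open>Maximality makes a negative fact \<open>(i, j) \<notin> R\<close> visible in \<open>R\<close> itself: some pair of \<open>R\<close>
  uses the pigeon \<open>i\<close> or the hole \<open>j\<close>.\<close>

definition maxinj :: "nat \<Rightarrow> (nat \<times> nat) set \<Rightarrow> bool" where
  "maxinj k R \<longleftrightarrow> pinj k R \<and> (\<forall>R'. pinj k R' \<longrightarrow> R \<subseteq> R' \<longrightarrow> R' = R)"

text \<open>Forcing is semantic, by truth in all maximal completions. Hence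
  \<open>Neg \<phi>\<close> is forced exactly if no completion satisfies \<phi>, and an unforced
  formula need not have a forced negation.\<close>

definition forces :: "nat \<Rightarrow> (nat \<times> nat) set \<Rightarrow> (nat \<Rightarrow> nat) \<Rightarrow> form \<Rightarrow> bool" where
  "forces k p e \<phi> \<longleftrightarrow> (\<forall>R. maxinj k R \<longrightarrow> p \<subseteq> R \<longrightarrow> sat (std R) e \<phi>)"

lemma pinj_subset: "pinj k R \<Longrightarrow> q \<subseteq> R \<Longrightarrow> pinj k q"
  unfolding pinj_def by blast

lemma pinj_finite: "pinj k R \<Longrightarrow> finite R"
  unfolding pinj_def using finite_subset by blast

lemma pinj_insert:
  assumes "pinj k R" "i \<le> k" "j < k" "\<And>j'. (i, j') \<notin> R" "\<And>i'. (i', j) \<notin> R"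
  shows "pinj k (insert (i, j) R)"
  using assms unfolding pinj_def by blast

lemma maxinj_extends: "pinj k p \<Longrightarrow> \<exists>R. maxinj k R \<and> p \<subseteq> R"
proof -
  assume p: "pinj k p"
  have "finite {R. pinj k R}"
    by (rule finite_subset[of _ "Pow ({..k} \<times> {..<k})"]) (auto simp: pinj_def)
  then obtain R where "R \<in> {R. pinj k R}" "p \<subseteq> R" "\<forall>R'\<in>{R. pinj k R}. R \<subseteq> R' \<longrightarrow> R = R'"
    using finite_has_maximal2[of "{R. pinj k R}" p] p by auto
  then show ?thesis unfolding maxinj_def by auto
qed

lemma maxinj_covers:
  assumes "maxinj k R" "i \<le> k" "j < k"
  shows "(\<exists>j'. (i, j') \<in> R) \<or> (\<exists>i'. (i', j) \<in> R)"
proof (rule ccontr)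
  assume "\<not> ?thesis"
  then have "pinj k (insert (i, j) R)"
    using assms unfolding maxinj_def by (intro pinj_insert) auto
  then have "insert (i, j) R = R"
    using assms unfolding maxinj_def by blast
  with \<open>\<not> ?thesis\<close> show False by blast
qed

lemma forces_mono: "forces k p e \<phi> \<Longrightarrow> p \<subseteq> q \<Longrightarrow> forces k q e \<phi>"
  unfolding forces_def by blast

text \<open>\<open>Q\<close> may depend on \<open>R\<close>: it is a set of queries certifying the
  truth value in this particular world.\<close>

definition locally :: "nat \<Rightarrow> (nat \<Rightarrow> nat) \<Rightarrow> (nat \<times> nat) set \<Rightarrow> form \<Rightarrow> bool" where
  "locally n e R \<phi> \<longleftrightarrow> (\<exists>Q. finite Q \<and> card Q \<le> n \<and>
     (\<forall>R'. R' \<inter> Q = R \<inter> Q \<longrightarrow> sat (std R') e \<phi> = sat (std R) e \<phi>))"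

lemma locally_mono: "locally m e R \<phi> \<Longrightarrow> m \<le> n \<Longrightarrow> locally n e R \<phi>"
  unfolding locally_def by (meson le_trans)

lemma locally_0: "(\<And>R'. sat (std R') e \<phi> = sat (std R) e \<phi>) \<Longrightarrow> locally 0 e R \<phi>"
  unfolding locally_def by (intro HOL.exI[of _ "{}"]) simp

lemma locally_combine:
  assumes "locally m e R \<phi>" "locally n e R \<psi>"
    and "\<And>R'. sat (std R') e \<phi> = sat (std R) e \<phi> \<Longrightarrow> sat (std R') e \<psi> = sat (std R) e \<psi> \<Longrightarrow>
      sat (std R') e \<chi> = sat (std R) e \<chi>"
  shows "locally (m + n) e R \<chi>"
proof -
  obtain P where P: "finite P" "card P \<le> m"
    "\<And>R'. R' \<inter> P = R \<inter> P \<Longrightarrow> sat (std R') e \<phi> = sat (std R) e \<phi>"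
    using assms(1) unfolding locally_def by blast
  obtain Q where Q: "finite Q" "card Q \<le> n"
    "\<And>R'. R' \<inter> Q = R \<inter> Q \<Longrightarrow> sat (std R') e \<psi> = sat (std R) e \<psi>"
    using assms(2) unfolding locally_def by blast
  have "card (P \<union> Q) \<le> m + n"
    using P(2) Q(2) card_Un_le[of P Q] by linarith
  moreover have "sat (std R') e \<chi> = sat (std R) e \<chi>" if "R' \<inter> (P \<union> Q) = R \<inter> (P \<union> Q)" for R'
    by (rule assms(3); rule P(3) Q(3)) (use that in blast)+
  ultimately show ?thesis
    unfolding locally_def using P(1) Q(1) by blast
qed

text \<open>The query sets of all \<open>l\<close> instances are united. The factor \<open>l\<close>
  is affordable for sharply bounded quantifiers because their range is polylogarithmic.\<close>

lemma locally_bounded_quantifier: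
  assumes "\<And>x. x < l \<Longrightarrow> locally m (case_nat x e) R \<phi>"
    and "\<And>R'. (\<And>x. x < l \<Longrightarrow> sat (std R') (case_nat x e) \<phi> = sat (std R) (case_nat x e) \<phi>) \<Longrightarrow>
      sat (std R') e \<chi> = sat (std R) e \<chi>"
  shows "locally (l * m) e R \<chi>"
proof -
  define good where "good x Q \<longleftrightarrow> finite Q \<and> card Q \<le> m \<and> (\<forall>R'. R' \<inter> Q = R \<inter> Q \<longrightarrow>
      sat (std R') (case_nat x e) \<phi> = sat (std R) (case_nat x e) \<phi>)" for x Q
  have "\<forall>x\<in>{..<l}. \<exists>Q. good x Q"
    using assms(1) unfolding locally_def good_def by blast
  then have "\<exists>Q. \<forall>x\<in>{..<l}. good x (Q x)"
    by (rule bchoice)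
  then obtain Q where "\<forall>x\<in>{..<l}. good x (Q x)" ..
  then have good: "x < l \<Longrightarrow> good x (Q x)" for x
    by blast
  then have Q: "x < l \<Longrightarrow> finite (Q x)" "x < l \<Longrightarrow> card (Q x) \<le> m" for x
    unfolding good_def by blast+
  have "card (\<Union>x<l. Q x) \<le> (\<Sum>x<l. card (Q x))"
    by (rule card_UN_le) simp
  also have "\<dots> \<le> (\<Sum>x<l. m)"
    by (rule sum_mono) (use Q in auto)
  finally have "card (\<Union>x<l. Q x) \<le> l * m" by simp
  moreover have "sat (std R') e \<chi> = sat (std R) e \<chi>"
    if R': "R' \<inter> (\<Union>x<l. Q x) = R \<inter> (\<Union>x<l. Q x)" for R'
  proof (rule assms(2))
    fix x assume "x < l"
    moreover from this R' have "R' \<inter> Q x = R \<inter> Q x" by blast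
    ultimately show "sat (std R') (case_nat x e) \<phi> = sat (std R) (case_nat x e) \<phi>"
      using good unfolding good_def by blast
  qed
  moreover have "finite (\<Union>x<l. Q x)"
    using Q by blast
  ultimately show ?thesis
    unfolding locally_def by blast
qed

definition local_on :: "(nat \<Rightarrow> nat \<Rightarrow> nat) \<Rightarrow> form \<Rightarrow> bool" where
  "local_on B \<phi> \<longleftrightarrow>
     (\<exists>d. polylog d \<and> (\<forall>k e R. (\<forall>i. e i \<le> B i k) \<longrightarrow> locally (d k) e R \<phi>))"

lemma local_onI:
  "polylog d \<Longrightarrow> (\<And>k e R. (\<And>i. e i \<le> B i k) \<Longrightarrow> locally (d k) e R \<phi>) \<Longrightarrow> local_on B \<phi>"
  unfolding local_on_def by blast

lemma local_onE:
  assumes "local_on B \<phi>"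
  obtains d where "polylog d" "\<And>k e R. (\<And>i. e i \<le> B i k) \<Longrightarrow> locally (d k) e R \<phi>"
  using assms unfolding local_on_def by blast

text \<open>The environment bound \<open>B\<close> makes the number of queries depend on
  \<open>k\<close> alone, uniformly in the values of the variables.\<close>

lemma sharply_bounded_local:
  assumes "sharply_bounded \<phi>" "\<And>i. pb (B i)"
  shows "local_on B \<phi>"
  using assms
proof (induction arbitrary: B rule: sharply_bounded.induct)
  case 1
  show ?case
    by (rule local_onI[OF polylog_const[of 0]]) (rule locally_0, simp)
next
  case (2 s t)
  show ?case
    by (rule local_onI[OF polylog_const[of 0]]) (rule locally_0, simp add: tval_std)
next
  case (3 s t)
  show ?case
    by (rule local_onI[OF polylog_const[of 0]]) (rule locally_0, simp add: tval_std)
next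
  case (4 s t)
  have "locally 1 e R (Rel s t)" for e R
    unfolding locally_def
    by (intro HOL.exI[of _ "{(tv e s, tv e t)}"]) (auto simp: tval_std)
  then show ?case by (intro local_onI[OF polylog_const[of 1]])
next
  case (5 \<phi> \<psi>)
  have "local_on B \<phi>"
    using 5(5) by (rule 5(3))
  then obtain d where d: "polylog d"
    "\<And>k e R. (\<And>i. e i \<le> B i k) \<Longrightarrow> locally (d k) e R \<phi>"
    by (rule local_onE) blast
  have "local_on B \<psi>"
    using 5(5) by (rule 5(4))
  then obtain d' where d': "polylog d'"
    "\<And>k e R. (\<And>i. e i \<le> B i k) \<Longrightarrow> locally (d' k) e R \<psi>"
    by (rule local_onE) blast
  show ?case
  proof (rule local_onI[OF polylog_add[OF d(1) d'(1)]])
    fix k e R assume e: "\<And>i. e i \<le> B i k"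
    show "locally (d k + d' k) e R (And \<phi> \<psi>)"
      by (rule locally_combine[OF d(2)[OF e] d'(2)[OF e]]) simp
  qed
next
  case (6 \<phi> \<psi>)
  have "local_on B \<phi>"
    using 6(5) by (rule 6(3))
  then obtain d where d: "polylog d"
    "\<And>k e R. (\<And>i. e i \<le> B i k) \<Longrightarrow> locally (d k) e R \<phi>"
    by (rule local_onE) blast
  have "local_on B \<psi>"
    using 6(5) by (rule 6(4))
  then obtain d' where d': "polylog d'"
    "\<And>k e R. (\<And>i. e i \<le> B i k) \<Longrightarrow> locally (d' k) e R \<psi>"
    by (rule local_onE) blast
  show ?case
  proof (rule local_onI[OF polylog_add[OF d(1) d'(1)]])
    fix k e R assume e: "\<And>i. e i \<le> B i k"
    show "locally (d k + d' k) e R (Or \<phi> \<psi>)"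
      by (rule locally_combine[OF d(2)[OF e] d'(2)[OF e]]) simp
  qed
next
  case (7 \<phi> \<psi>)
  have "local_on B \<phi>"
    using 7(5) by (rule 7(3))
  then obtain d where d: "polylog d"
    "\<And>k e R. (\<And>i. e i \<le> B i k) \<Longrightarrow> locally (d k) e R \<phi>"
    by (rule local_onE) blast
  have "local_on B \<psi>"
    using 7(5) by (rule 7(4))
  then obtain d' where d': "polylog d'"
    "\<And>k e R. (\<And>i. e i \<le> B i k) \<Longrightarrow> locally (d' k) e R \<psi>"
    by (rule local_onE) blast
  show ?case
  proof (rule local_onI[OF polylog_add[OF d(1) d'(1)]])
    fix k e R assume e: "\<And>i. e i \<le> B i k"
    show "locally (d k + d' k) e R (Imp \<phi> \<psi>)"
      by (rule locally_combine[OF d(2)[OF e] d'(2)[OF e]]) simp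
  qed
next
  case (8 \<phi> t)
  define b where "b k = tv (\<lambda>i. B i k) (Len t)" for k
  have "pb (\<lambda>k. tv (\<lambda>i. B i k) (Len t))" "pb (\<lambda>k. tv (\<lambda>i. B i k) t)"
    using 8(3) by (rule pb_tv)+
  \<comment> \<open>\<open>polylog b\<close> bounds the number of instances, as \<open>Len t\<close>
    is small as a number; \<open>pb b\<close> allows \<open>B\<close> to be extended by the bound
    variable.\<close>
  then have b: "pb b" "polylog b"
    unfolding b_def by simp_all
  have "\<And>i. pb (case_nat b B i)"
    using b(1) 8(3) by (rule pb_case_nat)
  then have "local_on (case_nat b B) \<phi>"
    by (rule 8(2))
  then obtain d where d: "polylog d"
    "\<And>k e R. (\<And>i. e i \<le> case_nat b B i k) \<Longrightarrow> locally (d k) e R \<phi>"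
    by (rule local_onE) blast
  show ?case
  proof (rule local_onI[OF polylog_mult[OF b(2) d(1)]])
    fix k e R assume e: "\<And>i. e i \<le> B i k"
    have le: "tv e (Len t) \<le> b k"
      unfolding b_def using e by (rule tv_mono)
    have "locally (tv e (Len t) * d k) e R (AllB (Len t) \<phi>)"
    proof (rule locally_bounded_quantifier)
      show "locally (d k) (case_nat x e) R \<phi>" if "x < tv e (Len t)" for x
      proof (rule d(2))
        show "case_nat x e i \<le> case_nat b B i k" for i
          using that le e by (cases i) auto
      qed
    qed (simp add: sat_AllB tval_std cong: conj_cong)
    then show "locally (b k * d k) e R (AllB (Len t) \<phi>)"
      by (rule locally_mono) (use le in simp)
  qed
next
  case (9 \<phi> t)
  define b where "b k = tv (\<lambda>i. B i k) (Len t)" for k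
  have "pb (\<lambda>k. tv (\<lambda>i. B i k) (Len t))" "pb (\<lambda>k. tv (\<lambda>i. B i k) t)"
    using 9(3) by (rule pb_tv)+
  then have b: "pb b" "polylog b"
    unfolding b_def by simp_all
  have "\<And>i. pb (case_nat b B i)"
    using b(1) 9(3) by (rule pb_case_nat)
  then have "local_on (case_nat b B) \<phi>"
    by (rule 9(2))
  then obtain d where d: "polylog d"
    "\<And>k e R. (\<And>i. e i \<le> case_nat b B i k) \<Longrightarrow> locally (d k) e R \<phi>"
    by (rule local_onE) blast
  show ?case
  proof (rule local_onI[OF polylog_mult[OF b(2) d(1)]])
    fix k e R assume e: "\<And>i. e i \<le> B i k"
    have le: "tv e (Len t) \<le> b k"
      unfolding b_def using e by (rule tv_mono)
    have "locally (tv e (Len t) * d k) e R (ExB (Len t) \<phi>)"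
    proof (rule locally_bounded_quantifier)
      show "locally (d k) (case_nat x e) R \<phi>" if "x < tv e (Len t)" for x
      proof (rule d(2))
        show "case_nat x e i \<le> case_nat b B i k" for i
          using that le e by (cases i) auto
      qed
    qed (simp add: sat_ExB tval_std cong: conj_cong)
    then show "locally (b k * d k) e R (ExB (Len t) \<phi>)"
      by (rule locally_mono) (use le in simp)
  qed
qed

text \<open>Each queried pair \<open>z\<close> is replaced by a pair of \<open>R\<close> that
  settles it: \<open>z\<close> itself if it is in \<open>R\<close>, otherwise a pair sharing its
  pigeon or its hole, which excludes \<open>z\<close> from every injection. So a query set becomes a
  certificate inside \<open>R\<close> of no larger size.\<close>

lemma locally_forces:
  assumes "locally n e R \<phi>" "maxinj k R" "sat (std R) e \<phi>"
  shows "\<exists>q\<subseteq>R. card q \<le> n \<and> forces k q e \<phi>"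
proof -
  obtain Q where Q: "finite Q" "card Q \<le> n"
    "\<And>R'. R' \<inter> Q = R \<inter> Q \<Longrightarrow> sat (std R') e \<phi> = sat (std R) e \<phi>"
    using assms(1) unfolding locally_def by blast
  \<comment> \<open>Pairs outside \<open>{..k} \<times> {..<k}\<close> lie in no partial injection
    and need no witness.\<close>
  define Q' where "Q' = Q \<inter> ({..k} \<times> {..<k})"
  have R: "pinj k R" using assms(2) unfolding maxinj_def by blast
  have "\<exists>x. x \<in> R \<and> (fst x = fst z \<or> snd x = snd z) \<and> (z \<in> R \<longrightarrow> x = z)" if "z \<in> Q'" for z
    using maxinj_covers[OF assms(2), of "fst z" "snd z"] that
    by (cases "z \<in> R") (fastforce simp: Q'_def)+
  then obtain h where h: "\<And>z. z \<in> Q' \<Longrightarrow> h z \<in> R \<and> (fst (h z) = fst z \<or> snd (h z) = snd z) \<and>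
      (z \<in> R \<longrightarrow> h z = z)"
    by metis
  have "finite Q'" unfolding Q'_def using Q(1) by simp
  then have "card (h ` Q') \<le> card Q'" by (rule card_image_le)
  also have "\<dots> \<le> card Q" unfolding Q'_def using Q(1) by (intro card_mono) auto
  finally have "card (h ` Q') \<le> n" using Q(2) by simp
  moreover have "h ` Q' \<subseteq> R" using h by auto
  moreover have "forces k (h ` Q') e \<phi>"
    unfolding forces_def
  proof (intro HOL.allI HOL.impI)
    fix R' assume R': "maxinj k R'" and sub: "h ` Q' \<subseteq> R'"
    then have inj: "pinj k R'" unfolding maxinj_def by blast
    have "(i, j) \<in> R' \<longleftrightarrow> (i, j) \<in> R" if "(i, j) \<in> Q" for i j
    proof (cases "(i, j) \<in> Q'")
      case True
      obtain i' j' where ij: "h (i, j) = (i', j')" by fastforce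
      have "(i', j') \<in> R'" using sub True ij by (metis image_subset_iff)
      moreover have "(i', j') \<in> R" "i' = i \<or> j' = j" "(i, j) \<in> R \<Longrightarrow> i' = i \<and> j' = j"
        using h[OF True] ij by auto
      ultimately show ?thesis
        using inj unfolding pinj_def by metis
    next
      case False
      then show ?thesis using that inj R unfolding Q'_def pinj_def by blast
    qed
    then have "R' \<inter> Q = R \<inter> Q" by auto
    then show "sat (std R') e \<phi>" using Q(3) assms(3) by blast
  qed
  ultimately show ?thesis by blast
qed

text \<open>Unlike \<open>Sigma_b1\<close>, this class contains the two existential disjuncts of \<open>PHP p h \<phi>\<close> whenever
  it contains \<open>\<phi>\<close>.\<close>

inductive Sig :: "form \<Rightarrow> bool" where
  sharp: "sharply_bounded \<phi> \<Longrightarrow> Sig \<phi>"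
| conj: "Sig \<phi> \<Longrightarrow> Sig \<psi> \<Longrightarrow> Sig (And \<phi> \<psi>)"
| disj: "Sig \<phi> \<Longrightarrow> Sig \<psi> \<Longrightarrow> Sig (Or \<phi> \<psi>)"
| exb: "Sig \<phi> \<Longrightarrow> Sig (ExB t \<phi>)"

lemma Sigma_b1_Sig: "Sigma_b1 \<phi> \<Longrightarrow> Sig \<phi>"
  by (induction rule: Sigma_b1.induct) (auto intro: Sig.intros)

lemma Sig_subst: "Sig \<phi> \<Longrightarrow> Sig (subst \<sigma> \<phi>)"
  by (induction arbitrary: \<sigma> rule: Sig.induct)
    (auto simp: subst_ExB intro: Sig.intros sharply_bounded_subst)

definition forceable_on :: "(nat \<Rightarrow> nat \<Rightarrow> nat) \<Rightarrow> form \<Rightarrow> bool" where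
  "forceable_on B \<phi> \<longleftrightarrow> (\<exists>d. polylog d \<and> (\<forall>k e R. (\<forall>i. e i \<le> B i k) \<longrightarrow> maxinj k R \<longrightarrow>
     sat (std R) e \<phi> \<longrightarrow> (\<exists>q\<subseteq>R. card q \<le> d k \<and> forces k q e \<phi>)))"

lemma forceable_onI:
  assumes "polylog d"
    and "\<And>k e R. (\<And>i. e i \<le> B i k) \<Longrightarrow> maxinj k R \<Longrightarrow> sat (std R) e \<phi> \<Longrightarrow>
      \<exists>q\<subseteq>R. card q \<le> d k \<and> forces k q e \<phi>"
  shows "forceable_on B \<phi>"
  using assms unfolding forceable_on_def by blast

lemma forceable_onE:
  assumes "forceable_on B \<phi>"
  obtains d where "polylog d"
    and "\<And>k e R. (\<And>i. e i \<le> B i k) \<Longrightarrow> maxinj k R \<Longrightarrow> sat (std R) e \<phi> \<Longrightarrow>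
      \<exists>q\<subseteq>R. card q \<le> d k \<and> forces k q e \<phi>"
  using assms unfolding forceable_on_def by blast

text \<open>A bounded existential quantifier adds nothing to the cost: a certificate for one witness
  suffices, and the bound \<open>t\<close> keeps the witness below a function of polylogarithmic
  length.\<close>

lemma Sig_forceable:
  assumes "Sig \<phi>" "\<And>i. pb (B i)"
  shows "forceable_on B \<phi>"
  using assms
proof (induction arbitrary: B rule: Sig.induct)
  case (sharp \<phi>)
  have "local_on B \<phi>"
    using sharp by (rule sharply_bounded_local)
  then obtain d where d: "polylog d"
    "\<And>k e R. (\<And>i. e i \<le> B i k) \<Longrightarrow> locally (d k) e R \<phi>"
    by (rule local_onE) blast
  show ?case
    by (rule forceable_onI[OF d(1)]) (rule locally_forces[OF d(2)])
next
  case (conj \<phi> \<psi>)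
  have "forceable_on B \<phi>"
    using conj.prems by (rule conj.IH(1))
  then obtain d where d: "polylog d"
    "\<And>k e R. (\<And>i. e i \<le> B i k) \<Longrightarrow> maxinj k R \<Longrightarrow> sat (std R) e \<phi> \<Longrightarrow>
      \<exists>q\<subseteq>R. card q \<le> d k \<and> forces k q e \<phi>"
    by (rule forceable_onE) blast
  have "forceable_on B \<psi>"
    using conj.prems by (rule conj.IH(2))
  then obtain d' where d': "polylog d'"
    "\<And>k e R. (\<And>i. e i \<le> B i k) \<Longrightarrow> maxinj k R \<Longrightarrow> sat (std R) e \<psi> \<Longrightarrow>
      \<exists>q\<subseteq>R. card q \<le> d' k \<and> forces k q e \<psi>"
    by (rule forceable_onE) blast
  show ?case
  proof (rule forceable_onI[OF polylog_add[OF d(1) d'(1)]])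
    fix k e R assume e: "\<And>i. e i \<le> B i k" and R: "maxinj k R" "sat (std R) e (And \<phi> \<psi>)"
    then have sat: "sat (std R) e \<phi>" "sat (std R) e \<psi>" by simp_all
    obtain q where q: "q \<subseteq> R" "card q \<le> d k" "forces k q e \<phi>"
      using d(2)[OF e R(1) sat(1)] by blast
    obtain q' where q': "q' \<subseteq> R" "card q' \<le> d' k" "forces k q' e \<psi>"
      using d'(2)[OF e R(1) sat(2)] by blast
    have "card (q \<union> q') \<le> d k + d' k"
      using q(2) q'(2) card_Un_le[of q q'] by linarith
    moreover have "forces k (q \<union> q') e (And \<phi> \<psi>)"
      using q(3) q'(3) unfolding forces_def by simp
    ultimately show "\<exists>q\<subseteq>R. card q \<le> d k + d' k \<and> forces k q e (And \<phi> \<psi>)"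
      using q(1) q'(1) by (intro HOL.exI[of _ "q \<union> q'"]) simp
  qed
next
  case (disj \<phi> \<psi>)
  have "forceable_on B \<phi>"
    using disj.prems by (rule disj.IH(1))
  then obtain d where d: "polylog d"
    "\<And>k e R. (\<And>i. e i \<le> B i k) \<Longrightarrow> maxinj k R \<Longrightarrow> sat (std R) e \<phi> \<Longrightarrow>
      \<exists>q\<subseteq>R. card q \<le> d k \<and> forces k q e \<phi>"
    by (rule forceable_onE) blast
  have "forceable_on B \<psi>"
    using disj.prems by (rule disj.IH(2))
  then obtain d' where d': "polylog d'"
    "\<And>k e R. (\<And>i. e i \<le> B i k) \<Longrightarrow> maxinj k R \<Longrightarrow> sat (std R) e \<psi> \<Longrightarrow>
      \<exists>q\<subseteq>R. card q \<le> d' k \<and> forces k q e \<psi>"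
    by (rule forceable_onE) blast
  show ?case
  proof (rule forceable_onI[OF polylog_add[OF d(1) d'(1)]])
    fix k e R assume e: "\<And>i. e i \<le> B i k" and R: "maxinj k R" "sat (std R) e (Or \<phi> \<psi>)"
    from R(2) consider "sat (std R) e \<phi>" | "sat (std R) e \<psi>" by auto
    then show "\<exists>q\<subseteq>R. card q \<le> d k + d' k \<and> forces k q e (Or \<phi> \<psi>)"
    proof cases
      case 1
      then obtain q where "q \<subseteq> R" "card q \<le> d k" "forces k q e \<phi>"
        using d(2)[OF e R(1)] by blast
      then show ?thesis by (intro HOL.exI[of _ q]) (simp add: forces_def)
    next
      case 2
      then obtain q where "q \<subseteq> R" "card q \<le> d' k" "forces k q e \<psi>"
        using d'(2)[OF e R(1)] by blast
      then show ?thesis by (intro HOL.exI[of _ q]) (simp add: forces_def)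
    qed
  qed
next
  case (exb \<phi> t)
  define b where "b k = tv (\<lambda>i. B i k) t" for k
  have "pb b"
    using exb(3) unfolding b_def by (rule pb_tv)
  then have "\<And>i. pb (case_nat b B i)"
    using exb(3) by (rule pb_case_nat)
  then have "forceable_on (case_nat b B) \<phi>"
    by (rule exb.IH)
  then obtain d where d: "polylog d"
    "\<And>k e R. (\<And>i. e i \<le> case_nat b B i k) \<Longrightarrow> maxinj k R \<Longrightarrow> sat (std R) e \<phi> \<Longrightarrow>
      \<exists>q\<subseteq>R. card q \<le> d k \<and> forces k q e \<phi>"
    by (rule forceable_onE) blast
  show ?case
  proof (rule forceable_onI[OF d(1)])
    fix k e R assume e: "\<And>i. e i \<le> B i k" and R: "maxinj k R" "sat (std R) e (ExB t \<phi>)"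
    obtain x where x: "x < tv e t" "sat (std R) (case_nat x e) \<phi>"
      using R(2) by (auto simp: sat_ExB tval_std)
    have le: "tv e t \<le> b k"
      unfolding b_def using e by (rule tv_mono)
    have "case_nat x e i \<le> case_nat b B i k" for i
      using x(1) le e by (cases i) auto
    from d(2)[OF this R(1) x(2)] obtain q where
      "q \<subseteq> R" "card q \<le> d k" "forces k q (case_nat x e) \<phi>" by blast
    then show "\<exists>q\<subseteq>R. card q \<le> d k \<and> forces k q e (ExB t \<phi>)"
      using x(1) by (intro HOL.exI[of _ q]) (auto simp: forces_def sat_ExB tval_std)
  qed
qed

section \<open>Decision trees querying a partial injection\<close>

lemma pinj_card_fst: "pinj k f \<Longrightarrow> card (fst ` f) \<le> card f" and pinj_card_snd: "pinj k f \<Longrightarrow> card (snd ` f) \<le> card f"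
  by (simp_all add: card_image_le pinj_finite)

text \<open>Fewer than \<open>k\<close> pairs always leave a hole free; dually, in
  \<open>cover_hole\<close>, a pigeon.\<close>

lemma cover_pigeon:
  assumes f: "pinj k f" and i: "i \<le> k" and card: "card f < k"
  shows "\<exists>f'. f \<subseteq> f' \<and> pinj k f' \<and> card f' \<le> Suc (card f) \<and> i \<in> fst ` f'"
proof (cases "i \<in> fst ` f")
  case True
  then show ?thesis using f by (intro HOL.exI[of _ f]) simp
next
  case False
  have "\<not> {..<k} \<subseteq> snd ` f"
    using card_mono[of "snd ` f" "{..<k}"] pinj_finite[OF f] pinj_card_snd[OF f] card by auto
  then obtain j where j: "j < k" "j \<notin> snd ` f" by auto
  have "pinj k (insert (i, j) f)"
    by (rule pinj_insert) (use f i j False in force)+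
  then show ?thesis
    using pinj_finite[OF f] by (intro HOL.exI[of _ "insert (i, j) f"]) (auto simp: card_insert_if)
qed

lemma cover_hole:
  assumes f: "pinj k f" and j: "j < k" and card: "card f < k"
  shows "\<exists>f'. f \<subseteq> f' \<and> pinj k f' \<and> card f' \<le> Suc (card f) \<and> j \<in> snd ` f'"
proof (cases "j \<in> snd ` f")
  case True
  then show ?thesis using f by (intro HOL.exI[of _ f]) simp
next
  case False
  have "\<not> {..k} \<subseteq> fst ` f"
    using card_mono[of "fst ` f" "{..k}"] pinj_finite[OF f] pinj_card_fst[OF f] card by auto
  then obtain i where i: "i \<le> k" "i \<notin> fst ` f" by auto
  have "pinj k (insert (i, j) f)"
    by (rule pinj_insert) (use f i j False in force)+
  then show ?thesis
    using pinj_finite[OF f] by (intro HOL.exI[of _ "insert (i, j) f"]) (auto simp: card_insert_if)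
qed

lemma cover_pigeons:
  assumes "finite P" "pinj k f" "P \<subseteq> {..k}" "card f + card P \<le> k"
  shows "\<exists>f'. f \<subseteq> f' \<and> pinj k f' \<and> card f' \<le> card f + card P \<and> P \<subseteq> fst ` f'"
  using assms
proof (induction P rule: finite_induct)
  case empty
  then show ?case by auto
next
  case (insert i P)
  then obtain g where g: "f \<subseteq> g" "pinj k g" "card g \<le> card f + card P" "P \<subseteq> fst ` g"
    by auto
  have "i \<le> k" "card g < k" using insert g by auto
  then obtain f' where "g \<subseteq> f'" "pinj k f'" "card f' \<le> Suc (card g)" "i \<in> fst ` f'"
    using cover_pigeon[OF g(2)] by blast
  moreover from this g have "insert i P \<subseteq> fst ` f'" "f \<subseteq> f'" by blast+
  ultimately show ?case
    using g insert.hyps by (intro HOL.exI[of _ f']) simp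
qed

lemma cover_holes:
  assumes "finite H" "pinj k f" "H \<subseteq> {..<k}" "card f + card H \<le> k"
  shows "\<exists>f'. f \<subseteq> f' \<and> pinj k f' \<and> card f' \<le> card f + card H \<and> H \<subseteq> snd ` f'"
  using assms
proof (induction H rule: finite_induct)
  case empty
  then show ?case by auto
next
  case (insert j H)
  then obtain g where g: "f \<subseteq> g" "pinj k g" "card g \<le> card f + card H" "H \<subseteq> snd ` g"
    by auto
  have "j < k" "card g < k" using insert g by auto
  then obtain f' where "g \<subseteq> f'" "pinj k f'" "card f' \<le> Suc (card g)" "j \<in> snd ` f'"
    using cover_hole[OF g(2)] by blast
  moreover from this g have "insert j H \<subseteq> snd ` f'" "f \<subseteq> f'" by blast+
  ultimately show ?case
    using g insert.hyps by (intro HOL.exI[of _ f']) simp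
qed

lemma pinj_Un_conflict:
  assumes "pinj k q" "pinj k q'" "\<not> pinj k (q \<union> q')"
  shows "\<exists>e\<in>q. \<exists>e'\<in>q'. e \<noteq> e' \<and> (fst e = fst e' \<or> snd e = snd e')"
proof (rule ccontr)
  assume "\<not> ?thesis"
  then have no: "\<And>i j i' j'. (i, j) \<in> q \<Longrightarrow> (i', j') \<in> q' \<Longrightarrow> i = i' \<or> j = j' \<Longrightarrow> i = i' \<and> j = j'"
    by force
  have "pinj k (q \<union> q')"
    using assms(1,2) no unfolding pinj_def by (auto dest: no)
  with assms(3) show False ..
qed

lemma pinj_eqI:
  assumes "pinj k R" "e \<in> R" "e' \<in> R" "fst e = fst e' \<or> snd e = snd e'"
  shows "e = e'"
  using assms unfolding pinj_def by (cases e; cases e') auto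

text \<open>A set \<open>W\<close> of pairs \<open>(q, b)\<close> collects the certificates \<open>q\<close> for the value \<open>b\<close>.\<close>

definition one_label :: "nat \<Rightarrow> ((nat \<times> nat) set \<times> nat) set \<Rightarrow> (nat \<times> nat) set \<Rightarrow> bool" where
  "one_label k W t \<longleftrightarrow> (\<forall>q b q' b'. (q, b) \<in> W \<longrightarrow> (q', b') \<in> W \<longrightarrow> pinj k (q \<union> t) \<longrightarrow>
     pinj k (q' \<union> t) \<longrightarrow> b = b')"

text \<open>Querying all pigeons and holes of two certificates with different labels decides at least one
  further pair of every other certificate, because it conflicts with one of the two.\<close>

lemma decision_tree:
  assumes W: "\<And>q b. (q, b) \<in> W \<Longrightarrow> pinj k q \<and> card q \<le> D"
    and conflict: "\<And>q b q' b'. (q, b) \<in> W \<Longrightarrow> (q', b') \<in> W \<Longrightarrow> b \<noteq> b' \<Longrightarrow> \<not> pinj k (q \<union> q')"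
    and "pinj k f" "t \<subseteq> f" "\<And>q b. (q, b) \<in> W \<Longrightarrow> pinj k (q \<union> t) \<Longrightarrow> card (q - t) \<le> r"
    and "card f + 4 * D * r \<le> k"
  shows "\<exists>f' t'. f \<subseteq> f' \<and> t \<subseteq> t' \<and> t' \<subseteq> f' \<and> pinj k f' \<and> card f' \<le> card f + 4 * D * r \<and>
    card t' \<le> card t + 4 * D * r \<and> one_label k W t'"
  using assms(3-)
\<comment> \<open>\<open>r\<close> bounds the part of a surviving certificate that \<open>t\<close>
  has not decided. A round queries at most \<open>2 * D\<close> pigeons and \<open>2 * D\<close>
  holes, hence costs \<open>4 * D\<close> pairs, and lowers \<open>r\<close> by one.\<close>
proof (induction r arbitrary: f t)
  case 0
  \<comment> \<open>All surviving certificates lie inside \<open>t\<close>, hence inside the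
    injection \<open>f\<close>, so no two of them conflict.\<close>
  have "q \<subseteq> t" if "(q, b) \<in> W" "pinj k (q \<union> t)" for q b
    using 0(3)[OF that] pinj_finite[OF that(2)] by simp
  then have "one_label k W t"
    unfolding one_label_def using conflict pinj_subset[OF 0(1)] 0(2)
    by (metis Un_least subset_trans)
  then show ?case using 0 by (intro HOL.exI[of _ f] HOL.exI[of _ t]) auto
next
  case (Suc r)
  show ?case
  proof (cases "one_label k W t")
    case True
    then show ?thesis using Suc.prems by (intro HOL.exI[of _ f] HOL.exI[of _ t]) auto
  next
    case False
    then obtain q1 b1 q2 b2 where q1: "(q1, b1) \<in> W" "pinj k (q1 \<union> t)"
      and q2: "(q2, b2) \<in> W" "pinj k (q2 \<union> t)" and b: "b1 \<noteq> b2"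
      unfolding one_label_def by blast
    define P where "P = fst ` (q1 \<union> q2)"
    define H where "H = snd ` (q1 \<union> q2)"
    have "finite q1" "finite q2"
      using W[OF q1(1)] W[OF q2(1)] pinj_finite by blast+
    then have Q: "finite (q1 \<union> q2)" "card (q1 \<union> q2) \<le> 2 * D" "q1 \<union> q2 \<subseteq> {..k} \<times> {..<k}"
      using W[OF q1(1)] W[OF q2(1)] card_Un_le[of q1 q2]
      by (simp_all add: pinj_def)
    have P: "finite P" "card P \<le> 2 * D" "P \<subseteq> {..k}"
      using Q card_image_le[OF Q(1), of fst] unfolding P_def by auto
    have H: "finite H" "card H \<le> 2 * D" "H \<subseteq> {..<k}"
      using Q card_image_le[OF Q(1), of snd] unfolding H_def by auto
    have bound: "card f + 4 * D + 4 * D * r \<le> k"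
      using Suc.prems(4) by simp
    obtain g where g: "f \<subseteq> g" "pinj k g" "card g \<le> card f + card P" "P \<subseteq> fst ` g"
      using cover_pigeons[OF P(1) Suc.prems(1) P(3)] bound P(2) by auto
    obtain f1 where f1: "g \<subseteq> f1" "pinj k f1" "card f1 \<le> card g + card H" "H \<subseteq> snd ` f1"
      using cover_holes[OF H(1) g(2) H(3)] bound P(2) H(2) g(3) by auto
    \<comment> \<open>The answers to all queries. As \<open>f1\<close> covers \<open>P\<close> and
      \<open>H\<close>, an injection extending \<open>s\<close> can have no further pair at these
      pigeons and holes.\<close>
    define s where "s = {z \<in> f1. fst z \<in> P} \<union> {z \<in> f1. snd z \<in> H}"
    have s: "s \<subseteq> f1" unfolding s_def by blast
    have "card {z \<in> f1. fst z \<in> P} \<le> card P"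
    proof (rule card_inj_on_le[of fst])
      show "inj_on fst {z \<in> f1. fst z \<in> P}"
        by (rule inj_onI) (use pinj_eqI[OF f1(2)] in blast)
    qed (use P in auto)
    moreover have "card {z \<in> f1. snd z \<in> H} \<le> card H"
    proof (rule card_inj_on_le[of snd])
      show "inj_on snd {z \<in> f1. snd z \<in> H}"
        by (rule inj_onI) (use pinj_eqI[OF f1(2)] in blast)
    qed (use H in auto)
    ultimately have card_s: "card s \<le> 4 * D"
      unfolding s_def using P(2) H(2) card_Un_le[of "{z \<in> f1. fst z \<in> P}" "{z \<in> f1. snd z \<in> H}"]
      by linarith
    \<comment> \<open>The conflict with \<open>e'\<close> means that the pigeon or hole of
      \<open>e\<close> was queried; \<open>q\<close> is compatible with the answer, so
      \<open>e\<close> is that answer. It is not in \<open>t\<close>, because \<open>q'\<close> is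
      compatible with \<open>t\<close>.\<close>
    have hit: "e \<in> s - t"
      if q: "(q, b) \<in> W" "pinj k (q \<union> (t \<union> s))" and e: "e \<in> q" "e' \<in> q'" "e \<noteq> e'" "fst e = fst e' \<or> snd e = snd e'"
        and q': "q' \<subseteq> q1 \<union> q2" "pinj k (q' \<union> t)" for q b e e' q'
    proof -
      have "e \<notin> t" using pinj_eqI[OF q'(2), of e e'] e by auto
      moreover have "\<exists>z\<in>s. fst z = fst e \<or> snd z = snd e"
      proof -
        have "fst e \<in> P \<or> snd e \<in> H" using e q' unfolding P_def H_def by (metis imageI subsetD)
        then show ?thesis
        proof
          assume e: "fst e \<in> P"
          then obtain z where "z \<in> f1" "fst z = fst e" using g(4) f1(1) by (metis imageE subsetD)
          then show ?thesis using e unfolding s_def by auto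
        next
          assume e: "snd e \<in> H"
          then obtain z where "z \<in> f1" "snd z = snd e" using f1(4) by (metis imageE subsetD)
          then show ?thesis using e unfolding s_def by auto
        qed
      qed
      ultimately show ?thesis
        using pinj_eqI[OF q(2), of _ e] e(1) by blast
    qed
    have "\<exists>f' t'. f1 \<subseteq> f' \<and> t \<union> s \<subseteq> t' \<and> t' \<subseteq> f' \<and> pinj k f' \<and> card f' \<le> card f1 + 4 * D * r \<and>
      card t' \<le> card (t \<union> s) + 4 * D * r \<and> one_label k W t'"
    proof (rule Suc.IH[OF f1(2)])
      show "t \<union> s \<subseteq> f1" using s Suc.prems(2) g(1) f1(1) by blast
      show "card f1 + 4 * D * r \<le> k"
        using f1(3) g(3) P(2) H(2) bound by linarith
      fix q b assume q: "(q, b) \<in> W" "pinj k (q \<union> (t \<union> s))"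
      have qt: "pinj k (q \<union> t)" by (rule pinj_subset[OF q(2)]) blast
      \<comment> \<open>\<open>b\<close> differs from \<open>b1\<close> or from \<open>b2\<close>,
        and the certificate carrying the different label conflicts with \<open>q\<close>.\<close>
      have "\<exists>q'. q' \<subseteq> q1 \<union> q2 \<and> pinj k (q' \<union> t) \<and> pinj k q' \<and> \<not> pinj k (q \<union> q')"
        using b conflict[OF q(1) q1(1)] conflict[OF q(1) q2(1)] q1 q2 W by (cases "b = b1") blast+
      then obtain q' where q': "q' \<subseteq> q1 \<union> q2" "pinj k (q' \<union> t)" "pinj k q'" "\<not> pinj k (q \<union> q')"
        by blast
      obtain e e' where e: "e \<in> q" "e' \<in> q'" "e \<noteq> e'" "fst e = fst e' \<or> snd e = snd e'"
        using pinj_Un_conflict[OF _ q'(3,4)] W[OF q(1)] by blast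
      have "e \<in> s - t" by (rule hit[OF q e q'(1,2)])
      then have "q - (t \<union> s) \<subset> q - t" using e(1) by blast
      then have "card (q - (t \<union> s)) < card (q - t)"
        using pinj_finite[OF qt] by (intro psubset_card_mono) auto
      then show "card (q - (t \<union> s)) \<le> r"
        using Suc.prems(3)[OF q(1) qt] by linarith
    qed
    then obtain f' t' where *: "f1 \<subseteq> f'" "t \<union> s \<subseteq> t'" "t' \<subseteq> f'" "pinj k f'"
      "card f' \<le> card f1 + 4 * D * r" "card t' \<le> card (t \<union> s) + 4 * D * r" "one_label k W t'"
      by blast
    have "card f' \<le> card f + 4 * D * Suc r"
      using *(5) f1(3) g(3) P(2) H(2) by simp
    moreover have "card t' \<le> card t + 4 * D * Suc r"
      using *(6) card_Un_le[of t s] card_s by simp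
    moreover have "f \<subseteq> f'" "t \<subseteq> t'"
      using * g(1) f1(1) by blast+
    ultimately show ?thesis
      using *(3,4,7) by (intro HOL.exI[of _ f'] HOL.exI[of _ t'] conjI)
  qed
qed

text \<open>The \<open>m + 1\<close> trees are run one after the other against a single growing partial injection;
  since \<open>m\<close> is much smaller than \<open>k\<close>, it never runs out of pigeons or holes.\<close>

lemma no_small_pigeonhole_violation:
  fixes W :: "nat \<Rightarrow> ((nat \<times> nat) set \<times> nat) set"
  assumes p: "pinj k p" "card p \<le> D"
    and W: "\<And>a q b. (q, b) \<in> W a \<Longrightarrow> pinj k q \<and> card q \<le> D \<and> b < m"
    and functional: "\<And>a q b q' b'. a \<le> m \<Longrightarrow> (q, b) \<in> W a \<Longrightarrow> (q', b') \<in> W a \<Longrightarrow> b \<noteq> b' \<Longrightarrow>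
      \<not> pinj k (q \<union> q')"
    and injective: "\<And>a a' q q' b. a \<le> m \<Longrightarrow> a' \<le> m \<Longrightarrow> a \<noteq> a' \<Longrightarrow> (q, b) \<in> W a \<Longrightarrow> (q', b) \<in> W a' \<Longrightarrow>
      \<not> pinj k (q \<union> q')"
    and total: "\<And>a p'. a \<le> m \<Longrightarrow> pinj k p' \<Longrightarrow> p \<subseteq> p' \<Longrightarrow> card p' \<le> 8 * D * D + 3 * D \<Longrightarrow>
      \<exists>q b. (q, b) \<in> W a \<and> pinj k (q \<union> p')"
    and bound: "D + (m + 1) * (4 * D * D) \<le> k"
  shows False
proof -
  \<comment> \<open>\<open>t a\<close> is the branch taken by the tree of \<open>a\<close>. It is
    recorded apart from \<open>f\<close>, which may grow to nearly \<open>k\<close> pairs, because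
    \<open>total\<close> speaks of small injections.\<close>
  have "\<exists>f t. pinj k f \<and> p \<subseteq> f \<and> card f \<le> card p + n * (4 * D * D) \<and>
      (\<forall>a<n. p \<subseteq> t a \<and> t a \<subseteq> f \<and> card (t a) \<le> card p + 4 * D * D \<and> one_label k (W a) (t a))"
    if "n \<le> m + 1" for n
    using that
  proof (induction n)
    case 0
    then show ?case using p by auto
  next
    case (Suc n)
    then obtain f t where f: "pinj k f" "p \<subseteq> f" "card f \<le> card p + n * (4 * D * D)"
      and t: "\<And>a. a < n \<Longrightarrow> p \<subseteq> t a \<and> t a \<subseteq> f \<and> card (t a) \<le> card p + 4 * D * D \<and> one_label k (W a) (t a)"
      by auto
    have "Suc n * (4 * D * D) \<le> (m + 1) * (4 * D * D)"
      using Suc.prems by (intro mult_right_mono) auto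
    then have room: "card f + 4 * D * D \<le> k"
      using f(3) p(2) bound unfolding mult_Suc by linarith
    have n: "n \<le> m" using Suc.prems by simp
    have shrink: "card (q - p) \<le> D" if "(q, b) \<in> W n" for q b
      using W[OF that] card_Diff_subset_Int[of q p] card_mono[of q "q - p"] pinj_finite by fastforce
    have "\<exists>f' t'. f \<subseteq> f' \<and> p \<subseteq> t' \<and> t' \<subseteq> f' \<and> pinj k f' \<and> card f' \<le> card f + 4 * D * D \<and>
        card t' \<le> card p + 4 * D * D \<and> one_label k (W n) t'"
      by (rule decision_tree[OF _ functional[OF n]]) (use W f room shrink in blast)+
    then obtain f' t' where f': "f \<subseteq> f'" "p \<subseteq> t'" "t' \<subseteq> f'" "pinj k f'" "card f' \<le> card f + 4 * D * D"
      "card t' \<le> card p + 4 * D * D" "one_label k (W n) t'"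
      by blast
    have "card f' \<le> card p + Suc n * (4 * D * D)"
      using f'(5) f(3) by simp
    moreover have "p \<subseteq> (t(n := t')) a \<and> (t(n := t')) a \<subseteq> f' \<and> card ((t(n := t')) a) \<le> card p + 4 * D * D \<and>
        one_label k (W a) ((t(n := t')) a)" if "a < Suc n" for a
      using that f' t[of a] by (cases "a = n") auto
    ultimately show ?case
      using f' f(2) by blast
  qed
  then obtain f t where f: "pinj k f" "p \<subseteq> f"
    and t: "\<And>a. a < m + 1 \<Longrightarrow> p \<subseteq> t a \<and> t a \<subseteq> f \<and> card (t a) \<le> card p + 4 * D * D \<and> one_label k (W a) (t a)"
    by (metis order_refl)
  have "\<exists>b. \<exists>q. (q, b) \<in> W a \<and> pinj k (q \<union> t a)" if "a \<le> m" for a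
    using total[OF that, of "t a"] t[of a] that pinj_subset[OF f(1)] p(2) by fastforce
  then obtain \<beta> where \<beta>: "\<And>a. a \<le> m \<Longrightarrow> \<exists>q. (q, \<beta> a) \<in> W a \<and> pinj k (q \<union> t a)"
    by metis
  have "\<beta> ` {..m} \<subseteq> {..<m}"
    using \<beta> W by fastforce
  then have "card (\<beta> ` {..m}) < card {..m}"
    using card_mono[of "{..<m}" "\<beta> ` {..m}"] by simp
  then have "\<not> inj_on \<beta> {..m}"
    by (rule pigeonhole)
  then obtain a a' where a: "a \<le> m" "a' \<le> m" "a \<noteq> a'" "\<beta> a = \<beta> a'"
    unfolding inj_on_def by auto
  \<comment> \<open>With both branches kept, \<open>one_label\<close> forces certificates for
    \<open>a\<close> and \<open>a'\<close> compatible with \<open>u\<close> to carry the labels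
    \<open>\<beta> a\<close> and \<open>\<beta> a'\<close>. Two branches of at most
    \<open>D + 4 * D * D\<close> pairs and one certificate of at most \<open>D\<close> pairs give
    the size \<open>8 * D * D + 3 * D\<close> in \<open>total\<close>.\<close>
  define u where "u = t a \<union> t a'"
  have u: "pinj k u" "p \<subseteq> u" "card u \<le> 2 * D + 8 * D * D"
    using t[of a] t[of a'] a pinj_subset[OF f(1)] card_Un_le[of "t a" "t a'"] p(2)
    unfolding u_def by auto
  obtain q b where q: "(q, b) \<in> W a" "pinj k (q \<union> u)"
    using total[OF a(1) u(1,2)] u(3) by auto
  have "card (q \<union> u) \<le> 8 * D * D + 3 * D"
    using u(3) W[OF q(1)] card_Un_le[of q u] by linarith
  then obtain q' b' where q': "(q', b') \<in> W a'" "pinj k (q' \<union> (q \<union> u))"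
    using total[OF a(2) q(2)] u(2) by blast
  have "b = \<beta> a"
    using \<beta>[OF a(1)] t[of a] a(1) q pinj_subset[OF q(2), of "q \<union> t a"]
    unfolding one_label_def u_def by fastforce
  moreover have "b' = \<beta> a'"
    using \<beta>[OF a(2)] t[of a'] a(2) q' pinj_subset[OF q'(2), of "q' \<union> t a'"]
    unfolding one_label_def u_def by fastforce
  ultimately have "\<not> pinj k (q \<union> q')"
    using injective[OF a(1,2,3), of q b q'] q(1) q'(1) a(4) by simp
  moreover have "pinj k (q \<union> q')"
    by (rule pinj_subset[OF q'(2)]) blast
  ultimately show False ..
qed

section \<open>The range m \<le> n to the power r\<close>

lemma tv_pow [simp]: "tv e (pow t n) = tv e t ^ n"
  by (induction n) auto

definition below_pow :: "rat \<Rightarrow> nat \<Rightarrow> nat \<Rightarrow> bool" where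
  "below_pow r m n \<longleftrightarrow> (case quotient_of r of (p, q) \<Rightarrow>
     if p \<ge> 0 then m ^ nat q \<le> n ^ nat p else m ^ nat q * n ^ nat (- p) \<le> 1)"

lemma sat_leq_pow: "sat (std R) e (leq_pow r s t) \<longleftrightarrow> below_pow r (tv e s) (tv e t)"
proof (cases "quotient_of r")
  case (Pair p q)
  show ?thesis
    by (simp only: leq_pow_def below_pow_def Pair prod.case sat.simps std_sel tval_std tv.simps tv_pow
        le_less if_distrib cong: if_cong split: if_split) blast
qed

text \<open>With \<open>r = p / q\<close> and \<open>m > 0\<close>, the chain is \<open>((m + 1) * S
  k) ^ q \<le> m ^ q * (2 * S k) ^ q \<le> k ^ p * k \<le> k ^ q\<close>. The strict inequality
  \<open>p < q\<close> pays for the extra factor \<open>k\<close>, which absorbs the polylogarithmic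
  one.\<close>

lemma below_pow_bound:
  assumes "r < 1" "polylog S"
  shows "\<exists>K. \<forall>k\<ge>K. \<forall>m. below_pow r m k \<longrightarrow> (m + 1) * S k \<le> k"
proof -
  obtain p q where pq: "quotient_of r = (p, q)" by fastforce
  have q: "q > 0" using quotient_of_denom_pos[OF pq] .
  have "p < q"
    using assms(1) q unfolding quotient_of_div[OF pq] by (simp add: field_simps)
  obtain K1 where K1: "\<forall>k\<ge>K1. S k < k"
    using polylog_less[OF assms(2)] by blast
  have "polylog (\<lambda>k. (2 * S k) ^ nat q)"
    by (intro polylog_power polylog_mult polylog_const assms(2))
  then obtain K2 where K2: "\<forall>k\<ge>K2. (2 * S k) ^ nat q < k"
    using polylog_less by blast
  have "(m + 1) * S k \<le> k" if k: "k \<ge> max 2 (max K1 K2)" and m: "below_pow r m k" for k m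
  proof (cases "m = 0")
    case True
    then show ?thesis using K1 k by (simp add: less_imp_le)
  next
    case False
    \<comment> \<open>A negative exponent admits only \<open>m = 0\<close> once
      \<open>k \<ge> 2\<close>.\<close>
    have "p \<ge> 0"
    proof (rule ccontr)
      assume p: "\<not> p \<ge> 0"
      have "1 * 2 ^ 1 \<le> m ^ nat q * k ^ nat (- p)"
      proof (intro mult_mono)
        have "(2::nat) ^ 1 \<le> 2 ^ nat (- p)"
          using p by (intro power_increasing) auto
        also have "\<dots> \<le> k ^ nat (- p)"
          using k by (intro power_mono) auto
        finally show "2 ^ 1 \<le> k ^ nat (- p)" .
      qed (use False in auto)
      then show False using m p pq unfolding below_pow_def by simp
    qed
    then have le: "m ^ nat q \<le> k ^ nat p"
      using m pq unfolding below_pow_def by simp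
    have "((m + 1) * S k) ^ nat q \<le> (m * (2 * S k)) ^ nat q"
    proof (rule power_mono)
      have "(m + 1) * S k \<le> (2 * m) * S k"
        by (rule mult_right_mono) (use False in auto)
      then show "(m + 1) * S k \<le> m * (2 * S k)"
        by (simp add: mult_ac)
    qed simp
    also have "\<dots> \<le> k ^ nat p * k"
      unfolding power_mult_distrib[of m] using le K2 k by (intro mult_mono) (auto simp: less_imp_le)
    also have "\<dots> = k ^ Suc (nat p)" by simp
    also have "\<dots> \<le> k ^ nat q"
      using \<open>p < q\<close> \<open>p \<ge> 0\<close> k by (intro power_increasing) auto
    finally show ?thesis
      using q power_le_imp_le_base[of "(m + 1) * S k" "nat q - 1" k] by simp
  qed
  then show ?thesis by blast
qed

section \<open>Conditions\<close>

text \<open>The first component of a condition is a new element of the model, added when the condition is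
  chosen.\<close>

type_synonym cond = "(nat \<Rightarrow> nat) \<times> nat set \<times> (nat \<Rightarrow> (nat \<times> nat) set)"

definition good :: "cond \<Rightarrow> bool" where
  "good y \<longleftrightarrow> (case y of (g, A, p) \<Rightarrow>
     pb g \<and> infinite A \<and> (\<forall>k. pinj k (p k)) \<and> polylog (\<lambda>k. card (p k)))"

definition extends :: "cond \<Rightarrow> cond \<Rightarrow> bool" where
  "extends y y' \<longleftrightarrow> (case (y, y') of ((g, A, p), (g', A', p')) \<Rightarrow>
     A' \<subseteq> A \<and> (\<forall>k\<in>A'. p k \<subseteq> p' k))"

definition cforces :: "cond \<Rightarrow> (nat \<Rightarrow> nat \<Rightarrow> nat) \<Rightarrow> form \<Rightarrow> bool" where
  "cforces y E \<phi> \<longleftrightarrow> (case y of (g, A, p) \<Rightarrow> \<forall>k\<in>A. forces k (p k) (\<lambda>i. E i k) \<phi>)"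

lemma pointwise_extension:
  assumes good: "good (g0, A, p)" and d: "polylog d" and J: "finite J"
    and ex: "\<And>k. k \<in> A \<Longrightarrow> k \<ge> K \<Longrightarrow> \<exists>j\<in>J. \<exists>x q. p k \<subseteq> q \<and> pinj k q \<and> card q \<le> d k \<and>
      blen x \<le> d k \<and> \<Phi> j k x q"
  shows "\<exists>j\<in>J. \<exists>g' A' p'. good (g', A', p') \<and> extends (g0, A, p) (g', A', p') \<and>
    (\<forall>k\<in>A'. \<Phi> j k (g' k) (p' k))"
proof -
  define ok where "ok j k x q \<longleftrightarrow> p k \<subseteq> q \<and> pinj k q \<and> card q \<le> d k \<and> blen x \<le> d k \<and> \<Phi> j k x q" for j k x q
  define A0 where "A0 = A - {..<K}"
  have inf: "infinite A0"
    using good unfolding good_def A0_def by (simp add: Diff_infinite_finite)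
  have "\<forall>k\<in>A0. \<exists>j\<in>J. \<exists>x q. ok j k x q"
    using ex unfolding ok_def A0_def by (auto simp: not_less)
  then obtain j where j: "j \<in> J" "infinite {k \<in> A0. \<exists>x q. ok j k x q}"
    using pigeonhole_infinite_rel[OF inf J, of "\<lambda>k j. \<exists>x q. ok j k x q"] by blast
  define A' where "A' = {k \<in> A0. \<exists>x q. ok j k x q}"
  have "\<exists>x q. ok j k x q" if "k \<in> A'" for k
    using that unfolding A'_def by blast
  then obtain g q where gq: "\<And>k. k \<in> A' \<Longrightarrow> ok j k (g k) (q k)"
    by metis
  \<comment> \<open>Default values outside \<open>A'\<close> keep the bounds required by
    \<open>good\<close> valid at every \<open>k\<close>.\<close>
  define g' where "g' k = (if k \<in> A' then g k else 0)" for k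
  define p' where "p' k = (if k \<in> A' then q k else {})" for k
  have "pb g'"
    using d by (rule polylog_mono) (use gq in \<open>auto simp: g'_def ok_def\<close>)
  moreover have "polylog (\<lambda>k. card (p' k))"
    using d by (rule polylog_mono) (use gq in \<open>auto simp: p'_def ok_def\<close>)
  moreover have "pinj k (p' k)" for k
    using gq[of k] by (auto simp: p'_def ok_def pinj_def)
  ultimately have "good (g', A', p')"
    using j(2) unfolding good_def A'_def by simp
  moreover have "extends (g0, A, p) (g', A', p')"
    using gq unfolding extends_def by (auto simp: p'_def ok_def A'_def A0_def)
  moreover have "\<forall>k\<in>A'. \<Phi> j k (g' k) (p' k)"
    using gq by (simp add: g'_def p'_def ok_def)
  ultimately show ?thesis using j(1) by blast
qed

text \<open>At each index either some completion satisfies \<phi>, and a small certificate taken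
  from it is added, or \<open>p k\<close> already forces the negation.\<close>

lemma cond_decide:
  assumes y: "good y" and \<phi>: "Sig \<phi>" and E: "\<And>i. pb (E i)"
  shows "\<exists>y'. good y' \<and> extends y y' \<and> (cforces y' E \<phi> \<or> cforces y' E (Neg \<phi>))"
proof -
  obtain g A p where ygp: "y = (g, A, p)" by (cases y)
  have p: "pinj k (p k)" "polylog (\<lambda>k. card (p k))" for k
    using y unfolding ygp good_def by auto
  have "forceable_on E \<phi>" using \<phi> E by (rule Sig_forceable)
  then obtain d where d: "polylog d" "\<And>k e R. (\<And>i. e i \<le> E i k) \<Longrightarrow> maxinj k R \<Longrightarrow> sat (std R) e \<phi> \<Longrightarrow>
      \<exists>q\<subseteq>R. card q \<le> d k \<and> forces k q e \<phi>"
    by (rule forceable_onE) blast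
  have "\<exists>j\<in>{\<phi>, Neg \<phi>}. \<exists>g' A' p'. good (g', A', p') \<and> extends (g, A, p) (g', A', p') \<and>
    (\<forall>k\<in>A'. forces k (p' k) (\<lambda>i. E i k) j)"
  proof (rule pointwise_extension[OF y[unfolded ygp] polylog_add[OF p(2) d(1)],
        where \<Phi> = "\<lambda>j k x q. forces k q (\<lambda>i. E i k) j"])
    fix k assume "k \<in> A"
    show "\<exists>j\<in>{\<phi>, Neg \<phi>}. \<exists>x q. p k \<subseteq> q \<and> pinj k q \<and> card q \<le> card (p k) + d k \<and>
      blen x \<le> card (p k) + d k \<and> forces k q (\<lambda>i. E i k) j"
    proof (cases "\<exists>R. maxinj k R \<and> p k \<subseteq> R \<and> sat (std R) (\<lambda>i. E i k) \<phi>")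
      case True
      then obtain R where R: "maxinj k R" "p k \<subseteq> R" "sat (std R) (\<lambda>i. E i k) \<phi>" by blast
      obtain q where q: "q \<subseteq> R" "card q \<le> d k" "forces k q (\<lambda>i. E i k) \<phi>"
        using d(2)[OF _ R(1,3)] by blast
      have "forces k (p k \<union> q) (\<lambda>i. E i k) \<phi>"
        using q(3) by (rule forces_mono) blast
      moreover have "pinj k (p k \<union> q)"
        using R(1) unfolding maxinj_def by (rule conjE) (erule pinj_subset, use R q in blast)
      moreover have "card (p k \<union> q) \<le> card (p k) + d k"
        using q(2) card_Un_le[of "p k" q] by linarith
      ultimately show ?thesis
        by (intro bexI[of _ \<phi>] HOL.exI[of _ 0] HOL.exI[of _ "p k \<union> q"]) auto
    next
      case False
      then have "forces k (p k) (\<lambda>i. E i k) (Neg \<phi>)"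
        unfolding forces_def by auto
      then show ?thesis
        using p(1)[of k] by (intro bexI[of _ "Neg \<phi>"] HOL.exI[of _ 0] HOL.exI[of _ "p k"]) auto
    qed
  qed simp
  then show ?thesis
    unfolding ygp cforces_def by fastforce
qed

text \<open>The witnesses found at the single indices are glued into the new element
  \<open>fst y'\<close>; lying below \<open>t\<close>, it has polylogarithmic length.\<close>

lemma cond_witness:
  assumes y: "good y" and \<phi>: "Sig \<phi>" and E: "\<And>i. pb (E i)"
  shows "\<exists>y'. good y' \<and> extends y y' \<and> (cforces y' E (Neg (ExB t \<phi>)) \<or>
    cforces y' (case_nat (fst y') E) (And (Less (Var 0) (tlift t)) \<phi>))"
proof -
  obtain g A p where ygp: "y = (g, A, p)" by (cases y)
  have p: "pinj k (p k)" "polylog (\<lambda>k. card (p k))" for k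
    using y unfolding ygp good_def by auto
  define \<psi> where "\<psi> = And (Less (Var 0) (tlift t)) \<phi>"
  define b where "b k = tv (\<lambda>i. E i k) t" for k
  have b: "pb b" unfolding b_def using E by (rule pb_tv)
  have "Sig \<psi>"
    unfolding \<psi>_def by (intro Sig.conj Sig.sharp[OF sharply_bounded.intros(3)] \<phi>)
  moreover have "\<And>i. pb (case_nat b E i)"
    using b E by (rule pb_case_nat)
  ultimately have "forceable_on (case_nat b E) \<psi>" by (rule Sig_forceable)
  then obtain d where d: "polylog d"
    "\<And>k e R. (\<And>i. e i \<le> case_nat b E i k) \<Longrightarrow> maxinj k R \<Longrightarrow> sat (std R) e \<psi> \<Longrightarrow>
      \<exists>q\<subseteq>R. card q \<le> d k \<and> forces k q e \<psi>"
    by (rule forceable_onE) blast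
  define D where "D k = card (p k) + d k + blen (b k)" for k
  have D: "polylog D"
    unfolding D_def by (intro polylog_add p(2) d(1) b)
  define \<Phi> where "\<Phi> j k x q \<longleftrightarrow> (if j then forces k q (case_nat x (\<lambda>i. E i k)) \<psi>
    else forces k q (\<lambda>i. E i k) (Neg (ExB t \<phi>)))" for j k x q
  have "\<exists>j\<in>{True, False}. \<exists>g' A' p'. good (g', A', p') \<and> extends (g, A, p) (g', A', p') \<and>
    (\<forall>k\<in>A'. \<Phi> j k (g' k) (p' k))"
  proof (rule pointwise_extension[OF y[unfolded ygp] D])
    fix k assume "k \<in> A"
    show "\<exists>j\<in>{True, False}. \<exists>x q. p k \<subseteq> q \<and> pinj k q \<and> card q \<le> D k \<and> blen x \<le> D k \<and> \<Phi> j k x q"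
    proof (cases "\<exists>R. maxinj k R \<and> p k \<subseteq> R \<and> sat (std R) (\<lambda>i. E i k) (ExB t \<phi>)")
      case True
      then obtain R x where R: "maxinj k R" "p k \<subseteq> R" "sat (std R) (case_nat x (\<lambda>i. E i k)) \<phi>"
        and x: "x < b k"
        by (auto simp: sat_ExB b_def)
      have "case_nat x (\<lambda>i. E i k) i \<le> case_nat b E i k" for i
        using x by (cases i) auto
      moreover have "sat (std R) (case_nat x (\<lambda>i. E i k)) \<psi>"
        using R(3) x by (simp add: \<psi>_def b_def)
      ultimately obtain q where q: "q \<subseteq> R" "card q \<le> d k" "forces k q (case_nat x (\<lambda>i. E i k)) \<psi>"
        using d(2)[OF _ R(1)] by blast
      have "\<Phi> True k x (p k \<union> q)"
        using forces_mono[OF q(3), of "p k \<union> q"] unfolding \<Phi>_def by simp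
      moreover have "pinj k (p k \<union> q)"
        using R(1) unfolding maxinj_def by (rule conjE) (erule pinj_subset, use R q in blast)
      moreover have "card (p k \<union> q) \<le> D k"
        using q(2) card_Un_le[of "p k" q] unfolding D_def by linarith
      moreover have "blen x \<le> D k"
        using blen_mono[of x "b k"] x unfolding D_def by simp
      ultimately show ?thesis by blast
    next
      case False
      then have "\<Phi> False k 0 (p k)"
        unfolding \<Phi>_def forces_def by auto
      moreover have "card (p k) \<le> D k" "blen 0 \<le> D k"
        unfolding D_def by simp_all
      ultimately show ?thesis
        using p(1)[of k] by blast
    qed
  qed simp
  then obtain j g' A' p' where y': "good (g', A', p')" "extends (g, A, p) (g', A', p')"
    "\<forall>k\<in>A'. \<Phi> j k (g' k) (p' k)" by blast
  have "cforces (g', A', p') E (Neg (ExB t \<phi>)) \<or> cforces (g', A', p') (case_nat g' E) \<psi>"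
    using y'(3) unfolding cforces_def \<Phi>_def by (cases j) (auto simp: case_nat_app)
  then show ?thesis
    using y'(1,2) unfolding ygp \<psi>_def by (intro HOL.exI[of _ "(g', A', p')"]) simp
qed

text \<open>These are the ways in which an induction up to \<open>a\<close> can end: failure at 0,
  success at \<open>a\<close>, or a failing step, located at the new element.\<close>

lemma cond_induct:
  assumes y: "good y" and \<phi>: "Sig \<phi>" and E: "\<And>i. pb (E i)" and a: "pb a"
  shows "\<exists>y'. good y' \<and> extends y y' \<and>
    (cforces y' (case_nat (\<lambda>k. 0) E) (Neg \<phi>) \<or> cforces y' (case_nat a E) \<phi> \<or>
     cforces y' (case_nat (fst y') E) \<phi> \<and> cforces y' (case_nat (\<lambda>k. fst y' k + 1) E) (Neg \<phi>))"
proof -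
  obtain g A p where ygp: "y = (g, A, p)" by (cases y)
  have p: "pinj k (p k)" "polylog (\<lambda>k. card (p k))" for k
    using y unfolding ygp good_def by auto
  have "\<And>i. pb (case_nat a E i)"
    using a E by (rule pb_case_nat)
  with \<phi> have "forceable_on (case_nat a E) \<phi>" by (rule Sig_forceable)
  then obtain d where d: "polylog d"
    "\<And>k e R. (\<And>i. e i \<le> case_nat a E i k) \<Longrightarrow> maxinj k R \<Longrightarrow> sat (std R) e \<phi> \<Longrightarrow>
      \<exists>q\<subseteq>R. card q \<le> d k \<and> forces k q e \<phi>"
    by (rule forceable_onE) blast
  define D where "D k = card (p k) + d k + blen (a k)" for k
  have D: "polylog D"
    unfolding D_def by (intro polylog_add p(2) d(1) a)
  define \<Phi> where "\<Phi> j k x q \<longleftrightarrow>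
      (if j = (0::nat) then forces k q (case_nat 0 (\<lambda>i. E i k)) (Neg \<phi>)
       else if j = 1 then forces k q (case_nat (a k) (\<lambda>i. E i k)) \<phi>
       else forces k q (case_nat x (\<lambda>i. E i k)) \<phi> \<and> forces k q (case_nat (x + 1) (\<lambda>i. E i k)) (Neg \<phi>))"
    for j k x q
  have "\<exists>j\<in>{0, 1, 2}. \<exists>g' A' p'. good (g', A', p') \<and> extends (g, A, p) (g', A', p') \<and>
    (\<forall>k\<in>A'. \<Phi> j k (g' k) (p' k))"
  proof (rule pointwise_extension[OF y[unfolded ygp] D])
    fix k assume "k \<in> A"
    \<comment> \<open>The arguments at which \<phi> is still possible. Outside \<open>X\<close> the
      negation is forced by \<open>p k\<close> itself, so a certificate added for
      \<open>Max X\<close> cannot disturb it at the successor.\<close>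
    define X where "X = {x. x \<le> a k \<and> (\<exists>R. maxinj k R \<and> p k \<subseteq> R \<and> sat (std R) (case_nat x (\<lambda>i. E i k)) \<phi>)}"
    have "finite X" unfolding X_def by simp
    have notin: "forces k (p k) (case_nat x (\<lambda>i. E i k)) (Neg \<phi>)" if "x \<le> a k" "x \<notin> X" for x
      using that unfolding X_def forces_def by auto
    show "\<exists>j\<in>{0, 1, 2}. \<exists>x q. p k \<subseteq> q \<and> pinj k q \<and> card q \<le> D k \<and> blen x \<le> D k \<and> \<Phi> j k x q"
    proof (cases "X = {}")
      case True
      then have "\<Phi> 0 k 0 (p k)"
        unfolding \<Phi>_def using notin[of 0] by simp
      moreover have "card (p k) \<le> D k" "blen 0 \<le> D k"
        unfolding D_def by simp_all
      ultimately show ?thesis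
        using p(1)[of k] by blast
    next
      case False
      define x where "x = Max X"
      have "x \<in> X" unfolding x_def using \<open>finite X\<close> False by simp
      then obtain R where x: "x \<le> a k"
        and R: "maxinj k R" "p k \<subseteq> R" "sat (std R) (case_nat x (\<lambda>i. E i k)) \<phi>"
        unfolding X_def by blast
      have "case_nat x (\<lambda>i. E i k) i \<le> case_nat a E i k" for i
        using x by (cases i) auto
      then obtain q where q: "q \<subseteq> R" "card q \<le> d k" "forces k q (case_nat x (\<lambda>i. E i k)) \<phi>"
        using d(2)[OF _ R(1,3)] by blast
      have f: "forces k (p k \<union> q) (case_nat x (\<lambda>i. E i k)) \<phi>"
        using q(3) by (rule forces_mono) blast
      have "\<exists>j\<in>{0, 1, 2}. \<Phi> j k x (p k \<union> q)"
      proof (cases "x = a k")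
        case True
        then show ?thesis using f unfolding \<Phi>_def by (intro bexI[of _ 1]) auto
      next
        case False
        have "x + 1 \<notin> X"
          using Max_ge[OF \<open>finite X\<close>, of "x + 1"] unfolding x_def by auto
        then have "forces k (p k) (case_nat (x + 1) (\<lambda>i. E i k)) (Neg \<phi>)"
          using False x by (intro notin) auto
        then have "forces k (p k \<union> q) (case_nat (x + 1) (\<lambda>i. E i k)) (Neg \<phi>)"
          by (rule forces_mono) blast
        then show ?thesis using f unfolding \<Phi>_def by (intro bexI[of _ 2]) auto
      qed
      moreover have "pinj k (p k \<union> q)"
        using R(1) unfolding maxinj_def by (rule conjE) (erule pinj_subset, use R q in blast)
      moreover have "card (p k \<union> q) \<le> D k"
        using q(2) card_Un_le[of "p k" q] unfolding D_def by linarith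
      moreover have "blen x \<le> D k"
        using blen_mono[OF x] unfolding D_def by simp
      ultimately show ?thesis by blast
    qed
  qed simp
  then obtain j g' A' p' where y': "good (g', A', p')" "extends (g, A, p) (g', A', p')"
    "\<forall>k\<in>A'. \<Phi> j k (g' k) (p' k)" by blast
  have "cforces (g', A', p') (case_nat (\<lambda>k. 0) E) (Neg \<phi>) \<or> cforces (g', A', p') (case_nat a E) \<phi> \<or>
    cforces (g', A', p') (case_nat g' E) \<phi> \<and> cforces (g', A', p') (case_nat (\<lambda>k. g' k + 1) E) (Neg \<phi>)"
    using y'(3) unfolding cforces_def \<Phi>_def case_nat_app split_conv by (cases "j = 0"; cases "j = 1") simp_all
  then show ?thesis
    using y'(1,2) unfolding ygp by (intro HOL.exI[of _ "(g', A', p')"]) simp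
qed

section \<open>The pigeonhole principle for conditions\<close>

definition php_inj :: "trm \<Rightarrow> trm \<Rightarrow> form \<Rightarrow> form" where
  "php_inj p h \<phi> = ExB p (ExB (tlift p) (And (Neg (Eq (Var 1) (Var 0)))
     (ExB (tlift (tlift h)) (And (app2 3 \<phi> (Var 2) (Var 0)) (app2 3 \<phi> (Var 1) (Var 0))))))"

definition php_fun :: "trm \<Rightarrow> trm \<Rightarrow> form \<Rightarrow> form" where
  "php_fun p h \<phi> = ExB p (ExB (tlift h) (ExB (tlift (tlift h)) (And (Neg (Eq (Var 1) (Var 0)))
     (And (app2 3 \<phi> (Var 2) (Var 1)) (app2 3 \<phi> (Var 2) (Var 0))))))"

lemma sat_app2: "sat M e (app2 k \<phi> s t) \<longleftrightarrow>
    sat M (case_nat (tval M e s) (case_nat (tval M e t) (\<lambda>j. e (j + k)))) \<phi>"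
proof -
  have "(\<lambda>i. tval M e (case_nat s (case_nat t (\<lambda>j. Var (j + k))) i)) =
      case_nat (tval M e s) (case_nat (tval M e t) (\<lambda>j. e (j + k)))"
    by (auto simp: fun_eq_iff split: nat.split)
  then show ?thesis by (simp add: app2_def sat_subst)
qed

lemma sat_php_inj: "sat M e (php_inj p h \<phi>) \<longleftrightarrow> (\<exists>a a' b. less_of M a (tval M e p) \<and>
    less_of M a' (tval M e p) \<and> a \<noteq> a' \<and> less_of M b (tval M e h) \<and>
    sat M (case_nat a (case_nat b e)) \<phi> \<and> sat M (case_nat a' (case_nat b e)) \<phi>)"
  by (auto simp: php_inj_def sat_ExB sat_app2 eval_nat_numeral)

lemma sat_php_fun: "sat M e (php_fun p h \<phi>) \<longleftrightarrow> (\<exists>a b b'. less_of M a (tval M e p) \<and>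
    less_of M b (tval M e h) \<and> less_of M b' (tval M e h) \<and> b \<noteq> b' \<and>
    sat M (case_nat a (case_nat b e)) \<phi> \<and> sat M (case_nat a (case_nat b' e)) \<phi>)"
  by (auto simp: php_fun_def sat_ExB sat_app2 eval_nat_numeral)

lemma sat_PHP: "sat M e (PHP p h \<phi>) \<longleftrightarrow>
    (\<exists>a. less_of M a (tval M e p) \<and>
       (\<forall>b. less_of M b (tval M e h) \<longrightarrow> \<not> sat M (case_nat a (case_nat b e)) \<phi>)) \<or>
    sat M e (php_inj p h \<phi>) \<or> sat M e (php_fun p h \<phi>)"
  unfolding PHP_def php_inj_def[symmetric] php_fun_def[symmetric]
  by (simp add: sat_ExB sat_AllB sat_app2 eval_nat_numeral)

lemma Sig_app2: "Sig \<phi> \<Longrightarrow> Sig (app2 k \<phi> s t)"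
  unfolding app2_def by (rule Sig_subst)

lemma Sig_Neg_Eq: "Sig (Neg (Eq s t))"
  by (intro Sig.sharp sharply_bounded.intros)

text \<open>Collisions can thus be forced like any other \<open>Sig\<close> formula. The first
  disjunct of \<open>PHP\<close>, with its inner universal quantifier, is treated separately in
  \<open>cond_pigeon\<close>.\<close>

lemma Sig_php_inj: "Sig \<phi> \<Longrightarrow> Sig (php_inj p h \<phi>)"
  unfolding php_inj_def by (intro Sig.exb Sig.conj Sig_Neg_Eq Sig_app2)

lemma Sig_php_fun: "Sig \<phi> \<Longrightarrow> Sig (php_fun p h \<phi>)"
  unfolding php_fun_def by (intro Sig.exb Sig.conj Sig_Neg_Eq Sig_app2)

text \<open>Otherwise the certificates \<open>W a\<close> satisfy all hypotheses of
  \<open>no_small_pigeonhole_violation\<close>: the negated conclusion is what provides totality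
  over small injections.\<close>

lemma world_pigeonhole:
  fixes m :: nat and e :: "nat \<Rightarrow> nat" and \<phi> :: form
  defines "\<Phi> \<equiv> \<lambda>R a b. sat (std R) (case_nat a (case_nat b e)) \<phi>"
  assumes p: "pinj k p"
    and d: "\<And>R a b. maxinj k R \<Longrightarrow> a \<le> m \<Longrightarrow> b < m \<Longrightarrow> \<Phi> R a b \<Longrightarrow>
      \<exists>q\<subseteq>R. card q \<le> d \<and> forces k q (case_nat a (case_nat b e)) \<phi>"
    and functional: "\<And>R a b b'. maxinj k R \<Longrightarrow> p \<subseteq> R \<Longrightarrow> a \<le> m \<Longrightarrow> b < m \<Longrightarrow> b' < m \<Longrightarrow>
      \<Phi> R a b \<Longrightarrow> \<Phi> R a b' \<Longrightarrow> b = b'"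
    and injective: "\<And>R a a' b. maxinj k R \<Longrightarrow> p \<subseteq> R \<Longrightarrow> a \<le> m \<Longrightarrow> a' \<le> m \<Longrightarrow> b < m \<Longrightarrow>
      \<Phi> R a b \<Longrightarrow> \<Phi> R a' b \<Longrightarrow> a = a'"
    and bound: "D + (m + 1) * (4 * D * D) \<le> k" and D: "card p + d \<le> D"
  shows "\<exists>a p'. a \<le> m \<and> p \<subseteq> p' \<and> pinj k p' \<and> card p' \<le> 8 * D * D + 3 * D \<and>
    (\<forall>R. maxinj k R \<longrightarrow> p' \<subseteq> R \<longrightarrow> (\<forall>b<m. \<not> \<Phi> R a b))"
proof (rule ccontr)
  assume none: "\<not> ?thesis"
  \<comment> \<open>Certificates must contain \<open>p\<close>, since functionality and injectivity
    are known for completions of \<open>p\<close>.\<close>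
  define W where "W a = {(q, b). p \<subseteq> q \<and> pinj k q \<and> card q \<le> D \<and> b < m \<and>
    forces k q (case_nat a (case_nat b e)) \<phi>}" for a
  show False
  proof (rule no_small_pigeonhole_violation[where W = W, OF p])
    show "card p \<le> D" using D by simp
    show "pinj k q \<and> card q \<le> D \<and> b < m" if "(q, b) \<in> W a" for a q b
      using that unfolding W_def by simp
    show "\<not> pinj k (q \<union> q')" if "a \<le> m" "(q, b) \<in> W a" "(q', b') \<in> W a" "b \<noteq> b'" for a q b q' b'
    proof
      assume "pinj k (q \<union> q')"
      then obtain R where "maxinj k R" "q \<union> q' \<subseteq> R" using maxinj_extends by blast
      then show False
        using that functional[of R a b b'] unfolding W_def forces_def \<Phi>_def by auto
    qed
    show "\<not> pinj k (q \<union> q')" if "a \<le> m" "a' \<le> m" "a \<noteq> a'" "(q, b) \<in> W a" "(q', b) \<in> W a'" for a a' q q' b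
    proof
      assume "pinj k (q \<union> q')"
      then obtain R where "maxinj k R" "q \<union> q' \<subseteq> R" using maxinj_extends by blast
      then show False
        using that injective[of R a a' b] unfolding W_def forces_def \<Phi>_def by auto
    qed
    show "\<exists>q b. (q, b) \<in> W a \<and> pinj k (q \<union> p')"
      if a: "a \<le> m" and p': "pinj k p'" "p \<subseteq> p'" "card p' \<le> 8 * D * D + 3 * D" for a p'
    proof -
      obtain R b where R: "maxinj k R" "p' \<subseteq> R" "b < m" "\<Phi> R a b"
        using none a p' by blast
      then obtain q where q: "q \<subseteq> R" "card q \<le> d" "forces k q (case_nat a (case_nat b e)) \<phi>"
        using d[OF R(1) a R(3,4)] by blast
      have inj: "pinj k (p \<union> q \<union> p')"
        using R(1) unfolding maxinj_def by (rule conjE) (erule pinj_subset, use R q p' in blast)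
      have "card (p \<union> q) \<le> D"
        using D q(2) card_Un_le[of p q] by linarith
      moreover have "forces k (p \<union> q) (case_nat a (case_nat b e)) \<phi>"
        using q(3) by (rule forces_mono) blast
      moreover have "pinj k (p \<union> q)"
        using inj by (rule pinj_subset) blast
      ultimately have "(p \<union> q, b) \<in> W a"
        unfolding W_def using R(3) by simp
      then show ?thesis using inj by blast
    qed
  qed (rule bound)
qed

text \<open>With \<open>m = E 0\<close>: either \<open>m\<close> is out of range, or some completion
  violates injectivity or functionality and this violation is forced, or no completion does. In the
  last case \<open>world_pigeonhole\<close> applies, and its pigeon becomes the new element.\<close>

lemma cond_pigeon:
  fixes \<phi> r E
  defines "J1 \<equiv> php_inj (Add (Var 0) One) (Var 0) \<phi>" and "J2 \<equiv> php_fun (Add (Var 0) One) (Var 0) \<phi>"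
  assumes r: "r < 1" and y: "good (g, A, p)" and \<phi>: "Sig \<phi>" and E: "\<And>i. pb (E i)"
  shows "\<exists>g' A' p'. good (g', A', p') \<and> extends (g, A, p) (g', A', p') \<and>
    ((\<forall>k\<in>A'. \<not> below_pow r (E 0 k) k) \<or> cforces (g', A', p') E J1 \<or> cforces (g', A', p') E J2 \<or>
     (\<forall>k\<in>A'. g' k \<le> E 0 k \<and> (\<forall>R. maxinj k R \<longrightarrow> p' k \<subseteq> R \<longrightarrow>
        (\<forall>b<E 0 k. \<not> sat (std R) (case_nat (g' k) (case_nat b (\<lambda>i. E i k))) \<phi>))))"
proof -
  have p: "pinj k (p k)" "polylog (\<lambda>k. card (p k))" for k
    using y unfolding good_def by auto
  have "\<And>i. pb (case_nat (E 0) (case_nat (E 0) E) i)"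
    using E by (intro pb_case_nat)
  with \<phi> have "forceable_on (case_nat (E 0) (case_nat (E 0) E)) \<phi>" by (rule Sig_forceable)
  then obtain d where d: "polylog d"
    "\<And>k e R. (\<And>i. e i \<le> case_nat (E 0) (case_nat (E 0) E) i k) \<Longrightarrow> maxinj k R \<Longrightarrow> sat (std R) e \<phi> \<Longrightarrow>
      \<exists>q\<subseteq>R. card q \<le> d k \<and> forces k q e \<phi>"
    by (rule forceable_onE) blast
  have "forceable_on E J1" unfolding J1_def using Sig_php_inj[OF \<phi>] E by (rule Sig_forceable)
  then obtain d1 where d1: "polylog d1"
    "\<And>k e R. (\<And>i. e i \<le> E i k) \<Longrightarrow> maxinj k R \<Longrightarrow> sat (std R) e J1 \<Longrightarrow>
      \<exists>q\<subseteq>R. card q \<le> d1 k \<and> forces k q e J1"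
    by (rule forceable_onE) blast
  have "forceable_on E J2" unfolding J2_def using Sig_php_fun[OF \<phi>] E by (rule Sig_forceable)
  then obtain d2 where d2: "polylog d2"
    "\<And>k e R. (\<And>i. e i \<le> E i k) \<Longrightarrow> maxinj k R \<Longrightarrow> sat (std R) e J2 \<Longrightarrow>
      \<exists>q\<subseteq>R. card q \<le> d2 k \<and> forces k q e J2"
    by (rule forceable_onE) blast
  define D where "D k = card (p k) + d k" for k
  have D: "polylog D" unfolding D_def by (intro polylog_add p(2) d(1))
  \<comment> \<open>Covers the cost of every alternative: the last summand is the size of the
    injection from \<open>world_pigeonhole\<close>, and \<open>blen (E 0 k)\<close> bounds the
    length of its pigeon.\<close>
  define D' where "D' k = D k + d1 k + d2 k + blen (E 0 k) + (8 * D k * D k + 3 * D k)" for k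
  have D': "polylog D'"
    unfolding D'_def by (intro polylog_add polylog_mult polylog_const D d1(1) d2(1) E)
  \<comment> \<open>Multiplied by \<open>m + 1\<close>, this dominates the number of pairs that
    \<open>world_pigeonhole\<close> requires to be at most \<open>k\<close>.\<close>
  have "polylog (\<lambda>k. D k + 4 * D k * D k)"
    by (intro polylog_add polylog_mult polylog_const D)
  from below_pow_bound[OF r this] obtain K
    where K: "\<And>k m. k \<ge> K \<Longrightarrow> below_pow r m k \<Longrightarrow> (m + 1) * (D k + 4 * D k * D k) \<le> k"
    by blast
  define \<Psi> where "\<Psi> k x q \<longleftrightarrow> x \<le> E 0 k \<and> (\<forall>R. maxinj k R \<longrightarrow> q \<subseteq> R \<longrightarrow>
        (\<forall>b<E 0 k. \<not> sat (std R) (case_nat x (case_nat b (\<lambda>i. E i k))) \<phi>))" for k x q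
  define \<Phi> where "\<Phi> j k x q \<longleftrightarrow>
      (if j = (0::nat) then \<not> below_pow r (E 0 k) k
       else if j = 1 then forces k q (\<lambda>i. E i k) J1
       else if j = 2 then forces k q (\<lambda>i. E i k) J2 else \<Psi> k x q)"
    for j k x q
  have "\<exists>j\<in>{0, 1, 2, 3}. \<exists>g' A' p'. good (g', A', p') \<and> extends (g, A, p) (g', A', p') \<and>
    (\<forall>k\<in>A'. \<Phi> j k (g' k) (p' k))"
  proof (rule pointwise_extension[OF y D'])
    fix k assume "k \<in> A" and k: "k \<ge> K"
    define e where "e = (\<lambda>i. E i k)"
    have found: "\<exists>q. p k \<subseteq> q \<and> pinj k q \<and> card q \<le> D' k \<and> forces k q e \<psi>"
      if R: "maxinj k R" "p k \<subseteq> R" and q: "\<exists>q\<subseteq>R. card q \<le> d' \<and> forces k q e \<psi>" and d': "D k + d' \<le> D' k"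
      for R d' \<psi>
    proof -
      obtain q where q: "q \<subseteq> R" "card q \<le> d'" "forces k q e \<psi>" using q by blast
      have "forces k (p k \<union> q) e \<psi>"
        using q(3) by (rule forces_mono) blast
      moreover have "pinj k (p k \<union> q)"
        using R(1) unfolding maxinj_def by (rule conjE) (erule pinj_subset, use R q in blast)
      moreover have "card (p k \<union> q) \<le> D' k"
        using q(2) d' card_Un_le[of "p k" q] unfolding D_def by linarith
      ultimately show ?thesis by blast
    qed
    consider (large) "\<not> below_pow r (E 0 k) k"
      | (inj) R where "maxinj k R" "p k \<subseteq> R" "sat (std R) e J1"
      | (func) R where "maxinj k R" "p k \<subseteq> R" "sat (std R) e J2"
      | (none) "below_pow r (E 0 k) k"
        "\<And>R. maxinj k R \<Longrightarrow> p k \<subseteq> R \<Longrightarrow> \<not> sat (std R) e J1"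
        "\<And>R. maxinj k R \<Longrightarrow> p k \<subseteq> R \<Longrightarrow> \<not> sat (std R) e J2"
      by blast
    then show "\<exists>j\<in>{0, 1, 2, 3}. \<exists>x q. p k \<subseteq> q \<and> pinj k q \<and> card q \<le> D' k \<and> blen x \<le> D' k \<and> \<Phi> j k x q"
    proof cases
      case large
      then have "\<Phi> 0 k 0 (p k)" unfolding \<Phi>_def by simp
      moreover have "card (p k) \<le> D' k" "blen 0 \<le> D' k" unfolding D'_def D_def by simp_all
      ultimately show ?thesis using p(1)[of k] by blast
    next
      case inj
      have "\<exists>q\<subseteq>R. card q \<le> d1 k \<and> forces k q e J1"
        using inj by (intro d1(2)) (simp_all add: e_def)
      moreover have "D k + d1 k \<le> D' k" unfolding D'_def by simp
      ultimately obtain q where q: "p k \<subseteq> q" "pinj k q" "card q \<le> D' k" "forces k q e J1"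
        using found[OF inj(1,2)] by blast
      then have "\<Phi> 1 k 0 q" unfolding \<Phi>_def e_def by simp
      moreover have "blen 0 \<le> D' k" by simp
      ultimately show ?thesis using q by blast
    next
      case func
      have "\<exists>q\<subseteq>R. card q \<le> d2 k \<and> forces k q e J2"
        using func by (intro d2(2)) (simp_all add: e_def)
      moreover have "D k + d2 k \<le> D' k" unfolding D'_def by simp
      ultimately obtain q where q: "p k \<subseteq> q" "pinj k q" "card q \<le> D' k" "forces k q e J2"
        using found[OF func(1,2)] by blast
      then have "\<Phi> 2 k 0 q" unfolding \<Phi>_def e_def by simp
      moreover have "blen 0 \<le> D' k" by simp
      ultimately show ?thesis using q by blast
    next
      case none
      have "\<exists>a p'. a \<le> E 0 k \<and> p k \<subseteq> p' \<and> pinj k p' \<and> card p' \<le> 8 * D k * D k + 3 * D k \<and>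
        (\<forall>R. maxinj k R \<longrightarrow> p' \<subseteq> R \<longrightarrow> (\<forall>b<E 0 k. \<not> sat (std R) (case_nat a (case_nat b e)) \<phi>))"
      proof (rule world_pigeonhole[OF p(1)])
        show "\<exists>q\<subseteq>R. card q \<le> d k \<and> forces k q (case_nat a (case_nat b e)) \<phi>"
          if "maxinj k R" "a \<le> E 0 k" "b < E 0 k" "sat (std R) (case_nat a (case_nat b e)) \<phi>" for R a b
        proof (rule d(2)[OF _ that(1,4)])
          show "case_nat a (case_nat b e) i \<le> case_nat (E 0) (case_nat (E 0) E) i k" for i
            using that by (auto simp: e_def split: nat.split)
        qed
        show "b = b'" if "maxinj k R" "p k \<subseteq> R" "a \<le> E 0 k" "b < E 0 k" "b' < E 0 k"
          "sat (std R) (case_nat a (case_nat b e)) \<phi>" "sat (std R) (case_nat a (case_nat b' e)) \<phi>" for R a b b'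
          using none(3)[OF that(1,2)] that(3-) unfolding J2_def sat_php_fun
          by (auto simp: e_def less_Suc_eq_le)
        show "a = a'" if "maxinj k R" "p k \<subseteq> R" "a \<le> E 0 k" "a' \<le> E 0 k" "b < E 0 k"
          "sat (std R) (case_nat a (case_nat b e)) \<phi>" "sat (std R) (case_nat a' (case_nat b e)) \<phi>" for R a a' b
          using none(2)[OF that(1,2)] that(3-) unfolding J1_def sat_php_inj
          by (auto simp: e_def less_Suc_eq_le)
        show "D k + (E 0 k + 1) * (4 * D k * D k) \<le> k"
          using K[OF k none(1)] by (simp add: algebra_simps)
        show "card (p k) + d k \<le> D k" unfolding D_def by simp
      qed
      then have "\<exists>a p'. p k \<subseteq> p' \<and> pinj k p' \<and> card p' \<le> 8 * D k * D k + 3 * D k \<and> \<Psi> k a p'"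
        unfolding \<Psi>_def e_def by (elim HOL.exE conjE) (intro HOL.exI conjI; assumption)
      then obtain a p' where a: "p k \<subseteq> p'" "pinj k p'" "card p' \<le> 8 * D k * D k + 3 * D k"
        "\<Psi> k a p'" by blast
      have le: "a \<le> E 0 k"
        using a(4) unfolding \<Psi>_def by blast
      have "\<Phi> 3 k a p'" using a(4) unfolding \<Phi>_def by simp
      moreover have "card p' \<le> D' k" "blen a \<le> D' k"
        using a(3) blen_mono[OF le] unfolding D'_def by simp_all
      ultimately show ?thesis using a(1,2) by blast
    qed
  qed simp
  then obtain j g' A' p' where y': "good (g', A', p')" "extends (g, A, p) (g', A', p')"
    "\<forall>k\<in>A'. \<Phi> j k (g' k) (p' k)" by blast
  consider "j = 0" | "j = 1" | "j = 2" | "j \<noteq> 0 \<and> j \<noteq> 1 \<and> j \<noteq> 2" by blast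
  then show ?thesis
  proof cases
    case 1
    then have "\<forall>k\<in>A'. \<not> below_pow r (E 0 k) k"
      using y'(3) unfolding \<Phi>_def by simp
    then show ?thesis using y'(1,2) by blast
  next
    case 2
    then have "cforces (g', A', p') E J1"
      using y'(3) unfolding \<Phi>_def cforces_def by simp
    then show ?thesis using y'(1,2) by blast
  next
    case 3
    then have "cforces (g', A', p') E J2"
      using y'(3) unfolding \<Phi>_def cforces_def by simp
    then show ?thesis using y'(1,2) by blast
  next
    case 4
    then have "\<forall>k\<in>A'. \<Psi> k (g' k) (p' k)"
      using y'(3) unfolding \<Phi>_def by simp
    then show ?thesis
      using y'(1,2) unfolding \<Psi>_def by (intro HOL.exI[of _ g'] HOL.exI[of _ A'] HOL.exI[of _ p'] conjI disjI2)
  qed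
qed

section \<open>The generic sequence\<close>

text \<open>Requirements refer to elements that are created only along the way. So the recursion
  carries the whole history \<open>L s\<close>, and each requirement has to come up after its
  parameters exist.\<close>

lemma generic_sequence:
  fixes ok :: "'y \<Rightarrow> bool" and le :: "'y \<Rightarrow> 'y \<Rightarrow> bool"
    and P :: "'i::countable \<Rightarrow> 'y list \<Rightarrow> 'y \<Rightarrow> bool"
  assumes y0: "ok y0"
    and step: "\<And>y i xs. ok y \<Longrightarrow> (\<And>x. x \<in> set xs \<Longrightarrow> ok x) \<Longrightarrow> \<exists>y'. ok y' \<and> le y y' \<and> P i xs y'"
  shows "\<exists>Y. Y 0 = y0 \<and> (\<forall>s. ok (Y s)) \<and> (\<forall>s. le (Y s) (Y (Suc s))) \<and>
    (\<forall>i js. \<exists>s. P i (map Y js) (Y s))"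
proof -
  define F where "F y i xs = (SOME y'. ok y' \<and> le y y' \<and> P i xs y')" for y i xs
  have F: "ok (F y i xs) \<and> le y (F y i xs) \<and> P i xs (F y i xs)"
    if "ok y" "\<And>x. x \<in> set xs \<Longrightarrow> ok x" for y i xs
    unfolding F_def by (rule someI_ex) (rule step[OF that])
  define task :: "nat \<Rightarrow> 'i \<times> nat list \<times> nat" where "task = from_nat"
  define L where "L = rec_nat [y0] (\<lambda>s l. l @ [F (l ! s) (fst (task s))
    (map ((!) l) (filter (\<lambda>j. j \<le> s) (fst (snd (task s)))))])"
  define Y where "Y s = L s ! s" for s
  have L0: "L 0 = [y0]" and LS: "L (Suc s) = L s @ [F (L s ! s) (fst (task s))
    (map ((!) (L s)) (filter (\<lambda>j. j \<le> s) (fst (snd (task s)))))]" for s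
    by (simp_all add: L_def)
  have len: "length (L s) = Suc s" for s
    by (induction s) (simp_all add: L0 LS)
  have L_Y: "L s ! j = Y j" if "j \<le> s" for j s
    using that
  proof (induction s)
    case (Suc s)
    then show ?case
      by (cases "j = Suc s") (simp_all add: LS nth_append len Y_def)
  qed (simp add: Y_def)
  have map_eq: "map ((!) (L s)) (filter (\<lambda>j. j \<le> s) js) = map Y (filter (\<lambda>j. j \<le> s) js)" for s js
    using L_Y by simp
  have YS: "Y (Suc s) = F (Y s) (fst (task s)) (map Y (filter (\<lambda>j. j \<le> s) (fst (snd (task s)))))" for s
    unfolding Y_def[of "Suc s"] LS map_eq using len[of s] L_Y[of s s] by (simp add: nth_append)
  have ok: "ok (Y s)" for s
  proof (induction s rule: less_induct)
    case (less s)
    show ?case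
    proof (cases s)
      case 0
      then show ?thesis using y0 by (simp add: Y_def L0)
    next
      case (Suc s')
      have "ok (Y s')" using less Suc by simp
      moreover have "ok x" if "x \<in> set (map Y (filter (\<lambda>j. j \<le> s') js))" for x js
        using that less Suc by auto
      ultimately show ?thesis unfolding Suc YS by (intro conjunct1[OF F])
    qed
  qed
  have props: "le (Y s) (Y (Suc s)) \<and> P (fst (task s)) (map Y (filter (\<lambda>j. j \<le> s) (fst (snd (task s))))) (Y (Suc s))" for s
    unfolding YS by (rule conjunct2[OF F]) (auto intro: ok)
  have "\<exists>s. P i (map Y js) (Y s)" for i js
  proof -
    \<comment> \<open>The dummy component \<open>c\<close> gives each task infinitely many codes;
      one of them exceeds all indices in \<open>js\<close>, and at that stage the filter drops
      nothing.\<close>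
    have "inj (\<lambda>c. to_nat (i, js, c :: nat))"
      by (auto intro!: injI)
    then have "infinite (range (\<lambda>c. to_nat (i, js, c :: nat)))"
      by (rule range_inj_infinite)
    then obtain c where c: "to_nat (i, js, c :: nat) > Max (insert 0 (set js))"
      unfolding infinite_nat_iff_unbounded by blast
    define s where "s = to_nat (i, js, c :: nat)"
    have "task s = (i, js, c)" unfolding task_def s_def by simp
    moreover have "filter (\<lambda>j. j \<le> s) js = js"
    proof (rule filter_True, rule ballI)
      fix j assume "j \<in> set js"
      then have "j \<le> Max (insert 0 (set js))" by (intro Max_ge) auto
      then show "j \<le> s" using c unfolding s_def by linarith
    qed
    ultimately have "P i (map Y js) (Y (Suc s))"
      using props[of s] by simp
    then show ?thesis by blast
  qed
  moreover have "Y 0 = y0" by (simp add: Y_def L0)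
  ultimately show ?thesis using ok props by blast
qed

section \<open>Requirements met by the generic sequence\<close>

datatype task = Decide form | Witness trm form | Induct form | Pigeon form

instance task :: countable
  by countable_datatype

definition shift :: "(nat \<Rightarrow> 'a) \<Rightarrow> nat \<Rightarrow> 'a" where
  "shift E i = E (Suc i)"

text \<open>In \<open>Induct\<close>, \<open>E 0\<close> is the end point of the induction and
  \<open>shift E\<close> holds the parameters; in \<open>Pigeon\<close>, \<open>E 0\<close> is
  \<open>m\<close>.\<close>

primrec meets :: "rat \<Rightarrow> task \<Rightarrow> (nat \<Rightarrow> nat \<Rightarrow> nat) \<Rightarrow> cond \<Rightarrow> bool" where
  "meets r (Decide \<phi>) E y \<longleftrightarrow> (Sig \<phi> \<longrightarrow> cforces y E \<phi> \<or> cforces y E (Neg \<phi>))"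
| "meets r (Witness t \<phi>) E y \<longleftrightarrow> (Sig \<phi> \<longrightarrow> cforces y E (Neg (ExB t \<phi>)) \<or>
     cforces y (case_nat (fst y) E) (And (Less (Var 0) (tlift t)) \<phi>))"
| "meets r (Induct \<phi>) E y \<longleftrightarrow> (Sig \<phi> \<longrightarrow> cforces y (case_nat (\<lambda>k. 0) (shift E)) (Neg \<phi>) \<or>
     cforces y (case_nat (E 0) (shift E)) \<phi> \<or>
     cforces y (case_nat (fst y) (shift E)) \<phi> \<and>
     cforces y (case_nat (\<lambda>k. fst y k + 1) (shift E)) (Neg \<phi>))"
| "meets r (Pigeon \<phi>) E y \<longleftrightarrow> (Sig \<phi> \<longrightarrow> (case y of (g, A, p) \<Rightarrow>
     (\<forall>k\<in>A. \<not> below_pow r (E 0 k) k) \<or>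
     cforces y E (php_inj (Add (Var 0) One) (Var 0) \<phi>) \<or>
     cforces y E (php_fun (Add (Var 0) One) (Var 0) \<phi>) \<or>
     (\<forall>k\<in>A. g k \<le> E 0 k \<and> (\<forall>R. maxinj k R \<longrightarrow> p k \<subseteq> R \<longrightarrow>
        (\<forall>b<E 0 k. \<not> sat (std R) (case_nat (g k) (case_nat b (\<lambda>i. E i k))) \<phi>)))))"

lemma extends_refl: "extends y y"
  by (auto simp: extends_def split: prod.split)

lemma meets_extension:
  assumes "r < 1" "good y" "\<And>i. pb (E i)"
  shows "\<exists>y'. good y' \<and> extends y y' \<and> meets r T E y'"
proof (cases T)
  case (Decide \<phi>)
  show ?thesis
  proof (cases "Sig \<phi>")
    case True
    then show ?thesis using cond_decide[of y \<phi> E] assms unfolding Decide meets.simps by blast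
  next
    case False
    then show ?thesis using assms(2) extends_refl unfolding Decide meets.simps by blast
  qed
next
  case (Witness t \<phi>)
  show ?thesis
  proof (cases "Sig \<phi>")
    case True
    then show ?thesis using cond_witness[of y \<phi> E t] assms unfolding Witness meets.simps by blast
  next
    case False
    then show ?thesis using assms(2) extends_refl unfolding Witness meets.simps by blast
  qed
next
  case (Induct \<phi>)
  show ?thesis
  proof (cases "Sig \<phi>")
    case True
    have "\<And>i. pb (shift E i)" unfolding shift_def using assms(3) .
    with True show ?thesis
      using cond_induct[of y \<phi> "shift E" "E 0"] assms unfolding Induct meets.simps by blast
  next
    case False
    then show ?thesis using assms(2) extends_refl unfolding Induct meets.simps by blast
  qed
next
  case (Pigeon \<phi>)
  show ?thesis
  proof (cases "Sig \<phi>")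
    case True
    obtain g A p where y: "y = (g, A, p)" by (cases y)
    obtain g' A' p' where "good (g', A', p')" "extends y (g', A', p')"
      "meets r (Pigeon \<phi>) E (g', A', p')"
      using cond_pigeon[OF assms(1) assms(2)[unfolded y] True, of E] assms(3)
      unfolding y meets.simps prod.case by metis
    then show ?thesis unfolding Pigeon by blast
  next
    case False
    then show ?thesis using assms(2) extends_refl unfolding Pigeon meets.simps by blast
  qed
qed

lemma generic_conditions:
  assumes "r < 1"
  shows "\<exists>Y. fst (Y 0) = id \<and> (\<forall>s. good (Y s)) \<and> (\<forall>s. extends (Y s) (Y (Suc s))) \<and>
    (\<forall>T js. \<exists>s. meets r T (\<lambda>i. if i < length js then fst (Y (js ! i)) else (\<lambda>k. 0)) (Y s))"
proof -
  define env :: "cond list \<Rightarrow> nat \<Rightarrow> nat \<Rightarrow> nat" where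
    "env ys i = (if i < length ys then fst (ys ! i) else (\<lambda>k. 0))" for ys i
  have env_map: "env (map Y js) = (\<lambda>i. if i < length js then fst (Y (js ! i)) else (\<lambda>k. 0))" for Y js
    by (auto simp: env_def fun_eq_iff)
  have "\<exists>Y. Y 0 = (id, UNIV, \<lambda>k. {}) \<and> (\<forall>s. good (Y s)) \<and> (\<forall>s. extends (Y s) (Y (Suc s))) \<and>
    (\<forall>T js. \<exists>s. meets r T (env (map Y js)) (Y s))"
  proof (rule generic_sequence)
    show "good (id, UNIV, \<lambda>k. {})"
      unfolding good_def by (simp add: polylog_blen pinj_def)
    fix y :: cond and T and ys :: "cond list"
    assume y: "good y" and ys: "\<And>x. x \<in> set ys \<Longrightarrow> good x"
    have "pb (env ys i)" for i
      using ys[of "ys ! i"] by (cases "i < length ys") (auto simp: env_def good_def)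
    then show "\<exists>y'. good y' \<and> extends y y' \<and> meets r T (env ys) y'"
      using meets_extension[OF assms y] by blast
  qed
  then obtain Y where Y: "Y 0 = (id, UNIV, \<lambda>k. {})" "\<forall>s. good (Y s)" "\<forall>s. extends (Y s) (Y (Suc s))"
    "\<forall>T js. \<exists>s. meets r T (env (map Y js)) (Y s)"
    by (elim HOL.exE conjE)
  then show ?thesis
    unfolding env_map by (intro HOL.exI[of _ Y] conjI) simp_all
qed

locale generic =
  fixes r :: rat and Y :: "nat \<Rightarrow> cond"
  assumes Y0: "fst (Y 0) = id"
    and Y_good: "good (Y s)"
    and Y_extends: "extends (Y s) (Y (Suc s))"
    and Y_meets: "\<exists>s. meets r T (\<lambda>i. if i < length js then fst (Y (js ! i)) else (\<lambda>k. 0)) (Y s)"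
begin

section \<open>The generic filter\<close>

definition worlds :: "nat \<Rightarrow> (nat \<times> (nat \<times> nat) set) set" where
  "worlds s = {(k, R). k \<in> fst (snd (Y s)) \<and> maxinj k R \<and> snd (snd (Y s)) k \<subseteq> R}"

text \<open>Only a filter generated by the decreasing sets \<open>worlds s\<close>;
  \<open>decided\<close> will show that it decides \<open>Sig\<close> formulas about elements of the
  model.\<close>

definition G :: "(nat \<times> (nat \<times> nat) set) filter" where
  "G = (INF s. principal (worlds s))"

lemma worlds_antimono: "s \<le> t \<Longrightarrow> worlds t \<subseteq> worlds s"
proof (induction t rule: dec_induct)
  case (step t)
  have "worlds (Suc t) \<subseteq> worlds t"
    using Y_extends[of t] unfolding worlds_def extends_def by (fastforce split: prod.splits)
  with step show ?case by blast
qed simp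

lemma eventually_G: "eventually Q G \<longleftrightarrow> (\<exists>s. \<forall>w\<in>worlds s. Q w)"
proof -
  have "eventually Q G \<longleftrightarrow> (\<exists>s\<in>UNIV. eventually Q (principal (worlds s)))"
    unfolding G_def
  proof (rule eventually_INF_base)
    show "\<exists>x\<in>UNIV. principal (worlds x) \<le> inf (principal (worlds a)) (principal (worlds b))" for a b
      using worlds_antimono[of a "max a b"] worlds_antimono[of b "max a b"]
      by (intro bexI[of _ "max a b"]) auto
  qed simp
  then show ?thesis by (simp add: eventually_principal)
qed

lemma G_nontrivial: "G \<noteq> bot"
proof -
  have "worlds s \<noteq> {}" for s
  proof -
    obtain g A p where y: "Y s = (g, A, p)" by (cases "Y s")
    then have A: "infinite A" "pinj k (p k)" for k using Y_good[of s] unfolding good_def by auto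
    then obtain k where "k \<in> A" using infinite_imp_nonempty by blast
    moreover obtain R where "maxinj k R" "p k \<subseteq> R" using maxinj_extends[OF A(2)] by blast
    ultimately have "(k, R) \<in> worlds s" unfolding worlds_def y by simp
    then show ?thesis by blast
  qed
  then show ?thesis
    unfolding trivial_limit_def eventually_G by blast
qed

definition forced :: "(nat \<Rightarrow> nat \<Rightarrow> nat) \<Rightarrow> form \<Rightarrow> bool" where
  "forced E \<phi> \<longleftrightarrow> (\<forall>\<^sub>F w in G. sat (std (snd w)) (\<lambda>i. E i (fst w)) \<phi>)"

definition sim :: "(nat \<Rightarrow> nat) \<Rightarrow> (nat \<Rightarrow> nat) \<Rightarrow> bool" where
  "sim f g \<longleftrightarrow> (\<forall>\<^sub>F w in G. f (fst w) = g (fst w))"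

lemma cforces_forced: "cforces (Y s) E \<phi> \<Longrightarrow> forced E \<phi>"
  unfolding forced_def eventually_G cforces_def worlds_def forces_def
  by (intro HOL.exI[of _ s]) (auto split: prod.splits)

lemma maxinj_G: "\<forall>\<^sub>F w in G. maxinj (fst w) (snd w)"
  unfolding eventually_G worlds_def by auto

lemma forced_Neg:
  assumes "forced E \<phi>" "forced E (Neg \<phi>)"
  shows False
proof -
  have "\<forall>\<^sub>F w in G. False"
    using assms unfolding forced_def by eventually_elim simp
  then show False using G_nontrivial by (simp add: trivial_limit_def)
qed

lemma sim_refl [simp]: "sim f f"
  unfolding sim_def by simp

lemma sim_sym: "sim f g \<Longrightarrow> sim g f"
  unfolding sim_def by (simp add: eq_commute)

lemma sim_trans: assumes "sim f g" "sim g h" shows "sim f h"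
  using assms unfolding sim_def by eventually_elim simp

lemma forced_sim:
  assumes "forced (case_nat f E) \<phi>" "sim f g"
  shows "forced (case_nat g E) \<phi>"
  using assms unfolding forced_def sim_def
  by eventually_elim (simp add: case_nat_app)

lemma sim_cong:
  assumes "sim f f'" "sim g g'"
  shows "sim f g \<longleftrightarrow> sim f' g'"
proof
  assume "sim f g"
  with assms show "sim f' g'"
    unfolding sim_def by eventually_elim simp
next
  assume "sim f' g'"
  with assms show "sim f g"
    unfolding sim_def by eventually_elim simp
qed

abbreviation el :: "nat \<Rightarrow> nat \<Rightarrow> nat" where
  "el s \<equiv> fst (Y s)"

text \<open>Closure under terms comes from \<open>Witness\<close>: that some
  \<open>x < t + 1\<close> equals \<open>t\<close> is true in every world, and its generic witness
  represents \<open>t\<close>.\<close>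

lemma el_term:
  assumes E: "E = (\<lambda>i. if i < length js then el (js ! i) else (\<lambda>k. 0))"
  shows "\<exists>s. sim (el s) (\<lambda>k. tv (\<lambda>i. E i k) t)"
proof -
  define \<phi> where "\<phi> = Eq (Var 0) (tlift t)"
  obtain s where s: "meets r (Witness (Add t One) \<phi>) E (Y s)"
    using Y_meets unfolding E by blast
  have "Sig \<phi>" unfolding \<phi>_def by (intro Sig.sharp sharply_bounded.intros)
  with s have "cforces (Y s) E (Neg (ExB (Add t One) \<phi>)) \<or>
      cforces (Y s) (case_nat (el s) E) (And (Less (Var 0) (tlift (Add t One))) \<phi>)"
    by simp
  moreover have "forced E (ExB (Add t One) \<phi>)"
    unfolding forced_def by (simp add: sat_ExB \<phi>_def)
  ultimately have "forced (case_nat (el s) E) (And (Less (Var 0) (tlift (Add t One))) \<phi>)"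
    using cforces_forced forced_Neg by blast
  then have "sim (el s) (\<lambda>k. tv (\<lambda>i. E i k) t)"
    unfolding forced_def sim_def by eventually_elim (simp add: case_nat_app \<phi>_def)
  then show ?thesis by blast
qed

text \<open>Since equality of the model is identity on \<open>nat\<close>, its elements enumerate one representative
  of each class of generically equal functions.\<close>

definition reps :: "nat set" where
  "reps = {s. \<forall>s'<s. \<not> sim (el s') (el s)}"

lemma rep_exists: "\<exists>s'\<in>reps. sim (el s') (el s)"
proof -
  define s' where "s' = (LEAST s'. sim (el s') (el s))"
  have s': "sim (el s') (el s)"
    unfolding s'_def by (rule LeastI[of _ s]) simp
  moreover have "s' \<in> reps"
    unfolding reps_def
  proof (clarify)
    fix t assume "t < s'" "sim (el t) (el s')"
    then have "sim (el t) (el s)" using s' sim_trans by blast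
    then show False using \<open>t < s'\<close> unfolding s'_def by (meson not_less_Least)
  qed
  ultimately show ?thesis by blast
qed

lemma reps_inj: "s \<in> reps \<Longrightarrow> t \<in> reps \<Longrightarrow> sim (el s) (el t) \<Longrightarrow> s = t"
  using sim_sym unfolding reps_def by (cases s t rule: linorder_cases) auto

text \<open>The numerals lie in distinct classes. Infinitely many classes are needed for
  \<open>enumerate\<close> to match them with the universe \<open>nat\<close>.\<close>

lemma reps_infinite: "infinite reps"
proof -
  have "\<exists>s\<in>reps. sim (el s) (\<lambda>k. c)" for c
  proof -
    define num where "num = rec_nat Zero (\<lambda>n t. Add t One)"
    have num: "tv e (num c) = c" for e
      by (induction c) (simp_all add: num_def)
    obtain s where "sim (el s) (\<lambda>k. c)"
      using el_term[of _ "[]" "num c"] unfolding num by blast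
    then show ?thesis using rep_exists[of s] sim_trans by blast
  qed
  then obtain h where h: "\<And>c. h c \<in> reps" "\<And>c. sim (el (h c)) (\<lambda>k. c)"
    by metis
  have "inj h"
  proof (rule injI)
    fix c d assume "h c = h d"
    then have "sim (\<lambda>k. c) (\<lambda>k. d)"
      using h(2) sim_sym sim_trans by metis
    then show "c = d"
      using eventually_happens'[OF G_nontrivial] unfolding sim_def by blast
  qed
  moreover have "range h \<subseteq> reps" using h(1) by blast
  ultimately show ?thesis
    using range_inj_infinite infinite_super by blast
qed

definition dec :: "nat \<Rightarrow> nat \<Rightarrow> nat" where
  "dec i = el (enumerate reps i)"

text \<open>Inverse to \<open>dec\<close> up to \<open>sim\<close>, and meaningful for functions
  that some element represents; \<open>dec_term\<close> ensures this for the values of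
  terms.\<close>

definition enc :: "(nat \<Rightarrow> nat) \<Rightarrow> nat" where
  "enc f = (SOME i. sim (dec i) f)"

lemma dec_inj: "sim (dec i) (dec j) \<Longrightarrow> i = j"
  unfolding dec_def
  using reps_inj[OF enumerate_in_set enumerate_in_set] reps_infinite enumerate_mono[of _ _ reps]
  by (metis linorder_neqE_nat order_less_irrefl)

lemma dec_el: "\<exists>i. sim (dec i) (el s)"
proof -
  obtain s' where s': "s' \<in> reps" "sim (el s') (el s)" using rep_exists by blast
  then obtain i where "enumerate reps i = s'"
    using enumerate_Ex[OF reps_infinite s'(1)] by auto
  with s' show ?thesis unfolding dec_def by blast
qed

definition DE :: "(nat \<Rightarrow> nat) \<Rightarrow> nat \<Rightarrow> nat \<Rightarrow> nat" where
  "DE e i = dec (e i)"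

text \<open>A task names finitely many elements, whereas environments are infinite. Beyond
  \<open>N\<close> the values become 0, which a formula with \<open>fbound \<phi> \<le> N\<close>
  cannot see.\<close>

definition trunc :: "nat \<Rightarrow> (nat \<Rightarrow> nat \<Rightarrow> nat) \<Rightarrow> nat \<Rightarrow> nat \<Rightarrow> nat" where
  "trunc N E i = (if i < N then E i else (\<lambda>k. 0))"

lemma DE_case_nat: "DE (case_nat v e) = case_nat (dec v) (DE e)"
  by (auto simp: DE_def fun_eq_iff split: nat.split)

lemma trunc_DE: "(\<lambda>i. if i < length (map (\<lambda>i. enumerate reps (e i)) [0..<N])
    then el (map (\<lambda>i. enumerate reps (e i)) [0..<N] ! i) else (\<lambda>k. 0)) = trunc N (DE e)"
  by (auto simp: trunc_def DE_def dec_def fun_eq_iff)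

lemma meets_DE: "\<exists>s. meets r T (trunc N (DE e)) (Y s)"
  using Y_meets[of T "map (\<lambda>i. enumerate reps (e i)) [0..<N]"] unfolding trunc_DE .

lemma sat_trunc: "fbound \<phi> \<le> N \<Longrightarrow> sat M (\<lambda>i. trunc N E i k) \<phi> = sat M (\<lambda>i. E i k) \<phi>"
  by (rule sat_cong) (simp add: trunc_def)

lemma forced_trunc: "fbound \<phi> \<le> N \<Longrightarrow> forced (trunc N E) \<phi> = forced E \<phi>"
  unfolding forced_def by (simp add: sat_trunc)

lemma case_nat_trunc: "case_nat f (trunc N E) = trunc (Suc N) (case_nat f E)"
  by (auto simp: trunc_def fun_eq_iff split: nat.split)

lemma tv_trunc: "tbound t \<le> N \<Longrightarrow> tv (\<lambda>i. trunc N E i k) t = tv (\<lambda>i. E i k) t"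
  using tval_cong[of t "\<lambda>i. trunc N E i k" "\<lambda>i. E i k" "std {}"] by (simp add: trunc_def)

lemma dec_term: "\<exists>i. sim (dec i) (\<lambda>k. tv (\<lambda>i. DE e i k) t)"
proof -
  obtain s where "sim (el s) (\<lambda>k. tv (\<lambda>i. trunc (tbound t) (DE e) i k) t)"
    using el_term[OF trunc_DE[symmetric]] by blast
  then show ?thesis
    using dec_el[of s] sim_trans by (metis (no_types, lifting) ext order_refl tv_trunc)
qed

lemma decided:
  assumes "Sig \<phi>"
  shows "forced (DE e) \<phi> \<or> forced (DE e) (Neg \<phi>)"
proof -
  obtain s where "meets r (Decide \<phi>) (trunc (fbound \<phi>) (DE e)) (Y s)"
    using meets_DE by blast
  then have "forced (trunc (fbound \<phi>) (DE e)) \<phi> \<or> forced (trunc (fbound \<phi>) (DE e)) (Neg \<phi>)"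
    using assms cforces_forced by auto
  then show ?thesis by (simp add: forced_trunc)
qed

lemma witnessed:
  assumes "Sig \<phi>" "forced (DE e) (ExB t \<phi>)"
  shows "\<exists>v. forced (DE (case_nat v e)) (And (Less (Var 0) (tlift t)) \<phi>)"
proof -
  define \<psi> where "\<psi> = And (Less (Var 0) (tlift t)) \<phi>"
  define N where "N = max (fbound (Neg (ExB t \<phi>))) (fbound \<psi>)"
  have N: "fbound (Neg (ExB t \<phi>)) \<le> N" "fbound \<psi> \<le> Suc N" unfolding N_def by simp_all
  obtain s where "meets r (Witness t \<phi>) (trunc N (DE e)) (Y s)"
    using meets_DE by blast
  then have "forced (trunc N (DE e)) (Neg (ExB t \<phi>)) \<or> forced (case_nat (el s) (trunc N (DE e))) \<psi>"
    using assms(1) cforces_forced unfolding \<psi>_def by auto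
  then have "forced (case_nat (el s) (DE e)) \<psi>"
    using assms(2) forced_Neg unfolding case_nat_trunc forced_trunc[OF N(1)] forced_trunc[OF N(2)] by blast
  moreover obtain v where "sim (dec v) (el s)" using dec_el by blast
  ultimately show ?thesis
    unfolding DE_case_nat \<psi>_def using forced_sim sim_sym by blast
qed

section \<open>The model\<close>

definition M :: "nat struct" where
  "M = \<lparr>zero_of = enc (\<lambda>k. 0), one_of = enc (\<lambda>k. 1), half_of = (\<lambda>i. enc (\<lambda>k. dec i k div 2)),
     len_of = (\<lambda>i. enc (\<lambda>k. blen (dec i k))), add_of = (\<lambda>i j. enc (\<lambda>k. dec i k + dec j k)),
     mul_of = (\<lambda>i j. enc (\<lambda>k. dec i k * dec j k)),
     smash_of = (\<lambda>i j. enc (\<lambda>k. 2 ^ (blen (dec i k) * blen (dec j k)))),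
     less_of = (\<lambda>i j. \<forall>\<^sub>F w in G. dec i (fst w) < dec j (fst w)),
     rel_of = (\<lambda>i j. \<forall>\<^sub>F w in G. (dec i (fst w), dec j (fst w)) \<in> snd w)\<rparr>"

lemma dec_enc_term: "sim (dec (enc (\<lambda>k. tv (\<lambda>i. DE e i k) t))) (\<lambda>k. tv (\<lambda>i. DE e i k) t)"
  unfolding enc_def by (rule someI_ex) (rule dec_term)

lemma tval_M: "sim (dec (tval M e t)) (\<lambda>k. tv (\<lambda>i. DE e i k) t)"
proof (induction t)
  case (Var i)
  then show ?case by (simp add: DE_def)
next
  case Zero
  then show ?case using dec_enc_term[of e Zero] by (simp add: M_def)
next
  case One
  then show ?case using dec_enc_term[of e One] by (simp add: M_def)
next
  case (Half t)
  have "sim (dec (tval M e (Half t))) (\<lambda>k. dec (tval M e t) k div 2)"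
    using dec_enc_term[of "\<lambda>_. tval M e t" "Half (Var 0)"] by (simp add: M_def DE_def)
  with Half show ?case unfolding sim_def by eventually_elim simp
next
  case (Len t)
  have "sim (dec (tval M e (Len t))) (\<lambda>k. blen (dec (tval M e t) k))"
    using dec_enc_term[of "\<lambda>_. tval M e t" "Len (Var 0)"] by (simp add: M_def DE_def)
  with Len show ?case unfolding sim_def by eventually_elim simp
next
  case (Add s t)
  have "sim (dec (tval M e (Add s t))) (\<lambda>k. dec (tval M e s) k + dec (tval M e t) k)"
    using dec_enc_term[of "case_nat (tval M e s) (\<lambda>_. tval M e t)" "Add (Var 0) (Var 1)"]
    by (simp add: M_def DE_def)
  with Add show ?case unfolding sim_def by eventually_elim simp
next
  case (Mul s t)
  have "sim (dec (tval M e (Mul s t))) (\<lambda>k. dec (tval M e s) k * dec (tval M e t) k)"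
    using dec_enc_term[of "case_nat (tval M e s) (\<lambda>_. tval M e t)" "Mul (Var 0) (Var 1)"]
    by (simp add: M_def DE_def)
  with Mul show ?case unfolding sim_def by eventually_elim simp
next
  case (Smash s t)
  have "sim (dec (tval M e (Smash s t)))
      (\<lambda>k. 2 ^ (blen (dec (tval M e s) k) * blen (dec (tval M e t) k)))"
    using dec_enc_term[of "case_nat (tval M e s) (\<lambda>_. tval M e t)" "Smash (Var 0) (Var 1)"]
    by (simp add: M_def DE_def)
  with Smash show ?case unfolding sim_def by eventually_elim simp
qed

lemma less_M: "less_of M i j \<longleftrightarrow> (\<forall>\<^sub>F w in G. dec i (fst w) < dec j (fst w))"
  by (simp add: M_def)

lemma rel_M: "rel_of M i j \<longleftrightarrow> (\<forall>\<^sub>F w in G. (dec i (fst w), dec j (fst w)) \<in> snd w)"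
  by (simp add: M_def)

section \<open>Los's theorem for \<open>Sig\<close> formulas\<close>

lemma truth_Eq: "sat M e (Eq s t) \<longleftrightarrow> forced (DE e) (Eq s t)"
proof -
  have "tval M e s = tval M e t \<longleftrightarrow> sim (dec (tval M e s)) (dec (tval M e t))"
    using dec_inj by auto
  also have "\<dots> \<longleftrightarrow> sim (\<lambda>k. tv (\<lambda>i. DE e i k) s) (\<lambda>k. tv (\<lambda>i. DE e i k) t)"
    by (intro sim_cong tval_M)
  finally show ?thesis by (simp add: sim_def forced_def)
qed

lemma truth_Less: "sat M e (Less s t) \<longleftrightarrow> forced (DE e) (Less s t)"
proof
  assume "sat M e (Less s t)"
  then have "\<forall>\<^sub>F w in G. dec (tval M e s) (fst w) < dec (tval M e t) (fst w)"
    by (simp add: less_M)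
  with tval_M[of e s] tval_M[of e t] show "forced (DE e) (Less s t)"
    unfolding sim_def forced_def by eventually_elim simp
next
  assume "forced (DE e) (Less s t)"
  with tval_M[of e s] tval_M[of e t]
  have "\<forall>\<^sub>F w in G. dec (tval M e s) (fst w) < dec (tval M e t) (fst w)"
    unfolding sim_def forced_def by eventually_elim simp
  then show "sat M e (Less s t)" by (simp add: less_M)
qed

lemma truth_Rel: "sat M e (Rel s t) \<longleftrightarrow> forced (DE e) (Rel s t)"
proof
  assume "sat M e (Rel s t)"
  then have "\<forall>\<^sub>F w in G. (dec (tval M e s) (fst w), dec (tval M e t) (fst w)) \<in> snd w"
    by (simp add: rel_M)
  with tval_M[of e s] tval_M[of e t] show "forced (DE e) (Rel s t)"
    unfolding sim_def forced_def by eventually_elim simp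
next
  assume "forced (DE e) (Rel s t)"
  with tval_M[of e s] tval_M[of e t]
  have "\<forall>\<^sub>F w in G. (dec (tval M e s) (fst w), dec (tval M e t) (fst w)) \<in> snd w"
    unfolding sim_def forced_def by eventually_elim simp
  then show "sat M e (Rel s t)" by (simp add: rel_M)
qed

lemma forced_And: "forced E (And \<phi> \<psi>) \<longleftrightarrow> forced E \<phi> \<and> forced E \<psi>"
  unfolding forced_def by (simp add: eventually_conj_iff)

lemma forced_mp: assumes "forced E (Imp \<phi> \<psi>)" "forced E \<phi>" shows "forced E \<psi>"
  using assms unfolding forced_def by eventually_elim simp

lemma forced_mono:
  assumes "forced E \<phi>" "\<And>e R. sat (std R) e \<phi> \<Longrightarrow> sat (std R) e \<psi>"
  shows "forced E \<psi>"
  using assms(1) unfolding forced_def by (rule eventually_mono) (rule assms(2))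

lemma truth_And: "(sat M e \<phi> \<longleftrightarrow> forced (DE e) \<phi>) \<Longrightarrow> (sat M e \<psi> \<longleftrightarrow> forced (DE e) \<psi>) \<Longrightarrow>
    sat M e (And \<phi> \<psi>) \<longleftrightarrow> forced (DE e) (And \<phi> \<psi>)"
  by (simp add: forced_And)

text \<open>\<open>G\<close> need not be an ultrafilter; a forced disjunction yields a forced
  disjunct through \<open>decided\<close>.\<close>

lemma truth_Or:
  assumes "Sig \<phi>" "sat M e \<phi> \<longleftrightarrow> forced (DE e) \<phi>" "sat M e \<psi> \<longleftrightarrow> forced (DE e) \<psi>"
  shows "sat M e (Or \<phi> \<psi>) \<longleftrightarrow> forced (DE e) (Or \<phi> \<psi>)"
proof
  assume "sat M e (Or \<phi> \<psi>)"
  then have "forced (DE e) \<phi> \<or> forced (DE e) \<psi>" using assms by simp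
  then show "forced (DE e) (Or \<phi> \<psi>)" by (auto elim: forced_mono)
next
  assume or: "forced (DE e) (Or \<phi> \<psi>)"
  have "forced (DE e) \<psi>" if "forced (DE e) (Neg \<phi>)"
    using or that unfolding forced_def by eventually_elim auto
  then have "forced (DE e) \<phi> \<or> forced (DE e) \<psi>"
    using decided[OF assms(1)] by blast
  then show "sat M e (Or \<phi> \<psi>)" using assms by simp
qed

lemma truth_Imp:
  assumes "Sig \<phi>" "Sig \<psi>" "sat M e \<phi> \<longleftrightarrow> forced (DE e) \<phi>" "sat M e \<psi> \<longleftrightarrow> forced (DE e) \<psi>"
  shows "sat M e (Imp \<phi> \<psi>) \<longleftrightarrow> forced (DE e) (Imp \<phi> \<psi>)"
proof
  assume "sat M e (Imp \<phi> \<psi>)"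
  then have "forced (DE e) (Neg \<phi>) \<or> forced (DE e) \<psi>"
    using assms decided[OF assms(1), of e] by auto
  then show "forced (DE e) (Imp \<phi> \<psi>)" by (auto elim: forced_mono)
next
  assume "forced (DE e) (Imp \<phi> \<psi>)"
  then show "sat M e (Imp \<phi> \<psi>)" using assms forced_mp by simp
qed

lemma less_M_forced: "less_of M x (tval M e t) \<longleftrightarrow> forced (DE (case_nat x e)) (Less (Var 0) (tlift t))"
  using truth_Less[of "case_nat x e" "Var 0" "tlift t"] by simp

text \<open>From right to left genericity enters: \<open>witnessed\<close> turns separate witnesses
  in the worlds into one element of the model.\<close>

lemma truth_ExB:
  assumes "Sig \<phi>" "\<And>x. sat M (case_nat x e) \<phi> \<longleftrightarrow> forced (DE (case_nat x e)) \<phi>"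
  shows "sat M e (ExB t \<phi>) \<longleftrightarrow> forced (DE e) (ExB t \<phi>)"
proof
  assume "sat M e (ExB t \<phi>)"
  then obtain x where "forced (DE (case_nat x e)) (And (Less (Var 0) (tlift t)) \<phi>)"
    unfolding sat_ExB less_M_forced assms(2) forced_And by blast
  then show "forced (DE e) (ExB t \<phi>)"
    unfolding forced_def by eventually_elim (auto simp: sat_ExB DE_case_nat case_nat_app)
next
  assume "forced (DE e) (ExB t \<phi>)"
  then show "sat M e (ExB t \<phi>)"
    unfolding sat_ExB less_M_forced assms(2) using witnessed[OF assms(1)] forced_And by blast
qed

text \<open>If the formula is not forced, its negation is, and this is an existential statement
  about \<open>Neg \<phi>\<close>, which is again \<open>Sig\<close> because \<phi> is sharply
  bounded. Its witness in the model is a counterexample.\<close>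

lemma truth_AllB:
  assumes sharp: "sharply_bounded \<phi>"
    and IH: "\<And>x. sat M (case_nat x e) \<phi> \<longleftrightarrow> forced (DE (case_nat x e)) \<phi>"
  shows "sat M e (AllB (Len t) \<phi>) \<longleftrightarrow> forced (DE e) (AllB (Len t) \<phi>)"
proof
  assume L: "sat M e (AllB (Len t) \<phi>)"
  show "forced (DE e) (AllB (Len t) \<phi>)"
  proof (rule ccontr)
    assume "\<not> ?thesis"
    then have "forced (DE e) (Neg (AllB (Len t) \<phi>))"
      using decided[OF Sig.sharp, OF sharply_bounded.intros(8), OF sharp] by blast
    then have "forced (DE e) (ExB (Len t) (Neg \<phi>))"
      by (rule forced_mono) (simp add: sat_ExB sat_AllB)
    moreover have "Sig (Neg \<phi>)"
      using sharp by (intro Sig.sharp sharply_bounded.intros)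
    ultimately obtain v where v: "forced (DE (case_nat v e)) (Less (Var 0) (tlift (Len t)))"
      "forced (DE (case_nat v e)) (Neg \<phi>)"
      using witnessed forced_And by blast
    then have "forced (DE (case_nat v e)) \<phi>"
      using L unfolding sat_AllB less_M_forced IH by blast
    then show False using v(2) forced_Neg by blast
  qed
next
  assume R: "forced (DE e) (AllB (Len t) \<phi>)"
  show "sat M e (AllB (Len t) \<phi>)"
    unfolding sat_AllB less_M_forced IH
  proof (intro HOL.allI HOL.impI)
    fix x assume "forced (DE (case_nat x e)) (Less (Var 0) (tlift (Len t)))"
    with R show "forced (DE (case_nat x e)) \<phi>"
      unfolding forced_def by eventually_elim (auto simp: sat_AllB DE_case_nat case_nat_app)
  qed
qed

lemma truth_Falsum: "sat M e Falsum \<longleftrightarrow> forced (DE e) Falsum"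
  using G_nontrivial by (simp add: forced_def trivial_limit_def)

lemma truth_sharply_bounded: "sharply_bounded \<phi> \<Longrightarrow> sat M e \<phi> \<longleftrightarrow> forced (DE e) \<phi>"
proof (induction arbitrary: e rule: sharply_bounded.induct)
  case 1 show ?case by (rule truth_Falsum)
next
  case (2 s t) show ?case by (rule truth_Eq)
next
  case (3 s t) show ?case by (rule truth_Less)
next
  case (4 s t) show ?case by (rule truth_Rel)
next
  case (5 \<phi> \<psi>) then show ?case by (intro truth_And)
next
  case (6 \<phi> \<psi>) then show ?case by (intro truth_Or Sig.sharp)
next
  case (7 \<phi> \<psi>) then show ?case by (intro truth_Imp Sig.sharp)
next
  case (8 \<phi> t) then show ?case by (intro truth_AllB)
next
  case (9 \<phi> t) then show ?case by (intro truth_ExB Sig.sharp)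
qed

lemma truth: "Sig \<phi> \<Longrightarrow> sat M e \<phi> \<longleftrightarrow> forced (DE e) \<phi>"
proof (induction arbitrary: e rule: Sig.induct)
  case (sharp \<phi>) then show ?case by (rule truth_sharply_bounded)
next
  case (conj \<phi> \<psi>) then show ?case by (intro truth_And)
next
  case (disj \<phi> \<psi>) then show ?case by (intro truth_Or)
next
  case (exb \<phi> t) then show ?case by (intro truth_ExB)
qed

section \<open>The axioms in the model\<close>

lemma M_BASIC: "\<phi> \<in> BASIC \<Longrightarrow> sat M e \<phi>"
  by (simp add: truth_sharply_bounded BASIC_sharply forced_def std_BASIC)

lemma sim_zero_M: "sim (dec (zero_of M)) (\<lambda>k. 0)"
  using tval_M[of "\<lambda>_. 0" Zero] by simp

lemma sim_succ_M: "sim (dec (add_of M x (one_of M))) (\<lambda>k. dec x k + 1)"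
  using tval_M[of "\<lambda>_. x" "Add (Var 0) One"] by (simp add: DE_def)

text \<open>A counterexample \<open>a\<close> rules out the second outcome of the task
  \<open>Induct\<close>; the first contradicts the base case, and the third contradicts the
  induction step at the new element.\<close>

lemma M_IND:
  assumes \<phi>: "Sig \<phi>"
  shows "sat M e (IND \<phi>)"
proof -
  have env: "(\<lambda>i. tval M (case_nat x e) (case_nat (Add (Var 0) One) (\<lambda>i. Var (Suc i)) i)) =
      case_nat (add_of M x (one_of M)) e" for x
    by (auto simp: fun_eq_iff split: nat.split)
  have "sat M (case_nat a e) \<phi>"
    if base: "sat M (case_nat (zero_of M) e) \<phi>"
      and step: "\<And>x. sat M (case_nat x e) \<phi> \<Longrightarrow> sat M (case_nat (add_of M x (one_of M)) e) \<phi>" for a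
  proof (rule ccontr)
    assume "\<not> sat M (case_nat a e) \<phi>"
    then have a: "\<not> forced (case_nat (dec a) (DE e)) \<phi>"
      using truth[OF \<phi>] by (simp add: DE_case_nat)
    define N where "N = fbound \<phi>"
    obtain s where "meets r (Induct \<phi>) (trunc (Suc N) (DE (case_nat a e))) (Y s)"
      using meets_DE by blast
    moreover have "shift (trunc (Suc N) (DE (case_nat a e))) = trunc N (DE e)"
      "trunc (Suc N) (DE (case_nat a e)) 0 = dec a"
      by (auto simp: shift_def trunc_def DE_def fun_eq_iff)
    ultimately have "forced (case_nat (\<lambda>k. 0) (trunc N (DE e))) (Neg \<phi>) \<or>
        forced (case_nat (dec a) (trunc N (DE e))) \<phi> \<or>
        forced (case_nat (el s) (trunc N (DE e))) \<phi> \<and>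
        forced (case_nat (\<lambda>k. el s k + 1) (trunc N (DE e))) (Neg \<phi>)"
      using \<phi> cforces_forced by auto
    moreover have "fbound \<phi> \<le> Suc N" "fbound (Neg \<phi>) \<le> Suc N"
      unfolding N_def by simp_all
    ultimately consider "forced (case_nat (\<lambda>k. 0) (DE e)) (Neg \<phi>)"
      | "forced (case_nat (el s) (DE e)) \<phi>" "forced (case_nat (\<lambda>k. el s k + 1) (DE e)) (Neg \<phi>)"
      unfolding case_nat_trunc using a by (auto simp only: forced_trunc)
    then show False
    proof cases
      case 1
      then have "forced (DE (case_nat (zero_of M) e)) (Neg \<phi>)"
        unfolding DE_case_nat by (rule forced_sim) (rule sim_sym[OF sim_zero_M])
      then show False using base truth[OF \<phi>] forced_Neg by blast
    next
      case 2
      obtain x where x: "sim (dec x) (el s)" using dec_el by blast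
      have "forced (DE (case_nat x e)) \<phi>"
        unfolding DE_case_nat using 2(1) sim_sym[OF x] by (rule forced_sim)
      then have "sat M (case_nat (add_of M x (one_of M)) e) \<phi>"
        using step truth[OF \<phi>] by blast
      moreover have "sim (\<lambda>k. el s k + 1) (dec (add_of M x (one_of M)))"
        using x sim_succ_M[of x] unfolding sim_def by eventually_elim simp
      then have "forced (DE (case_nat (add_of M x (one_of M)) e)) (Neg \<phi>)"
        unfolding DE_case_nat by (rule forced_sim[OF 2(2)])
      ultimately show False using truth[OF \<phi>] forced_Neg by blast
    qed
  qed
  then show ?thesis
    by (simp add: IND_def sat_inst sat_subst env)
qed

lemma M_T12: "models M T12"
  unfolding models_def T12_def using M_BASIC M_IND Sigma_b1_Sig by auto

section \<open>The pigeonhole principle in the model\<close>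

definition n :: nat where
  "n = (SOME i. sim (dec i) id)"

lemma sim_n: "sim (dec n) id"
  unfolding n_def by (rule someI_ex) (rule dec_el[of 0, unfolded Y0])

lemma sharply_bounded_leq_pow: "sharply_bounded (leq_pow r s t)"
  unfolding leq_pow_def
  by (cases "quotient_of r") (auto intro!: sharply_bounded.intros)

text \<open>This confronts facts of the model with what the condition at a prescribed stage
  \<open>s\<close> excludes in all of its worlds.\<close>

lemma forced_worlds:
  assumes "eventually Q G"
  shows "\<exists>w\<in>worlds s. Q w"
proof -
  have "eventually (\<lambda>w. w \<in> worlds s) G"
    unfolding eventually_G by blast
  with assms have "eventually (\<lambda>w. w \<in> worlds s \<and> Q w) G"
    by eventually_elim simp
  then show ?thesis
    using eventually_happens'[OF G_nontrivial] by blast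
qed

text \<open>A failure of \<open>PHP\<close> in the model excludes all outcomes of the task
  \<open>Pigeon\<close> but the last, whose new element is a pigeon without a hole and so
  contradicts totality.\<close>

lemma M_PHP_below:
  assumes \<phi>: "Sig \<phi>"
  shows "sat M (case_nat n e) (PHP_below r \<phi>)"
proof -
  define \<psi> where "\<psi> = app2 4 \<phi> (Var 0) (Var 1)"
  have \<psi>: "Sig \<psi>" unfolding \<psi>_def using \<phi> by (rule Sig_app2)
  define J1 where "J1 = php_inj (Add (Var 0) One) (Var 0) \<psi>"
  define J2 where "J2 = php_fun (Add (Var 0) One) (Var 0) \<psi>"
  have "sat M (case_nat m (case_nat n e)) (PHP (Add (Var 0) One) (Var 0) \<psi>)"
    if m: "sat M (case_nat m (case_nat n e)) (leq_pow r (Var 0) (Var 1))" for m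
  proof (rule ccontr)
    define e' where "e' = case_nat m (case_nat n e)"
    assume "\<not> ?thesis"
    then have J: "\<not> sat M e' J1" "\<not> sat M e' J2"
      and total: "\<And>a. less_of M a (tval M e' (Add (Var 0) One)) \<Longrightarrow>
        \<exists>b. less_of M b (tval M e' (Var 0)) \<and> sat M (case_nat a (case_nat b e')) \<psi>"
      unfolding sat_PHP J1_def J2_def e'_def by blast+
    \<comment> \<open>\<open>Suc\<close> ensures \<open>N > 0\<close>, so that truncation keeps the
      value \<open>m\<close> of \<open>Var 0\<close>.\<close>
    define N where "N = Suc (max (fbound \<psi>) (max (fbound J1) (fbound J2)))"
    define E where "E = trunc N (DE e')"
    have N: "fbound \<psi> \<le> N" "fbound J1 \<le> N" "fbound J2 \<le> N" "N > 0"
      unfolding N_def by simp_all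
    have E0: "E 0 = dec m"
      using N(4) by (simp add: E_def trunc_def DE_def e'_def)
    obtain s where s: "meets r (Pigeon \<psi>) E (Y s)"
      unfolding E_def using meets_DE by blast
    define g where "g = el s"
    define A where "A = fst (snd (Y s))"
    define p where "p = snd (snd (Y s))"
    have Y: "Y s = (g, A, p)" unfolding g_def A_def p_def by simp
    have worlds: "k \<in> A \<and> maxinj k R \<and> p k \<subseteq> R" if "(k, R) \<in> worlds s" for k R
      using that unfolding worlds_def A_def p_def by simp
    have alternatives: "(\<forall>k\<in>A. \<not> below_pow r (E 0 k) k) \<or> cforces (Y s) E J1 \<or> cforces (Y s) E J2 \<or>
     (\<forall>k\<in>A. g k \<le> E 0 k \<and> (\<forall>R. maxinj k R \<longrightarrow> p k \<subseteq> R \<longrightarrow>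
        (\<forall>b<E 0 k. \<not> sat (std R) (case_nat (g k) (case_nat b (\<lambda>i. E i k))) \<psi>)))"
    proof -
      have "meets r (Pigeon \<psi>) E (g, A, p)" using s unfolding Y .
      then show ?thesis
        using \<psi> unfolding meets.simps prod.case J1_def J2_def unfolding Y[symmetric] by blast
    qed
    have le: "\<forall>\<^sub>F w in G. below_pow r (dec m (fst w)) (fst w)"
    proof -
      have "forced (DE e') (leq_pow r (Var 0) (Var 1))"
        using m truth_sharply_bounded[OF sharply_bounded_leq_pow] unfolding e'_def by blast
      with sim_n show ?thesis
        unfolding forced_def sim_def
        by eventually_elim (simp add: sat_leq_pow e'_def DE_def)
    qed
    have "\<not> (\<forall>k\<in>A. \<not> below_pow r (E 0 k) k)"
      using forced_worlds[OF le, of s] worlds unfolding E0 by force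
    moreover have "\<not> cforces (Y s) E J1"
      using J(1) cforces_forced[of s E J1] truth[OF Sig_php_inj[OF \<psi>]] forced_trunc[OF N(2)]
      unfolding E_def J1_def by blast
    moreover have "\<not> cforces (Y s) E J2"
      using J(2) cforces_forced[of s E J2] truth[OF Sig_php_fun[OF \<psi>]] forced_trunc[OF N(3)]
      unfolding E_def J2_def by blast
    ultimately have dead: "g k \<le> dec m k"
      "maxinj k R \<Longrightarrow> p k \<subseteq> R \<Longrightarrow> b < dec m k \<Longrightarrow>
        \<not> sat (std R) (case_nat (g k) (case_nat b (\<lambda>i. E i k))) \<psi>" if "k \<in> A" for k R b
      using alternatives that unfolding E0 by blast+
    obtain a where a: "sim (dec a) (g)" using dec_el[of s] unfolding g_def by blast
    have "\<forall>\<^sub>F w in G. g (fst w) \<le> dec m (fst w)"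
      unfolding eventually_G using worlds dead(1) by (intro HOL.exI[of _ s]) auto
    with a have "forced (DE (case_nat a e')) (Less (Var 0) (tlift (Add (Var 0) One)))"
      unfolding forced_def sim_def by eventually_elim (simp add: DE_def e'_def)
    then obtain b where b: "less_of M b (tval M e' (Var 0))" "sat M (case_nat a (case_nat b e')) \<psi>"
      using total unfolding less_M_forced by blast
    have "forced (case_nat (dec a) (case_nat (dec b) (DE e'))) \<psi>"
      using b(2) truth[OF \<psi>] by (simp add: DE_case_nat)
    moreover have "\<forall>\<^sub>F w in G. dec b (fst w) < dec m (fst w)"
      using b(1) by (simp add: less_M e'_def)
    ultimately have "\<forall>\<^sub>F w in G. dec b (fst w) < dec m (fst w) \<and>
        sat (std (snd w)) (case_nat (g (fst w)) (case_nat (dec b (fst w)) (\<lambda>i. DE e' i (fst w)))) \<psi>"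
      using a unfolding forced_def sim_def by eventually_elim (simp add: case_nat_app)
    \<comment> \<open>The hole \<open>b\<close> that the model assigns to the new pigeon shows up in
      a world of stage \<open>s\<close>, where the condition forbids it.\<close>
    from forced_worlds[OF this, of s] obtain k R where kR: "(k, R) \<in> worlds s" "dec b k < dec m k"
      "sat (std R) (case_nat (g k) (case_nat (dec b k) (\<lambda>i. DE e' i k))) \<psi>"
      by auto
    have "sat (std R) (case_nat (g k) (case_nat (dec b k) (\<lambda>i. E i k))) \<psi> =
        sat (std R) (case_nat (g k) (case_nat (dec b k) (\<lambda>i. DE e' i k))) \<psi>"
      by (rule sat_cong) (use N(1) in \<open>auto simp: E_def trunc_def split: nat.split\<close>)
    then show False
      using dead(2)[of k R "dec b k"] worlds[OF kR(1)] kR(2,3) by blast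
  qed
  then show ?thesis
    by (simp add: PHP_below_def \<psi>_def)
qed

text \<open>Every world is a partial injection, which excludes both kinds of collision. A pigeon
  without a hole would be recognised at some stage, yet a condition with fewer than \<open>k\<close>
  pairs can still send it to a free hole.\<close>

lemma M_not_PHP: "\<not> sat M (case_nat n e) (PHP (Add (Var 0) One) (Var 0) (Rel (Var 0) (Var 1)))"
proof
  define \<rho> where "\<rho> = Rel (Var 0) (Var 1)"
  have \<rho>: "Sig \<rho>" unfolding \<rho>_def by (intro Sig.sharp sharply_bounded.intros)
  define e' where "e' = case_nat n e"
  assume "sat M (case_nat n e) (PHP (Add (Var 0) One) (Var 0) (Rel (Var 0) (Var 1)))"
  then consider (dead) a where "less_of M a (tval M e' (Add (Var 0) One))"
      "\<And>b. less_of M b (tval M e' (Var 0)) \<Longrightarrow> \<not> rel_of M a b"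
    | (inj) "sat M e' (php_inj (Add (Var 0) One) (Var 0) \<rho>)"
    | (func) "sat M e' (php_fun (Add (Var 0) One) (Var 0) \<rho>)"
    unfolding sat_PHP e'_def \<rho>_def by auto
  then show False
  proof cases
    case inj
    then have "forced (DE e') (php_inj (Add (Var 0) One) (Var 0) \<rho>)"
      using truth[OF Sig_php_inj[OF \<rho>]] by blast
    with maxinj_G have "\<forall>\<^sub>F w in G. False"
      unfolding forced_def
      by eventually_elim (auto simp: sat_php_inj \<rho>_def maxinj_def pinj_def)
    then show False using G_nontrivial by (simp add: trivial_limit_def)
  next
    case func
    then have "forced (DE e') (php_fun (Add (Var 0) One) (Var 0) \<rho>)"
      using truth[OF Sig_php_fun[OF \<rho>]] by blast
    with maxinj_G have "\<forall>\<^sub>F w in G. False"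
      unfolding forced_def
      by eventually_elim (auto simp: sat_php_fun \<rho>_def maxinj_def pinj_def)
    then show False using G_nontrivial by (simp add: trivial_limit_def)
  next
    case dead
    \<comment> \<open>In the bound, \<open>Var 1\<close> is \<open>n\<close>; under the quantifier,
      \<open>Var 1\<close> is \<open>a\<close> and \<open>Var 0\<close> is the hole.\<close>
    define \<psi> where "\<psi> = ExB (Var 1) (Rel (Var 1) (Var 0))"
    have \<psi>: "Sig \<psi>" unfolding \<psi>_def by (intro Sig.exb Sig.sharp sharply_bounded.intros)
    have "\<not> sat M (case_nat a e') \<psi>"
      using dead(2) by (auto simp: \<psi>_def sat_ExB)
    then have "forced (DE (case_nat a e')) (Neg \<psi>)"
      using truth[OF \<psi>] decided[OF \<psi>] by blast
    moreover have "forced (DE (case_nat a e')) (Less (Var 0) (tlift (Add (Var 0) One)))"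
      using dead(1) unfolding less_M_forced .
    ultimately have "\<forall>\<^sub>F w in G. dec a (fst w) \<le> fst w \<and> (\<forall>b<fst w. (dec a (fst w), b) \<notin> snd w)"
      using sim_n unfolding forced_def sim_def
      by eventually_elim (auto simp: \<psi>_def sat_ExB DE_def e'_def)
    then obtain s where s: "\<And>k R. (k, R) \<in> worlds s \<Longrightarrow> dec a k \<le> k \<and> (\<forall>b<k. (dec a k, b) \<notin> R)"
      unfolding eventually_G by fastforce
    obtain g A p where y: "Y s = (g, A, p)" by (cases "Y s")
    have p: "infinite A" "pinj k (p k)" "polylog (\<lambda>k. card (p k))" for k
      using Y_good[of s] unfolding y good_def by auto
    \<comment> \<open>Polylogarithmic size leaves a hole free at every large index, and the infinite
      set \<open>A\<close> contains one.\<close>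
    obtain K where K: "\<And>k. k \<ge> K \<Longrightarrow> card (p k) < k"
      using polylog_less[OF p(3)] by blast
    obtain k where k: "k \<in> A" "k \<ge> K"
      using p(1) unfolding infinite_nat_iff_unbounded_le by blast
    have "worlds s = {(k, R). k \<in> A \<and> maxinj k R \<and> p k \<subseteq> R}"
      unfolding worlds_def y by simp
    then have s': "dec a k \<le> k \<and> (\<forall>b<k. (dec a k, b) \<notin> R)" if "maxinj k R" "p k \<subseteq> R" for R
      using s[of k R] that k(1) by simp
    obtain R0 where "maxinj k R0" "p k \<subseteq> R0" using maxinj_extends[OF p(2)] by blast
    then have "dec a k \<le> k" using s' by blast
    then obtain f where f: "p k \<subseteq> f" "pinj k f" "dec a k \<in> fst ` f"
      using cover_pigeon[OF p(2) _ K[OF k(2)]] by blast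
    obtain R where R: "maxinj k R" "f \<subseteq> R" using maxinj_extends[OF f(2)] by blast
    obtain b where "(dec a k, b) \<in> R" using f(3) R(2) by fastforce
    moreover from this have "b < k" using R(1) unfolding maxinj_def pinj_def by blast
    ultimately show False using s'[OF R(1)] f(1) R(2) by blast
  qed
qed

end

theorem theorem4p16:
  fixes \<epsilon> :: rat
  assumes "\<epsilon> > 0"
  shows "\<exists>M :: nat struct. models M T12 \<and>
    (\<exists>n. \<forall>e. (\<forall>\<phi>. Delta_b1 \<phi> \<longrightarrow> sat M (case_nat n e) (PHP_below (1 - \<epsilon>) \<phi>)) \<and>
             sat M (case_nat n e) (Neg (PHP (Add (Var 0) One) (Var 0) (Rel (Var 0) (Var 1)))))"
proof -
  have "1 - \<epsilon> < 1" using assms by simp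
  from generic_conditions[OF this] obtain Y where "fst (Y 0) = id" "\<And>s. good (Y s)"
    "\<And>s. extends (Y s) (Y (Suc s))"
    "\<And>T js. \<exists>s. meets (1 - \<epsilon>) T (\<lambda>i. if i < length js then fst (Y (js ! i)) else (\<lambda>k. 0)) (Y s)"
    by blast
  then interpret generic "1 - \<epsilon>" Y
    by unfold_locales
  have "sat M (case_nat n e) (PHP_below (1 - \<epsilon>) \<phi>)" if "Delta_b1 \<phi>" for e \<phi>
    using that Sigma_b1_Sig by (intro M_PHP_below) (auto simp: Delta_b1_def)
  moreover have "sat M (case_nat n e) (Neg (PHP (Add (Var 0) One) (Var 0) (Rel (Var 0) (Var 1))))" for e
    using M_not_PHP by simp
  ultimately show ?thesis
    using M_T12 by blast
qed

end
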